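(* For every link diagram $D$ and all $i,j$ there is a short exact sequence of Khovanov homology $$0\to H_{i+2,j+4}(D)\xrightarrow{\ \alpha_h\ }H_{i,j}(D\#D_h)\xrightarrow{\ \beta_h\ }H_{i-2,j-4}(D)\to 0,$$ where $D\#D_h$ is the connected sum of $D$ with the Hopf link diagram $D_h$, and $\alpha_h$, $\beta_h$ are induced by the following maps on enhanced states. $\alpha_h$ sends an enhanced state $S$ of $D$ to the enhanced state of $D\#D_h$ which has negative markers at both crossings of $D_h$, has the negative sign on the additional small trivial circle, and agrees with $S$ elsewhere. $\beta_h$ is the projection sending an enhanced state of $D\#D_h$ with positive markers at both crossings of $D_h$ and positive sign on the additional small trivial circle to the corresponding enhanced state of $D$, and all other enhanced states to $0$. The statement holds for homology with coefficients in any ring $\mathcal{R}$, not just $\mathbb{Z}$.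
   Context: Diagrams: $D$ is a diagram in the plane (disc) of an unoriented framed link, with ordered crossings. At each crossing there are two smoothings: the positive-marker smoothing ($A$-smoothing) joins the two local regions swept out when the overcrossing arc is rotated counterclockwise until it meets the undercrossing arc; the negative-marker smoothing joins the other two regions. A Kauffman state $s$ assigns $+1$ or $-1$ (a positive or negative marker) to each crossing; $D_s$ is the system of circles obtained by smoothing all crossings according to $s$, and $\sigma(s)$ is the number of positive minus the number of negative markers. Khovanov homology: an enhanced state $S$ is a Kauffman state $s$ with a sign $+$ or $-$ on each circle of $D_s$; put $\sigma(S)=\sigma(s)$ and $\tau(S)=\#\{\text{positive circles}\}-\#\{\text{negative circles}\}$. $\mathcal{C}_{i,j}(D)$ is the free abelian group (free $\mathcal R$-module, for coefficients in $\mathcal R$) on enhanced states with $\sigma(S)=i$ and $\sigma(S)+2\tau(S)=j$. The differential $d_{i,j}:\mathcal{C}_{i,j}(D)\to\mathcal{C}_{i-2,j}(D)$ is $d(S)=\sum_{S'}(-1)^{t(S:S')}[S:S']S'$, the sum over enhanced states $S'$ generating $\mathcal C_{i-2,j}(D)$, where $[S:S']=1$ if the markers of $S$ and $S'$ differ at exactly one crossing $v$ and all circles not touching $v$ have the same sign in $S$ and $S'$, and $[S:S']=0$ otherwise; $t(S:S')$ is the number of negative markers of $S$ at crossings bigger than $v$ in the ordering. $H_{i,j}(D)=\ker(d_{i,j})/\mathrm{im}(d_{i+2,j})$. Hopf link addition: $D_h$ is the standard two-crossing diagram of the Hopf link. $D\#D_h$ is obtained from $D$ by adding a small circle meeting one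 arc of $D$ in exactly two crossings, the arc passing over the circle at one crossing and under it at the other. The two new crossings are placed first in the ordering of crossings of $D\#D_h$, followed by the crossings of $D$ in their order. When both new crossings have the same marker (both positive or both negative), smoothing them yields (up to planar isotopy) the arc of $D$ together with one additional small trivial circle, so that enhanced states of this type correspond to enhanced states of $D$ together with a sign on the small circle. *)

theory Defs
  imports "HOL-Algebra.Exact_Sequence"
begin

section \<open>Link diagrams\<close>

text \<open>
  An unoriented diagram is given by a planar-diagram code over arc labels. A crossing is the list
  \<open>[a, b, c, d]\<close> of the four arcs at it, read counterclockwise, where \<open>a\<close> and \<open>c\<close> belong to
  the undercrossing strand (so \<open>b\<close> and \<open>d\<close> to the overcrossing one); the list of crossings
  carries their ordering. Components without crossings are recorded by one label each, in \<open>loops\<close>.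
  The code determines the diagram up to isotopy of the sphere and the relative position of
  disconnected parts, neither of which enters the Khovanov complex.
\<close>

record link_diagram =
  crossings :: "nat list list"
  loops :: "nat set"

abbreviation ncr :: "link_diagram \<Rightarrow> nat" where
  "ncr D \<equiv> length (crossings D)"

definition edges :: "link_diagram \<Rightarrow> nat set" where
  "edges D = set (concat (crossings D))"

definition arcs :: "link_diagram \<Rightarrow> nat set" where
  "arcs D = edges D \<union> loops D"

definition ends :: "link_diagram \<Rightarrow> (nat \<times> nat) set" where
  "ends D = {..<ncr D} \<times> {..<4}"

definition arc_at :: "link_diagram \<Rightarrow> nat \<times> nat \<Rightarrow> nat" where
  "arc_at D = (\<lambda>(k, p). crossings D ! k ! p)"

text \<open>The classes of \<open>A\<close> under the equivalence relation generated by \<open>r \<subseteq> A \<times> A\<close>.\<close>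

definition generated_classes :: "'a set \<Rightarrow> 'a rel \<Rightarrow> 'a set set" where
  "generated_classes A r = A // (r \<union> r\<inverse>)\<^sup>*"

definition components :: "link_diagram \<Rightarrow> nat set set" where
  "components D = generated_classes (edges D) {(a, b). \<exists>x\<in>set (crossings D). a \<in> set x \<and> b \<in> set x}"

text \<open>
  A region of the complement of the 4-valent graph is a class of corners, the corner \<open>(k, p)\<close>
  lying between the ends \<open>p\<close> and \<open>p + 1\<close> (mod 4) at crossing \<open>k\<close>. Leaving \<open>k\<close> by its end
  \<open>p\<close> and arriving at the end \<open>p'\<close> of \<open>k'\<close>, the region on the left has the corner \<open>(k, p)\<close>
  at the start and \<open>(k', p' - 1)\<close> on arrival.
\<close>

definition faces :: "link_diagram \<Rightarrow> (nat \<times> nat) set set" where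
  "faces D = generated_classes (ends D)
     {((k, p), (k', (p' + 3) mod 4)) | k p k' p'.
        (k, p) \<in> ends D \<and> (k', p') \<in> ends D \<and> (k, p) \<noteq> (k', p') \<and>
        arc_at D (k, p) = arc_at D (k', p')}"

text \<open>
  Planarity is the Euler formula \<open>V - E + F = 2C\<close> with \<open>C\<close> the number of connected components:
  every component contributes at most 2, and exactly 2 if and only if it has genus 0.
\<close>

definition planar :: "link_diagram \<Rightarrow> bool" where
  "planar D \<longleftrightarrow> ncr D + card (faces D) = card (edges D) + 2 * card (components D)"

definition is_diagram :: "link_diagram \<Rightarrow> bool" where
  "is_diagram D \<longleftrightarrow>
     (\<forall>x\<in>set (crossings D). length x = 4) \<and>
     (\<forall>a\<in>edges D. count_list (concat (crossings D)) a = 2) \<and>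
     finite (loops D) \<and> loops D \<inter> edges D = {} \<and>
     planar D"

section \<open>Kauffman states and enhanced states\<close>

text \<open>
  A state is the list of markers, \<open>True\<close> being the positive one. Rotating the overcrossing arc
  (ends \<open>1\<close>, \<open>3\<close>) counterclockwise sweeps the corners between ends \<open>1\<close>, \<open>2\<close> and between
  ends \<open>3\<close>, \<open>0\<close>; once these are joined, end \<open>0\<close> is connected to \<open>1\<close> and end \<open>2\<close> to \<open>3\<close>.
\<close>

definition smoothing :: "nat list \<Rightarrow> bool \<Rightarrow> nat rel" where
  "smoothing x m = (if m then {(x!0, x!1), (x!2, x!3)} else {(x!1, x!2), (x!3, x!0)})"

text \<open>A circle of \<open>D\<^sub>s\<close> is represented by the set of arcs of \<open>D\<close> that it runs along.\<close>

definition circles :: "link_diagram \<Rightarrow> bool list \<Rightarrow> nat set set" where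
  "circles D s = generated_classes (arcs D) (\<Union>k<ncr D. smoothing (crossings D ! k) (s ! k))"

text \<open>An enhanced state is a state together with the set of its positive circles.\<close>

type_synonym estate = "bool list \<times> nat set set"

definition enhanced_states :: "link_diagram \<Rightarrow> estate set" where
  "enhanced_states D = {(s, P). length s = ncr D \<and> P \<subseteq> circles D s}"

definition sigma :: "estate \<Rightarrow> int" where
  "sigma = (\<lambda>(s, P). (\<Sum>m\<leftarrow>s. if m then 1 else -1))"

definition tau :: "link_diagram \<Rightarrow> estate \<Rightarrow> int" where
  "tau D = (\<lambda>(s, P). int (card P) - int (card (circles D s - P)))"

definition generators :: "link_diagram \<Rightarrow> int \<Rightarrow> int \<Rightarrow> estate set" where
  "generators D i j = {S \<in> enhanced_states D. sigma S = i \<and> sigma S + 2 * tau D S = j}"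

section \<open>Khovanov homology\<close>

text \<open>
  Coefficients are taken in an arbitrary ring, neither commutative nor unital. A chain is its
  coefficient function; all chain modules are left modules and are written as groups in the
  multiplicative notation of the algebra library.
\<close>

definition chains :: "link_diagram \<Rightarrow> int \<Rightarrow> int \<Rightarrow> (estate \<Rightarrow> 'r::ring) monoid" where
  "chains D i j =
     \<lparr>carrier = {c. \<forall>S. S \<notin> generators D i j \<longrightarrow> c S = 0},
      mult = (\<lambda>c c' S. c S + c' S),
      one = (\<lambda>S. 0)\<rparr>"

text \<open>
  \<open>incident D v S S'\<close> says that \<open>[S:S'] = 1\<close> with \<open>v\<close> the crossing at which the markers
  differ; for given \<open>S\<close> and \<open>S'\<close> there is at most one such \<open>v\<close>.
\<close>

definition incident :: "link_diagram \<Rightarrow> nat \<Rightarrow> estate \<Rightarrow> estate \<Rightarrow> bool" where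
  "incident D v = (\<lambda>(s, P) (s', P').
     v < ncr D \<and> (\<forall>k<ncr D. s ! k \<noteq> s' ! k \<longleftrightarrow> k = v) \<and>
     {c \<in> P. c \<inter> set (crossings D ! v) = {}} = {c \<in> P'. c \<inter> set (crossings D ! v) = {}})"

definition negative_after :: "link_diagram \<Rightarrow> nat \<Rightarrow> estate \<Rightarrow> nat" where
  "negative_after D v = (\<lambda>(s, P). card {k. v < k \<and> k < ncr D \<and> \<not> s ! k})"

definition khovanov_d ::
  "link_diagram \<Rightarrow> int \<Rightarrow> int \<Rightarrow> (estate \<Rightarrow> 'r::ring) \<Rightarrow> estate \<Rightarrow> 'r" where
  "khovanov_d D i j c = (\<lambda>S'.
     if S' \<in> generators D (i - 2) j
     then \<Sum>S\<in>generators D i j. \<Sum>v | incident D v S S'.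
            (if even (negative_after D v S) then c S else - c S)
     else 0)"

definition cycles :: "link_diagram \<Rightarrow> int \<Rightarrow> int \<Rightarrow> (estate \<Rightarrow> 'r::ring) set" where
  "cycles D i j = kernel (chains D i j) (chains D (i - 2) j) (khovanov_d D i j)"

definition boundaries :: "link_diagram \<Rightarrow> int \<Rightarrow> int \<Rightarrow> (estate \<Rightarrow> 'r::ring) set" where
  "boundaries D i j = khovanov_d D (i + 2) j ` carrier (chains D (i + 2) j)"

definition homology ::
  "link_diagram \<Rightarrow> int \<Rightarrow> int \<Rightarrow> (estate \<Rightarrow> 'r::ring) set monoid" where
  "homology D i j = (chains D i j)\<lparr>carrier := cycles D i j\<rparr> Mod boundaries D i j"

text \<open>
  The map into \<open>homology D i j\<close> induced by a map \<open>f\<close> on chains: it sends the class \<open>X\<close> to the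
  class of \<open>f x\<close> for \<open>x \<in> X\<close>. The value is a single coset precisely if this class does not
  depend on \<open>x\<close>.
\<close>

definition induced ::
  "link_diagram \<Rightarrow> int \<Rightarrow> int \<Rightarrow> ((estate \<Rightarrow> 'r::ring) \<Rightarrow> estate \<Rightarrow> 'r)
     \<Rightarrow> (estate \<Rightarrow> 'r) set \<Rightarrow> (estate \<Rightarrow> 'r) set" where
  "induced D i j f X = (\<Union>x\<in>X. boundaries D i j #>\<^bsub>chains D i j\<^esub> f x)"

definition scale :: "link_diagram \<Rightarrow> int \<Rightarrow> int \<Rightarrow> 'r::ring
     \<Rightarrow> (estate \<Rightarrow> 'r) set \<Rightarrow> (estate \<Rightarrow> 'r) set" where
  "scale D i j a = induced D i j (\<lambda>c S. a * c S)"

text \<open>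
  The linear extension, to chains on \<open>B\<close>, of a map that sends each enhanced state to an enhanced
  state or to \<open>0\<close> (rendered as \<open>None\<close>).
\<close>

definition linear_ext ::
  "estate set \<Rightarrow> (estate \<Rightarrow> estate option) \<Rightarrow> (estate \<Rightarrow> 'r::ring) \<Rightarrow> estate \<Rightarrow> 'r" where
  "linear_ext B f c = (\<lambda>T. \<Sum>S | S \<in> B \<and> f S = Some T. c S)"

section \<open>Hopf link addition\<close>

text \<open>
  An arc running upwards is cut into \<open>e\<close>, \<open>u\<close>, \<open>w\<close> by a small circle, whose parts to the left
  and to the right of the arc are \<open>l\<close> and \<open>r\<close>; the arc passes over the circle between \<open>e\<close> and
  \<open>u\<close>, and under it between \<open>u\<close> and \<open>w\<close>. The two new crossings may come in either order.
\<close>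

definition hopf_crossings :: "nat \<Rightarrow> nat \<Rightarrow> nat \<Rightarrow> nat \<Rightarrow> nat \<Rightarrow> nat list list set" where
  "hopf_crossings e u w l r =
     {[[l, e, r, u], [u, r, w, l]], [[u, r, w, l], [l, e, r, u]]}"

text \<open>
  \<open>hopf_sum D u l r D'\<close>: \<open>D'\<close> is obtained from \<open>D\<close> by Hopf link addition with fresh labels. An
  arc \<open>e\<close> of \<open>D\<close> that ends at crossings is cut so that \<open>w\<close> keeps the end \<open>(k, p)\<close> of \<open>e\<close>. Either
  of its two ends may be chosen, so the arc may be traversed in both directions, which gives both
  alternatives for the overcrossing. Cutting a component without crossings leaves \<open>w = e\<close>.
\<close>

inductive hopf_sum :: "link_diagram \<Rightarrow> nat \<Rightarrow> nat \<Rightarrow> nat \<Rightarrow> link_diagram \<Rightarrow> bool"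
  for D u l r where
  on_edge: "\<lbrakk>(k, p) \<in> ends D; arc_at D (k, p) = e;
             distinct [u, w, l, r]; {u, w, l, r} \<inter> arcs D = {};
             hs \<in> hopf_crossings e u w l r\<rbrakk>
    \<Longrightarrow> hopf_sum D u l r
          \<lparr>crossings = hs @ (crossings D)[k := (crossings D ! k)[p := w]], loops = loops D\<rparr>"
| on_loop: "\<lbrakk>e \<in> loops D; distinct [u, l, r]; {u, l, r} \<inter> arcs D = {};
             hs \<in> hopf_crossings e u e l r\<rbrakk>
    \<Longrightarrow> hopf_sum D u l r \<lparr>crossings = hs @ crossings D, loops = loops D - {e}\<rparr>"

text \<open>
  If both new crossings have the same marker, a circle \<open>c\<close> of \<open>D'\<close> other than the additional small
  circle corresponds to the circle \<open>c \<inter> arcs D\<close> of \<open>D\<close>. The small circle is \<open>{u, l}\<close> for negative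
  and \<open>{u, r}\<close> for positive markers.
\<close>

definition alpha_state :: "link_diagram \<Rightarrow> link_diagram \<Rightarrow> estate \<Rightarrow> estate option" where
  "alpha_state D D' = (\<lambda>(s, P). let s' = False # False # s in
     Some (s', {c \<in> circles D' s'. c \<inter> arcs D \<in> P}))"

definition beta_state :: "link_diagram \<Rightarrow> nat \<Rightarrow> nat \<Rightarrow> estate \<Rightarrow> estate option" where
  "beta_state D u r = (\<lambda>(s', P').
     if take 2 s' = [True, True] \<and> {u, r} \<in> P'
     then Some (drop 2 s', (\<lambda>c. c \<inter> arcs D) ` (P' - {{u, r}}))
     else None)"

definition alpha_h :: "link_diagram \<Rightarrow> link_diagram \<Rightarrow> int \<Rightarrow> int
     \<Rightarrow> (estate \<Rightarrow> 'r::ring) set \<Rightarrow> (estate \<Rightarrow> 'r) set" where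
  "alpha_h D D' i j =
     induced D' i j (linear_ext (generators D (i + 2) (j + 4)) (alpha_state D D'))"

definition beta_h :: "link_diagram \<Rightarrow> nat \<Rightarrow> nat \<Rightarrow> link_diagram \<Rightarrow> int \<Rightarrow> int
     \<Rightarrow> (estate \<Rightarrow> 'r::ring) set \<Rightarrow> (estate \<Rightarrow> 'r) set" where
  "beta_h D u r D' i j =
     induced D (i - 2) (j - 4) (linear_ext (generators D' i j) (beta_state D u r))"

end

(*
  The two new crossings split the complex of D' = D # D_h into the parts ++, +-, -+, -- according
  to their markers. With C the complex of D and A = <1, x> spanned by the negative and the positive
  sign of the small circle, ++ and -- are copies of C (x) A, and +- and -+ are copies of C. Writing
  d for the differential of D, X for the operator that turns the circle through the cut arc from
  negative to positive (positive circles are killed) and E for the sign (-1)^(number of negative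
  markers), a chain (p x + q 1, a, b, f x + g 1) has the boundary
    (dp x + dq 1,  da + E(q + X p),  db + E(q + X p),  (df + E(b - a)) x + (dg + X E(b - a)) 1).
  Since d X = X d, d E = - E d, X E = E X and E E = 1, exactness becomes an explicit calculation:
  a cycle p lifts to (p x - X p 1, 0, 0, 0); a cycle with p a boundary can be reduced by boundaries
  to (0, 0, 0, g 1); and if (0, 0, 0, g 1) bounds, then g = d(g' - X f).

  For d d = 0 and d X = X d one needs that the change of a marker always merges or splits circles.
  This is where planarity enters: by the Euler formula, counting over F_2, the faces have a
  checkerboard colouring, hence the arcs can be directed such that all smoothings respect the
  directions, and the change of a marker composes a permutation of the arcs with a transposition.
*)
theory Submission
  imports Defs "HOL-Library.Function_Algebras" HOL.Modules
begin


section \<open>Equivalence closures and orbits\<close>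

text \<open>For a code of positive genus the change of one marker may leave the number of circles
  unchanged, and then the Khovanov complex can break down; planarity, on the other hand, is only
  given as a numerical identity. It is spent on \<open>D\<close> alone: the circles of
  \<open>D'\<close> are preimages of circles of \<open>D\<close> under a retraction of labels, so
  the block formulas for \<open>D'\<close> need no directions of its arcs, and they reduce the
  square of its differential to \<open>D\<close>. Reading a negative circle as 1 and a positive one
  as x with x^2 = 0, a merge is the multiplication and a split the comultiplication 1 -> 1 (x) x + x
  (x) 1, x -> x (x) x. Both are linear over multiplication by x at an arc. This gives d X = X d, and
  it reduces the commutation of edge maps to states without positive circles. The terms q + X p and
  X E(b - a) are the multiplication by the small circle and the comultiplication that splits it off
  again; E arises because the new crossings come first in the ordering. Gradings are kept apart: the
  differential is one sum over all enhanced states, which agrees with the graded one on each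
  bidegree.\<close>

lemma equiv_symcl: "equiv UNIV ((r \<union> r\<inverse>)\<^sup>*)"
  by (intro equivI refl_rtrancl sym_rtrancl trans_rtrancl) (auto simp: sym_def)

lemma symcl_subset_equiv:
  assumes "r \<subseteq> R" "equiv UNIV R"
  shows "(r \<union> r\<inverse>)\<^sup>* \<subseteq> R"
proof (rule subrelI)
  fix x y assume "(x, y) \<in> (r \<union> r\<inverse>)\<^sup>*"
  then show "(x, y) \<in> R"
  proof induction
    case base
    show ?case using assms(2) by (simp add: equiv_def refl_on_def)
  next
    case (step y z)
    then have "(y, z) \<in> R" using assms by (auto simp: equiv_def dest: symD)
    then show ?case using step.IH assms(2) by (meson equivE transE)
  qed
qed

text \<open>For an equivalence \<open>R\<close>, this is the smallest equivalence that also relates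
  \<open>a\<close> and \<open>b\<close>, given explicitly so that the glued class can be read off
  without a closure.\<close>

definition join_rel :: "'a rel \<Rightarrow> 'a \<Rightarrow> 'a \<Rightarrow> 'a rel" where
  "join_rel R a b = {(x, y). (x, y) \<in> R \<or> ((x, a) \<in> R \<or> (x, b) \<in> R) \<and> ((y, a) \<in> R \<or> (y, b) \<in> R)}"

lemma join_commute: "join_rel R a b = join_rel R b a"
  by (auto simp: join_rel_def)

lemma equiv_join:
  assumes "equiv UNIV R" shows "equiv UNIV (join_rel R a b)"
proof (rule equivI)
  show "refl (join_rel R a b)"
    using assms by (auto simp: join_rel_def equiv_def refl_on_def)
  show "sym (join_rel R a b)"
    using assms by (auto simp: join_rel_def equiv_def sym_def)
  show "trans (join_rel R a b)"
  proof (rule transI)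
    have t: "(x, z) \<in> R" if "(x, y) \<in> R" "(y, z) \<in> R" for x y z
      using assms that by (meson equivE transE)
    have s: "(y, x) \<in> R" if "(x, y) \<in> R" for x y
      using assms that by (meson equivE symE)
    fix x y z assume "(x, y) \<in> join_rel R a b" "(y, z) \<in> join_rel R a b"
    then show "(x, z) \<in> join_rel R a b"
      unfolding join_rel_def by (auto intro: t s)
  qed
qed auto

lemma join_cong:
  assumes "equiv UNIV R" "(a, a') \<in> R" "(b, b') \<in> R"
  shows "join_rel R a b = join_rel R a' b'"
proof -
  have "(x, a) \<in> R \<longleftrightarrow> (x, a') \<in> R" "(x, b) \<in> R \<longleftrightarrow> (x, b') \<in> R" for x
    using assms by (meson equivE symE transE)+
  then show ?thesis by (simp add: join_rel_def)
qed

lemma join_subset: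
  assumes R: "equiv UNIV R" and "R0 \<subseteq> R" "(a, b) \<in> R"
  shows "join_rel R0 a b \<subseteq> R"
proof (rule subrelI)
  fix x y assume "(x, y) \<in> join_rel R0 a b"
  then consider "(x, y) \<in> R" | "(x, a) \<in> R \<or> (x, b) \<in> R" "(y, a) \<in> R \<or> (y, b) \<in> R"
    using \<open>R0 \<subseteq> R\<close> by (auto simp: join_rel_def)
  then show "(x, y) \<in> R"
  proof cases
    case 2
    then have "(x, a) \<in> R" "(y, a) \<in> R"
      using R \<open>(a, b) \<in> R\<close> by (meson equivE symE transE)+
    then show ?thesis using R by (meson equivE symE transE)
  qed
qed

text \<open>As soon as \<open>a\<close> and \<open>c\<close> are connected after the exchange, all
  four points lie in one class of the new relation. The old pairs are redundant there, so the new
  relation is the old one with two classes glued.\<close>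

lemma resmoothing_join:
  assumes r: "r = r0 \<union> {(a, b), (c, d)}" and r': "r' = r0 \<union> {(b, c), (d, a)}"
    and ac: "(a, c) \<in> (r' \<union> r'\<inverse>)\<^sup>*"
  shows "(r' \<union> r'\<inverse>)\<^sup>* = join_rel ((r \<union> r\<inverse>)\<^sup>*) a c"
proof
  let ?R = "(r \<union> r\<inverse>)\<^sup>*" and ?R' = "(r' \<union> r'\<inverse>)\<^sup>*"
  have e: "equiv UNIV ?R" and e': "equiv UNIV ?R'" by (rule equiv_symcl)+
  have ab: "(a, b) \<in> ?R" "(c, d) \<in> ?R" using r by auto
  have "r' \<subseteq> join_rel ?R a c"
    using ab e unfolding r' join_rel_def equiv_def
    by (auto simp: r dest: symD refl_onD)
  then show "?R' \<subseteq> join_rel ?R a c"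
    by (rule symcl_subset_equiv[OF _ equiv_join[OF e]])
  have bc: "(b, c) \<in> ?R'" "(d, a) \<in> ?R'" using r' by auto
  then have "(a, b) \<in> ?R'" "(c, d) \<in> ?R'"
    using ac e' by (meson equivE symE transE)+
  then have "r \<subseteq> ?R'" unfolding r by (auto simp: r')
  then have "?R \<subseteq> ?R'" by (rule symcl_subset_equiv[OF _ e'])
  then show "join_rel ?R a c \<subseteq> ?R'" by (rule join_subset[OF e' _ ac])
qed

text \<open>Both maps run through the same elements from their common value \<open>f a = g b\<close> on until the
  first return to \<open>{a, b}\<close>, where exactly one of the two orbits closes up.\<close>

lemma orbit_swap:
  assumes f: "bij_betw f A A" and g: "bij_betw g A A" and "finite A" "a \<in> A" "b \<in> A" "a \<noteq> b"
    and fg: "\<And>x. x \<in> A \<Longrightarrow> x \<noteq> a \<Longrightarrow> x \<noteq> b \<Longrightarrow> g x = f x" and ga: "g a = f b" and gb: "g b = f a"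
    and F: "F = {(x, f x) | x. x \<in> A}" and G: "G = {(x, g x) | x. x \<in> A}"
  shows "(a, b) \<in> (F \<union> F\<inverse>)\<^sup>* \<longleftrightarrow> (a, b) \<notin> (G \<union> G\<inverse>)\<^sup>*"
proof -
  \<comment> \<open>An injection of a finite set that maps \<open>Z\<close> into \<open>Z\<close>
    maps nothing else into \<open>Z\<close>, so \<open>Z\<close> is a union of orbits and separates
    \<open>a\<close> from \<open>b\<close>.\<close>
  have no_escape: "(a, b) \<notin> (H \<union> H\<inverse>)\<^sup>*"
    if h: "bij_betw h A A" and H: "H = {(x, h x) | x. x \<in> A}" and "Z \<subseteq> A" "h ` Z \<subseteq> Z" and ab: "a \<in> Z \<longleftrightarrow> b \<notin> Z"
    for h H Z
  proof -
    have inj: "inj_on h A" using h by (simp add: bij_betw_def)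
    have "finite Z" using \<open>Z \<subseteq> A\<close> \<open>finite A\<close> finite_subset by blast
    then have hZ: "h ` Z = Z"
      using endo_inj_surj[OF _ \<open>h ` Z \<subseteq> Z\<close>] inj_on_subset[OF inj \<open>Z \<subseteq> A\<close>] by blast
    have "h x \<in> Z \<longleftrightarrow> x \<in> Z" if "x \<in> A" for x
    proof
      assume "h x \<in> Z"
      then obtain z where "z \<in> Z" "h z = h x" using hZ by (metis imageE)
      then show "x \<in> Z" using inj_onD[OF inj] \<open>Z \<subseteq> A\<close> that by auto
    qed (use hZ in auto)
    then have "H \<subseteq> {(x, y). x \<in> Z \<longleftrightarrow> y \<in> Z}" using H by auto
    then have "(H \<union> H\<inverse>)\<^sup>* \<subseteq> {(x, y). x \<in> Z \<longleftrightarrow> y \<in> Z}"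
      by (rule symcl_subset_equiv) (auto simp: equiv_def refl_on_def sym_def trans_def)
    then show ?thesis using ab by auto
  qed
  define x where "x k = (f ^^ k) (f a)" for k
  have fA: "f y \<in> A" if "y \<in> A" for y using f that by (auto simp: bij_betw_def)
  have xA: "x k \<in> A" for k unfolding x_def by (induction k) (auto simp: fA \<open>a \<in> A\<close>)
  have xSuc: "x (Suc k) = f (x k)" for k by (simp add: x_def)
  have "\<exists>k. x k \<in> {a, b}"
  proof -
    have "\<not> inj_on x UNIV"
      using \<open>finite A\<close> xA by (meson finite_imageD finite_subset image_subsetI infinite_UNIV_nat)
    then obtain p q where "p < q" "x p = x q"
      by (metis (no_types, lifting) UNIV_I inj_onI linorder_neqE_nat)
    \<comment> \<open>By injectivity a repetition is pulled back to the index 0, where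
      \<open>f a = f (x n)\<close> gives \<open>x n = a\<close>.\<close>
    have "\<exists>k. x k = a" if "x p = x (Suc p + n)" for p n
      using that
    proof (induction p)
      case 0
      then have "f a = f (x n)" by (simp add: xSuc) (simp add: x_def)
      then show ?case using f \<open>a \<in> A\<close> xA by (metis bij_betw_def inj_onD)
    next
      case (Suc p)
      then have "f (x p) = f (x (Suc p + n))" by (simp add: xSuc)
      then have "x p = x (Suc p + n)" using f xA by (metis bij_betw_def inj_onD)
      then show ?case by (rule Suc.IH)
    qed
    from this[of p "q - p - 1"] \<open>p < q\<close> \<open>x p = x q\<close> show ?thesis by auto
  qed
  define n where "n = (LEAST k. x k \<in> {a, b})"
  have xn: "x n \<in> {a, b}" unfolding n_def using \<open>\<exists>k. x k \<in> {a, b}\<close> by (rule LeastI_ex)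
  have xk: "x k \<notin> {a, b}" if "k < n" for k using not_less_Least that unfolding n_def by blast
  \<comment> \<open>Before its last point, \<open>Z\<close> is traversed alike by both maps. The
    last point returns to \<open>f a\<close> under \<open>f\<close> if it is \<open>a\<close>, and
    under \<open>g\<close> if it is \<open>b\<close>.\<close>
  define Z where "Z = x ` {..n}"
  have ZA: "Z \<subseteq> A" using xA by (auto simp: Z_def)
  have path: "(f a, x k) \<in> (F \<union> F\<inverse>)\<^sup>* \<and> (f a, x k) \<in> (G \<union> G\<inverse>)\<^sup>*" if "k \<le> n" for k
    using that
  proof (induction k)
    case 0 then show ?case by (simp add: x_def)
  next
    case (Suc k)
    then have "g (x k) = x (Suc k)" using fg xA xk[of k] by (auto simp: xSuc)
    moreover have "f (x k) = x (Suc k)" by (simp add: xSuc)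
    ultimately have "(x k, x (Suc k)) \<in> F" "(x k, x (Suc k)) \<in> G" using xA[of k] F G by force+
    then show ?case using Suc by (meson Suc_leD UnI1 rtrancl.rtrancl_into_rtrancl)
  qed
  have Zstep: "h ` Z \<subseteq> Z" if "\<And>k. k < n \<Longrightarrow> h (x k) = x (Suc k)" "h (x n) = f a" for h
  proof -
    have "h (x k) \<in> Z" if "k \<le> n" for k
    proof (cases "k = n")
      case True
      have "f a = x 0" by (simp add: x_def)
      then show ?thesis using True \<open>h (x n) = f a\<close> by (simp add: Z_def)
    next
      case False
      then show ?thesis using that \<open>\<And>k. k < n \<Longrightarrow> h (x k) = x (Suc k)\<close> by (simp add: Z_def)
    qed
    then show ?thesis by (auto simp: Z_def)
  qed
  have gx: "g (x k) = x (Suc k)" if "k < n" for k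
    using fg[OF xA] xk[OF that] by (simp add: xSuc)
  show ?thesis
  proof (cases "x n = a")
    case True
    have "x k \<noteq> b" if "k \<le> n" for k using that True xk[of k] \<open>a \<noteq> b\<close> by (cases "k = n") auto
    then have "b \<notin> Z" "a \<in> Z" using True unfolding Z_def by auto
    then have "(a, b) \<notin> (F \<union> F\<inverse>)\<^sup>*"
      using True by (intro no_escape[OF f F ZA Zstep]) (auto simp: xSuc)
    moreover have "(b, f a) \<in> G" using G gb \<open>b \<in> A\<close> by force
    then have "(b, a) \<in> (G \<union> G\<inverse>)\<^sup>*"
      using path[of n] True by (metis UnI1 converse_rtrancl_into_rtrancl order_refl)
    then have "(a, b) \<in> (G \<union> G\<inverse>)\<^sup>*" using equiv_symcl[of G] by (auto simp: equiv_def dest: symD)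
    ultimately show ?thesis by blast
  next
    case False
    then have xb: "x n = b" using xn by auto
    have "x k \<noteq> a" if "k \<le> n" for k using that xb xk[of k] \<open>a \<noteq> b\<close> by (cases "k = n") auto
    then have "a \<notin> Z" "b \<in> Z" using xb unfolding Z_def by auto
    then have "(a, b) \<notin> (G \<union> G\<inverse>)\<^sup>*"
      using xb gb by (intro no_escape[OF g G ZA Zstep]) (auto simp: gx)
    moreover have "(a, f a) \<in> F" using F \<open>a \<in> A\<close> by force
    then have "(a, b) \<in> (F \<union> F\<inverse>)\<^sup>*"
      using path[of n] xb by (metis UnI1 converse_rtrancl_into_rtrancl order_refl)
    ultimately show ?thesis by blast
  qed
qed

section \<open>Checkerboard orientations of planar diagrams\<close>

lemma arc_at_in_edges:
  assumes "\<forall>x\<in>set (crossings D). length x = 4" "x \<in> ends D"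
  shows "arc_at D x \<in> edges D"
  using assms by (force simp: arc_at_def ends_def edges_def in_set_conv_nth)

lemma edges_eq_image:
  assumes "\<forall>x\<in>set (crossings D). length x = 4"
  shows "edges D = arc_at D ` ends D"
proof
  show "edges D \<subseteq> arc_at D ` ends D"
  proof
    fix a assume "a \<in> edges D"
    then obtain k p where "k < ncr D" "p < length (crossings D ! k)" "a = crossings D ! k ! p"
      unfolding edges_def by (auto simp: in_set_conv_nth)
    then have "(k, p) \<in> ends D" "a = arc_at D (k, p)"
      using assms by (auto simp: ends_def arc_at_def)
    then show "a \<in> arc_at D ` ends D" by blast
  qed
qed (use arc_at_in_edges[OF assms] in auto)

lemma card_ends_of_arc:
  assumes "\<forall>x\<in>set (crossings D). length x = 4"
  shows "card {x \<in> ends D. arc_at D x = a} = count_list (concat (crossings D)) a"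
proof -
  have "{x \<in> ends D. arc_at D x = a} = (SIGMA k:{..<ncr D}. {p. p < length (crossings D ! k) \<and> crossings D ! k ! p = a})"
    using assms by (auto simp: ends_def arc_at_def)
  also have "card \<dots> = (\<Sum>k<ncr D. card {p. p < length (crossings D ! k) \<and> crossings D ! k ! p = a})"
    by (simp add: card_SigmaI)
  also have "\<dots> = (\<Sum>k<ncr D. count_list (crossings D ! k) a)"
    by (simp add: count_list_eq_length_filter length_filter_conv_card eq_commute)
  also have "\<dots> = sum_list (map (\<lambda>xs. count_list xs a) (crossings D))"
    by (simp add: sum_list_sum_nth atLeast0LessThan)
  also have "\<dots> = count_list (concat (crossings D)) a"
    by (induction "crossings D" arbitrary: D rule: list.induct)
       (simp, metis (no_types, lifting) concat.simps(2) count_list_append link_diagram.select_convs(1) list.simps(9) sum_list.Cons)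
  finally show ?thesis .
qed

section \<open>Linear algebra over the field with two elements: sets as vectors,
  \<open>symdiff\<close> as addition\<close>

definition symdiff :: "'a set \<Rightarrow> 'a set \<Rightarrow> 'a set" where
  "symdiff A B = (A - B) \<union> (B - A)"

lemma in_symdiff [simp]: "x \<in> symdiff A B \<longleftrightarrow> (x \<in> A \<longleftrightarrow> x \<notin> B)"
  by (auto simp: symdiff_def)

lemma even_card_symdiff:
  assumes "finite A" "finite B"
  shows "even (card (symdiff A B)) \<longleftrightarrow> (even (card A) \<longleftrightarrow> even (card B))"
proof -
  have "card (symdiff A B) = card (A - B) + card (B - A)"
    using assms by (auto simp: symdiff_def intro!: card_Un_disjoint)
  moreover have "card A = card (A - B) + card (A \<inter> B)" "card B = card (B - A) + card (A \<inter> B)"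
    using assms by (metis Int_Diff_Un Int_Diff_disjoint card_Un_disjoint finite_Diff finite_Int add.commute Int_commute)+
  ultimately show ?thesis by (metis even_add)
qed

text \<open>Rank and nullity over the field with two elements, in counting form: the fibres of an
  additive map are translates of its kernel.\<close>

lemma card_kernel_image:
  assumes "finite A" and hom: "\<And>X Y. X \<subseteq> A \<Longrightarrow> Y \<subseteq> A \<Longrightarrow> f (symdiff X Y) = symdiff (f X) (f Y)"
  shows "card {X. X \<subseteq> A \<and> f X = {}} * card (f ` Pow A) = 2 ^ card A"
proof -
  let ?K = "{X. X \<subseteq> A \<and> f X = {}}"
  have fib: "card {X \<in> Pow A. f X = y} = card ?K" if y: "y \<in> f ` Pow A" for y
  proof -
    obtain X0 where X0: "X0 \<subseteq> A" "f X0 = y" using y by auto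
    have sym: "symdiff X0 (symdiff X0 X) = X" for X by auto
    have sub: "symdiff X0 X \<subseteq> A" if "X \<subseteq> A" for X using X0 that by (auto simp: symdiff_def)
    have "bij_betw (symdiff X0) ?K {X \<in> Pow A. f X = y}"
    proof (rule bij_betw_byWitness[where f' = "symdiff X0"])
      show "symdiff X0 ` ?K \<subseteq> {X \<in> Pow A. f X = y}"
        using sub hom X0 by (auto simp: symdiff_def)
      show "symdiff X0 ` {X \<in> Pow A. f X = y} \<subseteq> ?K"
        using sub hom[of X0] X0 by (auto simp: symdiff_def)
    qed (use sym in auto)
    then show ?thesis by (simp add: bij_betw_same_card)
  qed
  have "2 ^ card A = card (Pow A)" using assms by (simp add: card_Pow)
  also have "Pow A = (\<Union>y\<in>f ` Pow A. {X \<in> Pow A. f X = y})" by auto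
  also have "card \<dots> = (\<Sum>y\<in>f ` Pow A. card {X \<in> Pow A. f X = y})"
    using \<open>finite A\<close> by (intro card_UN_disjoint) auto
  also have "\<dots> = (\<Sum>y\<in>f ` Pow A. card ?K)" by (intro sum.cong fib refl)
  finally show ?thesis by (simp add: mult.commute)
qed

text \<open>
  A direction of all arcs such that around every crossing incoming and outgoing ends alternate is
  encoded by \<open>c\<close>: the even ends of the crossing \<open>k\<close> are incoming if and only if \<open>c k\<close>.
\<close>

definition half_ends :: "link_diagram \<Rightarrow> (nat \<Rightarrow> bool) \<Rightarrow> bool \<Rightarrow> (nat \<times> nat) set" where
  "half_ends D c b = {(k, p). (k, p) \<in> ends D \<and> (even p = c k) = b}"

text \<open>Bijectivity for both values of \<open>b\<close> means that every arc has exactly one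
  incoming and exactly one outgoing end.\<close>

definition oriented :: "link_diagram \<Rightarrow> (nat \<Rightarrow> bool) \<Rightarrow> bool" where
  "oriented D c \<longleftrightarrow> (\<forall>x\<in>set (crossings D). length x = 4) \<and>
     (\<forall>b. bij_betw (arc_at D) (half_ends D c b) (edges D))"

section \<open>Regions of a diagram code, and boundaries and coboundaries modulo 2\<close>

locale pd_diagram =
  fixes D :: link_diagram
  assumes length_crossing: "\<forall>x\<in>set (crossings D). length x = 4"
    and count_two: "\<forall>a\<in>edges D. count_list (concat (crossings D)) a = 2"
begin

lemma two_ends:
  assumes "x \<in> ends D" "y \<in> ends D" "x \<noteq> y" "arc_at D x = arc_at D y"
  shows "{z \<in> ends D. arc_at D z = arc_at D x} = {x, y}"
proof -
  have "card {z \<in> ends D. arc_at D z = arc_at D x} = 2"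
    using card_ends_of_arc[OF length_crossing] count_two arc_at_in_edges[OF length_crossing assms(1)] by simp
  moreover have "finite {z \<in> ends D. arc_at D z = arc_at D x}" by (simp add: ends_def)
  ultimately show ?thesis
    using assms by (intro card_subset_eq[symmetric]) auto
qed

lemma partner:
  assumes "x \<in> ends D"
  obtains y where "y \<in> ends D" "y \<noteq> x" "arc_at D y = arc_at D x"
proof -
  have "card {z \<in> ends D. arc_at D z = arc_at D x} = 2"
    using card_ends_of_arc[OF length_crossing] count_two arc_at_in_edges[OF length_crossing assms(1)] by simp
  then obtain u v where "{z \<in> ends D. arc_at D z = arc_at D x} = {u, v}" "u \<noteq> v"
    by (auto simp: card_2_iff)
  then show ?thesis using that by (metis (mono_tags, lifting) insertCI mem_Collect_eq)
qed

text \<open>For an end \<open>x\<close>, the corners \<open>x\<close> and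
  \<open>prev_corner x\<close> lie to the left and to the right of the arc leaving there; adding 3
  is subtracting 1 modulo 4.\<close>

definition prev_corner :: "nat \<times> nat \<Rightarrow> nat \<times> nat" where
  "prev_corner = (\<lambda>(k, p). (k, (p + 3) mod 4))"

definition face_rel :: "(nat \<times> nat) rel" where
  "face_rel = {((k, p), (k', (p' + 3) mod 4)) | k p k' p'.
        (k, p) \<in> ends D \<and> (k', p') \<in> ends D \<and> (k, p) \<noteq> (k', p') \<and>
        arc_at D (k, p) = arc_at D (k', p')}"

definition face :: "nat \<times> nat \<Rightarrow> (nat \<times> nat) set" where
  "face x = (face_rel \<union> face_rel\<inverse>)\<^sup>* `` {x}"

lemma faces_eq: "faces D = face ` ends D"
  by (auto simp: faces_def generated_classes_def face_def face_rel_def quotient_def)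

lemma face_partner:
  assumes "x \<in> ends D" "y \<in> ends D" "x \<noteq> y" "arc_at D x = arc_at D y"
  shows "face x = face (prev_corner y)"
proof -
  have "(x, prev_corner y) \<in> face_rel"
    using assms by (cases x; cases y) (auto simp: face_rel_def prev_corner_def)
  then have "(x, prev_corner y) \<in> (face_rel \<union> face_rel\<inverse>)\<^sup>*" by auto
  then show ?thesis unfolding face_def by (rule equiv_class_eq[OF equiv_symcl])
qed

text \<open>The mod 2 coboundary of a set of faces: the arcs that separate a face in
  \<open>Y\<close> from one outside.\<close>

definition cobdry :: "(nat \<times> nat) set set \<Rightarrow> nat set" where
  "cobdry Y = arc_at D ` {x \<in> ends D. face x \<in> Y \<longleftrightarrow> face (prev_corner x) \<notin> Y}"

text \<open>Seen from the other end, left and right of the arc are exchanged, which leaves the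
  symmetric criterion unchanged; so either end can be used to test it.\<close>

lemma cobdry_iff:
  assumes "x \<in> ends D"
  shows "arc_at D x \<in> cobdry Y \<longleftrightarrow> (face x \<in> Y \<longleftrightarrow> face (prev_corner x) \<notin> Y)"
proof
  assume "arc_at D x \<in> cobdry Y"
  then obtain y where y: "y \<in> ends D" "arc_at D x = arc_at D y" "face y \<in> Y \<longleftrightarrow> face (prev_corner y) \<notin> Y"
    unfolding cobdry_def by blast
  then show "face x \<in> Y \<longleftrightarrow> face (prev_corner x) \<notin> Y"
    using face_partner[OF assms y(1)] face_partner[OF y(1) assms] by (cases "x = y") auto
qed (use assms in \<open>unfold cobdry_def, blast\<close>)

lemma cobdry_subset: "cobdry Y \<subseteq> edges D"
  using arc_at_in_edges[OF length_crossing] unfolding cobdry_def by blast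

lemma edges_eqI:
  assumes "A \<subseteq> edges D" "B \<subseteq> edges D" "\<And>x. x \<in> ends D \<Longrightarrow> arc_at D x \<in> A \<longleftrightarrow> arc_at D x \<in> B"
  shows "A = B"
proof -
  have "a \<in> A \<longleftrightarrow> a \<in> B" if a: "a \<in> edges D" for a
  proof -
    obtain x where "x \<in> ends D" "a = arc_at D x"
      using a unfolding edges_eq_image[OF length_crossing] by blast
    then show ?thesis using assms(3) by simp
  qed
  then show ?thesis using assms(1,2) by blast
qed

lemma cobdry_symdiff: "cobdry (symdiff X Y) = symdiff (cobdry X) (cobdry Y)"
proof (rule edges_eqI[OF cobdry_subset])
  show "symdiff (cobdry X) (cobdry Y) \<subseteq> edges D"
    using cobdry_subset[of X] cobdry_subset[of Y] by (auto simp: symdiff_def)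
next
  fix x assume x: "x \<in> ends D"
  show "arc_at D x \<in> cobdry (symdiff X Y) \<longleftrightarrow> arc_at D x \<in> symdiff (cobdry X) (cobdry Y)"
    unfolding cobdry_iff[OF x] in_symdiff by argo
qed

text \<open>The mod 2 boundary. Ends are counted rather than arcs, so an arc with both ends at one
  crossing contributes nothing modulo 2.\<close>

definition bdry :: "nat set \<Rightarrow> nat set" where
  "bdry h = {k. k < ncr D \<and> odd (card {p. p < 4 \<and> arc_at D (k, p) \<in> h})}"

lemma bdry_symdiff: "bdry (symdiff g h) = symdiff (bdry g) (bdry h)"
proof -
  have "{p. p < 4 \<and> arc_at D (k, p) \<in> symdiff g h} =
     symdiff {p. p < 4 \<and> arc_at D (k, p) \<in> g} {p. p < 4 \<and> arc_at D (k, p) \<in> h}" for k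
    by (auto simp: symdiff_def)
  then show ?thesis by (auto simp: bdry_def even_card_symdiff)
qed

lemma card_less_4: "card {p. p < (4::nat) \<and> Q p} = of_bool (Q 0) + of_bool (Q 1) + of_bool (Q 2) + of_bool (Q 3)"
proof -
  have "{p. p < (4::nat) \<and> Q p} = {p \<in> {..<4}. Q p}" by auto
  also have "card \<dots> = (\<Sum>p<4. of_bool (Q p))" by (simp add: sum.If_cases of_bool_def Int_def)
  finally show ?thesis by (simp add: eval_nat_numeral)
qed

text \<open>Going once around a crossing, one changes an even number of times between faces in
  \<open>Y\<close> and faces outside.\<close>

lemma bdry_cobdry: "bdry (cobdry Y) = {}"
proof -
  have "even (card {p. p < 4 \<and> arc_at D (k, p) \<in> cobdry Y})" if "k < ncr D" for k
  proof -
    have "{p. p < 4 \<and> arc_at D (k, p) \<in> cobdry Y} =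
        {p. p < 4 \<and> (face (k, p) \<in> Y \<longleftrightarrow> face (k, (p + 3) mod 4) \<notin> Y)}"
      using that cobdry_iff by (auto simp: ends_def prev_corner_def)
    then show ?thesis by (auto simp: card_less_4)
  qed
  then show ?thesis by (auto simp: bdry_def)
qed

section \<open>Connected components and the ranks of boundary and coboundary\<close>

definition component :: "nat \<Rightarrow> nat set" where
  "component a = (let r = {(a, b). \<exists>x\<in>set (crossings D). a \<in> set x \<and> b \<in> set x} in (r \<union> r\<inverse>)\<^sup>* `` {a})"

lemma components_eq: "components D = component ` edges D"
  by (auto simp: components_def generated_classes_def component_def quotient_def Let_def)

text \<open>Connectedness of arcs, turned into an induction over ends with two moves: around a
  crossing and along an arc. Both rank estimates propagate a property in this way.\<close>

lemma component_induct:
  assumes eq: "component (arc_at D x) = component (arc_at D y)"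
    and x: "x \<in> ends D" and y: "y \<in> ends D"
    and Px: "P x"
    and crossing: "\<And>k p q. P (k, p) \<Longrightarrow> (k, p) \<in> ends D \<Longrightarrow> (k, q) \<in> ends D \<Longrightarrow> P (k, q)"
    and arc: "\<And>x y. P x \<Longrightarrow> x \<in> ends D \<Longrightarrow> y \<in> ends D \<Longrightarrow> x \<noteq> y \<Longrightarrow> arc_at D x = arc_at D y \<Longrightarrow> P y"
  shows "P y"
proof -
  define r where "r = {(a, b). \<exists>x\<in>set (crossings D). a \<in> set x \<and> b \<in> set x}"
  have symr: "r \<union> r\<inverse> = r" by (auto simp: r_def)
  have all: "P z" if "P z'" "z' \<in> ends D" "z \<in> ends D" "arc_at D z' = arc_at D z" for z z'
    using that arc by (cases "z' = z") auto
  have "(arc_at D x, arc_at D y) \<in> r\<^sup>*"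
    using eq equiv_symcl[of r] unfolding component_def r_def[symmetric] Let_def
    by (auto simp: symr dest: eq_equiv_class)
  \<comment> \<open>Quantified over both ends of the current arc, since the next crossing may be
    reached through either of them.\<close>
  then have "\<forall>z\<in>ends D. arc_at D z = arc_at D y \<longrightarrow> P z"
  proof (induction)
    case base
    then show ?case using all Px x by metis
  next
    case (step a b)
    then obtain c where c: "c \<in> set (crossings D)" "a \<in> set c" "b \<in> set c" by (auto simp: r_def)
    then obtain k p q where k: "k < ncr D" "p < 4" "q < 4" "c = crossings D ! k" "c ! p = a" "c ! q = b"
      using length_crossing by (metis in_set_conv_nth)
    then have *: "(k, p) \<in> ends D" "(k, q) \<in> ends D" "arc_at D (k, p) = a" "arc_at D (k, q) = b"
      by (auto simp: ends_def arc_at_def)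
    then have "P (k, q)" using step.IH crossing by blast
    then show ?case using all * by metis
  qed
  then show ?thesis using y by blast
qed

lemma finite_ends: "finite (ends D)"
  by (simp add: ends_def)

text \<open>A set of faces without coboundary contains all or none of the faces at a component,
  hence is determined by the components that it meets.\<close>

lemma card_ker_cobdry: "card {Y. Y \<subseteq> faces D \<and> cobdry Y = {}} \<le> 2 ^ card (components D)"
proof -
  let ?K = "{Y. Y \<subseteq> faces D \<and> cobdry Y = {}}"
  let ?g = "\<lambda>Y. (\<lambda>x. component (arc_at D x)) ` {x \<in> ends D. face x \<in> Y}"
  have mono: "face y \<in> Y"
    if Y: "Y \<in> ?K" and "x \<in> ends D" "y \<in> ends D" "face x \<in> Y" "component (arc_at D x) = component (arc_at D y)" for x y Y
  proof -
    have ker: "face x \<in> Y \<longleftrightarrow> face (prev_corner x) \<in> Y" if "x \<in> ends D" for x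
      using cobdry_iff[OF that, of Y] Y by auto
    show ?thesis
    proof (rule component_induct[where P = "\<lambda>x. face x \<in> Y"])
      fix k p q assume *: "face (k, p) \<in> Y" "(k, p) \<in> ends D" "(k, q) \<in> ends D"
      have "face (k, 0) \<in> Y \<longleftrightarrow> face (k, 3) \<in> Y" "face (k, 1) \<in> Y \<longleftrightarrow> face (k, 0) \<in> Y"
        "face (k, 2) \<in> Y \<longleftrightarrow> face (k, 1) \<in> Y"
        using ker[of "(k, 0)"] ker[of "(k, 1)"] ker[of "(k, 2)"] * by (simp_all add: prev_corner_def ends_def)
      moreover have "p = 0 \<or> p = 1 \<or> p = 2 \<or> p = 3" "q = 0 \<or> q = 1 \<or> q = 2 \<or> q = 3"
        using * by (auto simp: ends_def)
      ultimately show "face (k, q) \<in> Y" using * by auto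
    next
      fix x y assume "face x \<in> Y" "x \<in> ends D" "y \<in> ends D" "x \<noteq> y" "arc_at D x = arc_at D y"
      then show "face y \<in> Y" using ker face_partner by metis
    qed (use that in auto)
  qed
  have "inj_on ?g ?K"
  proof (rule inj_onI)
    fix Y Y' assume Y: "Y \<in> ?K" "Y' \<in> ?K" and eq: "?g Y = ?g Y'"
    have sub: "Y1 \<subseteq> Y2" if Y12: "Y1 \<in> ?K" "Y2 \<in> ?K" "?g Y1 = ?g Y2" for Y1 Y2
    proof
      fix f assume "f \<in> Y1"
      then obtain x where x: "x \<in> ends D" "f = face x" using Y12(1) unfolding faces_eq by blast
      then have "component (arc_at D x) \<in> ?g Y2" using \<open>f \<in> Y1\<close> Y12(3) by blast
      then show "f \<in> Y2" using mono[OF Y12(2)] x by blast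
    qed
    show "Y = Y'" using sub[OF Y(1,2) eq] sub[OF Y(2,1) eq[symmetric]] by blast
  qed
  moreover have "?g ` ?K \<subseteq> Pow (components D)"
    using arc_at_in_edges[OF length_crossing] by (auto simp: components_eq)
  moreover have fin: "finite (components D)"
    by (simp add: components_eq edges_def)
  ultimately have "card ?K \<le> card (Pow (components D))"
    by (intro card_inj_on_le) auto
  then show ?thesis using fin by (simp add: card_Pow)
qed

text \<open>The symmetric difference also covers an arc that returns to its crossing: its boundary
  is empty.\<close>

lemma bdry_arc:
  assumes "x \<in> ends D" "y \<in> ends D" "x \<noteq> y" "arc_at D x = arc_at D y"
  shows "bdry {arc_at D x} = symdiff {fst x} {fst y}"
proof -
  have "card {p. p < 4 \<and> arc_at D (k, p) \<in> {arc_at D x}} = of_bool (fst x = k) + of_bool (fst y = k)"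
    if "k < ncr D" for k
  proof -
    have "p < 4 \<and> arc_at D (k, p) \<in> {arc_at D x} \<longleftrightarrow> (k, p) \<in> {x, y}" for p
      unfolding two_ends[OF assms, symmetric] using that by (simp add: ends_def)
    then have "{p. p < 4 \<and> arc_at D (k, p) \<in> {arc_at D x}} = {p. (k, p) \<in> {x, y}}" by simp
    also have "\<dots> = (if fst x = k then {snd x} else {}) \<union> (if fst y = k then {snd y} else {})"
      by (cases x; cases y) auto
    finally have eq: "{p. p < 4 \<and> arc_at D (k, p) \<in> {arc_at D x}} =
      (if fst x = k then {snd x} else {}) \<union> (if fst y = k then {snd y} else {})" .
    have "snd x \<noteq> snd y" if "fst x = k" "fst y = k" using that \<open>x \<noteq> y\<close> by (simp add: prod_eq_iff)
    then show ?thesis unfolding eq by (auto simp: card_insert_if)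
  qed
  note card = this
  have "fst x < ncr D" "fst y < ncr D" using assms by (auto simp: ends_def)
  then have "k \<in> bdry {arc_at D x} \<longleftrightarrow> k \<in> symdiff {fst x} {fst y}" for k
    by (cases "k < ncr D"; cases "fst x = k"; cases "fst y = k") (auto simp: bdry_def card[simplified])
  then show ?thesis by blast
qed

text \<open>The rank of the boundary map is at least the number of crossings minus the number of
  components: differences of crossings in one component are boundaries, so apart from one root per
  component every set of crossings can be prescribed.\<close>

lemma card_im_bdry: "2 ^ ncr D \<le> card (bdry ` Pow (edges D)) * 2 ^ card (components D)"
proof -
  let ?G = "bdry ` Pow (edges D)"
  have emp: "{} \<in> ?G" by (rule image_eqI[of _ _ "{}"]) (auto simp: bdry_def)
  have G: "symdiff A B \<in> ?G" if AB: "A \<in> ?G" "B \<in> ?G" for A B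
  proof -
    obtain g h where gh: "A = bdry g" "B = bdry h" "g \<subseteq> edges D" "h \<subseteq> edges D" using AB by auto
    have "symdiff g h \<subseteq> edges D" using gh by (auto simp: symdiff_def)
    then show ?thesis using gh by (auto simp flip: bdry_symdiff)
  qed
  define comp where "comp k = component (arc_at D (k, 0))" for k
  have comp: "comp ` {..<ncr D} = components D"
  proof -
    have "component (arc_at D x) = comp (fst x)" if "x \<in> ends D" for x
    proof -
      let ?r = "{(a, b). \<exists>x\<in>set (crossings D). a \<in> set x \<and> b \<in> set x}"
      have x: "fst x < ncr D" "snd x < 4" using that by (auto simp: ends_def)
      then have "crossings D ! fst x \<in> set (crossings D)" "length (crossings D ! fst x) = 4"
        using length_crossing by auto
      moreover from this(2) have "arc_at D x \<in> set (crossings D ! fst x)"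
        "arc_at D (fst x, 0) \<in> set (crossings D ! fst x)"
        using x by (auto simp: arc_at_def case_prod_beta)
      ultimately have "(arc_at D x, arc_at D (fst x, 0)) \<in> ?r" by blast
      then have "(arc_at D x, arc_at D (fst x, 0)) \<in> (?r \<union> ?r\<inverse>)\<^sup>*" by auto
      then show ?thesis unfolding comp_def component_def Let_def by (rule equiv_class_eq[OF equiv_symcl])
    qed
    note component_eq = this
    show ?thesis
    proof
      show "comp ` {..<ncr D} \<subseteq> components D"
      proof
        fix C assume "C \<in> comp ` {..<ncr D}"
        then obtain k where "C = component (arc_at D (k, 0))" "(k, 0) \<in> ends D"
          by (auto simp: comp_def ends_def)
        then show "C \<in> components D"
          using arc_at_in_edges[OF length_crossing] unfolding components_eq by blast
      qed
      show "components D \<subseteq> comp ` {..<ncr D}"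
      proof
        fix C assume "C \<in> components D"
        then obtain x where "x \<in> ends D" "C = component (arc_at D x)"
          unfolding components_eq edges_eq_image[OF length_crossing] by blast
        moreover from this(1) have "fst x \<in> {..<ncr D}" by (auto simp: ends_def)
        ultimately show "C \<in> comp ` {..<ncr D}" using component_eq by blast
      qed
    qed
  qed
  define root where "root = inv_into {..<ncr D} comp"
  have root: "root c < ncr D" "comp (root c) = c" if "c \<in> components D" for c
  proof -
    have "c \<in> comp ` {..<ncr D}" using that comp by simp
    from inv_into_into[OF this] f_inv_into_f[OF this]
    show "root c < ncr D" "comp (root c) = c" by (simp_all add: root_def)
  qed
  define T where "T = {..<ncr D} - root ` components D"
  \<comment> \<open>The boundaries of the arcs along a path from \<open>k\<close> to the root of its
    component are summed up.\<close>
  have conn: "symdiff {k} {root (comp k)} \<in> ?G" if k: "k < ncr D" for k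
  proof -
    have "comp k \<in> components D" unfolding comp[symmetric] using k by simp
    note root = root[OF this]
    have "symdiff {k} {fst (root (comp k), 0::nat)} \<in> ?G"
    proof (rule component_induct[where x = "(k, 0)" and P = "\<lambda>x. symdiff {k} {fst x} \<in> ?G"])
      show "component (arc_at D (k, 0)) = component (arc_at D (root (comp k), 0))"
        using root by (simp add: comp_def)
      have "symdiff {k} {fst (k, 0::nat)} = {}" by (auto simp: symdiff_def)
      then show "symdiff {k} {fst (k, 0::nat)} \<in> ?G" using emp by simp
    next
      fix x y assume *: "symdiff {k} {fst x} \<in> ?G" "x \<in> ends D" "y \<in> ends D" "x \<noteq> y" "arc_at D x = arc_at D y"
      have "symdiff {fst x} {fst y} \<in> ?G"
        using bdry_arc[OF *(2-5)] arc_at_in_edges[OF length_crossing *(2)] by (metis Pow_iff empty_subsetI image_eqI insert_subset)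
      moreover have "symdiff (symdiff {k} {fst x}) (symdiff {fst x} {fst y}) = symdiff {k} {fst y}"
        by (auto simp: set_eq_iff simp del: singleton_iff)
      ultimately show "symdiff {k} {fst y} \<in> ?G" using G[OF *(1)] by metis
    qed (use k root in \<open>auto simp: ends_def\<close>)
    then show ?thesis by simp
  qed
  \<comment> \<open>Crossings are toggled one at a time; the root toggled along with each of them is
    invisible in \<open>T\<close>.\<close>
  have "\<exists>B\<in>?G. B \<inter> T = Y" if "Y \<subseteq> T" for Y
  proof -
    have "finite Y" using that by (rule finite_subset) (simp add: T_def)
    then show ?thesis using that
    proof (induction Y rule: finite_induct)
      case empty then show ?case using emp by blast
    next
      case (insert k Y)
      then obtain B where B: "B \<in> ?G" "B \<inter> T = Y" by auto
      have k: "k \<in> T" using insert by auto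
      then have "k < ncr D" by (simp add: T_def)
      then have "comp k \<in> components D" unfolding comp[symmetric] by simp
      then have "root (comp k) \<notin> T" by (simp add: T_def)
      with k insert(2) B(2) have "symdiff B (symdiff {k} {root (comp k)}) \<inter> T = insert k Y" by auto
      then show ?case using G[OF B(1) conn[OF \<open>k < ncr D\<close>]] by blast
    qed
  qed
  then have "Pow T \<subseteq> (\<lambda>B. B \<inter> T) ` ?G" by (metis (no_types, lifting) Pow_iff image_iff subsetI)
  moreover have finG: "finite ?G" by (simp add: edges_def)
  ultimately have "card (Pow T) \<le> card ?G" by (rule surj_card_le[rotated])
  moreover have "finite T" by (simp add: T_def)
  ultimately have le: "2 ^ card T \<le> card ?G" by (simp add: card_Pow)
  have "inj_on root (components D)" by (metis inj_onI root(2))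
  then have "card (root ` components D) = card (components D)" by (rule card_image)
  moreover have "root ` components D \<subseteq> {..<ncr D}" using root by auto
  ultimately have "ncr D = card T + card (components D)"
    unfolding T_def by (metis card_Diff_subset card_lessThan card_mono finite_lessThan finite_subset le_add_diff_inverse2)
  then show ?thesis using le by (simp add: power_add)
qed

text \<open>The first homology of the sphere with coefficients in the field with two elements vanishes: by
  the Euler formula there are as many coboundaries of sets of faces as 1-cycles, and the set of all
  arcs is a 1-cycle since all crossings have four ends.\<close>

lemma ex_checkerboard:
  assumes "planar D"
  shows "\<exists>Y. cobdry Y = edges D"
proof -
  let ?Z = "{h. h \<subseteq> edges D \<and> bdry h = {}}" and ?I = "cobdry ` Pow (faces D)"
  have "finite (faces D)" by (simp add: faces_eq finite_ends)
  then have 1: "card {Y. Y \<subseteq> faces D \<and> cobdry Y = {}} * card ?I = 2 ^ card (faces D)"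
    using cobdry_symdiff by (rule card_kernel_image)
  have finE: "finite (edges D)" by (simp add: edges_def)
  then have 2: "card ?Z * card (bdry ` Pow (edges D)) = 2 ^ card (edges D)"
    using bdry_symdiff by (rule card_kernel_image)
  \<comment> \<open>In the notation of the Euler formula, the cycles have dimension at most E - V +
    C and the coboundaries at least F - C, and these numbers agree. Powers are multiplied out to
    avoid subtraction.\<close>
  have "card ?Z * 2 ^ (ncr D + card (components D)) =
      card ?Z * 2 ^ ncr D * 2 ^ card (components D)" by (simp add: power_add)
  also have "\<dots> \<le> card ?Z * (card (bdry ` Pow (edges D)) * 2 ^ card (components D)) * 2 ^ card (components D)"
    by (intro mult_mono card_im_bdry) auto
  also have "\<dots> = 2 ^ (card (edges D) + 2 * card (components D))"
    by (simp add: 2[symmetric] power_add mult_2)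
  also have "\<dots> = 2 ^ ncr D * 2 ^ card (faces D)"
    using \<open>planar D\<close> by (simp add: planar_def flip: power_add)
  also have "\<dots> = 2 ^ ncr D * (card {Y. Y \<subseteq> faces D \<and> cobdry Y = {}} * card ?I)" by (simp only: 1)
  also have "\<dots> \<le> 2 ^ ncr D * (2 ^ card (components D) * card ?I)"
    by (intro mult_mono card_ker_cobdry) auto
  finally have "card ?Z \<le> card ?I" by (simp add: power_add)
  moreover have "?I \<subseteq> ?Z" using cobdry_subset bdry_cobdry by auto
  moreover have "finite ?Z" using finE by simp
  ultimately have "?I = ?Z" by (intro card_seteq)
  moreover have "edges D \<in> ?Z"
  proof -
    have "{p. p < 4 \<and> arc_at D (k, p) \<in> edges D} = {..<4}" if "k < ncr D" for k
      using that arc_at_in_edges[OF length_crossing] by (auto simp: ends_def)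
    then show ?thesis by (auto simp: bdry_def)
  qed
  ultimately show ?thesis by (metis (no_types, lifting) imageE)
qed

text \<open>Every arc is directed so that its side in \<open>Y\<close> is on the right. As the
  colours alternate around a crossing, so do incoming and outgoing ends.\<close>

lemma ex_oriented:
  assumes "planar D"
  shows "\<exists>c. oriented D c"
proof -
  obtain Y where Y: "cobdry Y = edges D" using ex_checkerboard[OF assms] by blast
  have alt: "face x \<in> Y \<longleftrightarrow> face (prev_corner x) \<notin> Y" if "x \<in> ends D" for x
    using cobdry_iff[OF that, of Y] Y arc_at_in_edges[OF length_crossing that] by simp
  define c where "c k = (face (k, 0) \<in> Y)" for k
  have c: "face (k, p) \<in> Y \<longleftrightarrow> (even p = c k)" if "(k, p) \<in> ends D" for k p
  proof -
    have "k < ncr D" "p = 0 \<or> p = 1 \<or> p = 2 \<or> p = 3" using that by (auto simp: ends_def)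
    then show ?thesis
      using alt[of "(k, 1)"] alt[of "(k, 2)"] alt[of "(k, 3)"]
      by (auto simp: c_def ends_def prev_corner_def)
  qed
  have half: "half_ends D c b = {x \<in> ends D. (face x \<in> Y) = b}" for b
    using c by (auto simp: half_ends_def)
  have opp: "face x \<in> Y \<longleftrightarrow> face y \<notin> Y"
    if "x \<in> ends D" "y \<in> ends D" "x \<noteq> y" "arc_at D x = arc_at D y" for x y
    using face_partner[OF that] alt[OF that(2)] by simp
  have "bij_betw (arc_at D) (half_ends D c b) (edges D)" for b
  proof (rule bij_betwI')
    fix a assume "a \<in> edges D"
    then obtain x where x: "x \<in> ends D" "a = arc_at D x" using edges_eq_image[OF length_crossing] by auto
    then obtain y where y: "y \<in> ends D" "y \<noteq> x" "arc_at D y = arc_at D x" using partner by blast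
    then have "face x \<in> Y \<longleftrightarrow> face y \<notin> Y" using opp[of x y] x by simp
    then have "x \<in> half_ends D c b \<or> y \<in> half_ends D c b" using x y unfolding half by blast
    then show "\<exists>x\<in>half_ends D c b. a = arc_at D x" using x y by metis
  qed (use opp half arc_at_in_edges[OF length_crossing] in auto)
  then show ?thesis using length_crossing by (auto simp: oriented_def)
qed

end

lemma is_diagram_oriented:
  assumes "is_diagram D"
  shows "\<exists>c. oriented D c"
proof -
  interpret pd_diagram D using assms by unfold_locales (auto simp: is_diagram_def)
  show ?thesis using assms by (intro ex_oriented) (simp add: is_diagram_def)
qed

section \<open>Circles of a smoothing as classes of an equivalence on all labels\<close>

definition conn :: "link_diagram \<Rightarrow> bool list \<Rightarrow> nat rel" where
  "conn D s = (let r = (\<Union>k<ncr D. smoothing (crossings D ! k) (s ! k)) in (r \<union> r\<inverse>)\<^sup>*)"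

definition circ :: "link_diagram \<Rightarrow> bool list \<Rightarrow> nat \<Rightarrow> nat set" where
  "circ D s a = conn D s `` {a}"

lemma equiv_conn: "equiv UNIV (conn D s)"
  unfolding conn_def Let_def by (rule equiv_symcl)

lemma conn_refl [simp]: "(a, a) \<in> conn D s"
  using equiv_conn by (simp add: equiv_def refl_on_def)

lemma conn_sym: "(a, b) \<in> conn D s \<Longrightarrow> (b, a) \<in> conn D s"
  using equiv_conn by (meson equivE symE)

lemma conn_trans: "(a, b) \<in> conn D s \<Longrightarrow> (b, c) \<in> conn D s \<Longrightarrow> (a, c) \<in> conn D s"
  using equiv_conn by (meson equivE transE)

lemma circles_eq: "circles D s = circ D s ` arcs D"
  by (auto simp: circles_def generated_classes_def circ_def conn_def Let_def quotient_def)

lemma in_circ: "b \<in> circ D s a \<longleftrightarrow> (a, b) \<in> conn D s"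
  by (simp add: circ_def)

lemma circ_eq_iff: "circ D s a = circ D s b \<longleftrightarrow> (a, b) \<in> conn D s"
  unfolding circ_def by (rule eq_equiv_class_iff[OF equiv_conn]) auto

lemma circ_memb: "c \<in> circles D s \<Longrightarrow> a \<in> c \<longleftrightarrow> c = circ D s a"
  unfolding circles_eq by (metis imageE in_circ circ_eq_iff)

lemma smoothing_subset_conn:
  "k < ncr D \<Longrightarrow> smoothing (crossings D ! k) (s ! k) \<subseteq> conn D s"
  unfolding conn_def Let_def by auto

lemma conn_crossing:
  assumes "k < ncr D"
  shows "if s ! k then (crossings D ! k ! 0, crossings D ! k ! 1) \<in> conn D s \<and> (crossings D ! k ! 2, crossings D ! k ! 3) \<in> conn D s
    else (crossings D ! k ! 1, crossings D ! k ! 2) \<in> conn D s \<and> (crossings D ! k ! 3, crossings D ! k ! 0) \<in> conn D s"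
  using smoothing_subset_conn[OF assms, of s] by (auto simp: smoothing_def split: if_splits)

lemma set_length_4: "length x = 4 \<Longrightarrow> set x = {x ! 0, x ! 1, x ! 2, x ! 3}"
  by (auto simp: length_Suc_conv numeral_eq_Suc)

text \<open>Each smoothing joins every odd end to an even one, so the circles touching the crossing
  are those through its ends 0 and 2.\<close>

lemma untouched_circles:
  assumes "k < ncr D" "length (crossings D ! k) = 4" "P \<subseteq> circles D s"
  shows "{c \<in> P. c \<inter> set (crossings D ! k) = {}}
    = P - {circ D s (crossings D ! k ! 0), circ D s (crossings D ! k ! 2)}"
proof -
  let ?x = "crossings D ! k"
  have "c \<inter> set ?x = {} \<longleftrightarrow> c \<noteq> circ D s (?x ! 0) \<and> c \<noteq> circ D s (?x ! 2)" if "c \<in> P" for c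
  proof -
    have c: "a \<in> c \<longleftrightarrow> c = circ D s a" for a using that assms(3) circ_memb by blast
    have "circ D s (?x ! 1) = circ D s (?x ! 0) \<and> circ D s (?x ! 3) = circ D s (?x ! 2) \<or>
        circ D s (?x ! 1) = circ D s (?x ! 2) \<and> circ D s (?x ! 3) = circ D s (?x ! 0)"
      using conn_crossing[OF assms(1), of s] by (auto simp: circ_eq_iff split: if_splits dest: conn_sym)
    then show ?thesis by (auto simp: set_length_4[OF assms(2)] c)
  qed
  then show ?thesis by auto
qed

lemma symcl_eq: assumes "N \<subseteq> (r \<union> r\<inverse>)\<^sup>*" "r \<subseteq> (N \<union> N\<inverse>)\<^sup>*"
  shows "(r \<union> r\<inverse>)\<^sup>* = (N \<union> N\<inverse>)\<^sup>*"
  using symcl_subset_equiv[OF assms(1) equiv_symcl] symcl_subset_equiv[OF assms(2) equiv_symcl] by blast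

section \<open>Orientations and smoothings\<close>

lemma oriented_uminus: "oriented D c \<Longrightarrow> oriented D (\<lambda>k. \<not> c k)"
proof -
  assume "oriented D c"
  moreover have "half_ends D (\<lambda>k. \<not> c k) b = half_ends D c (\<not> b)" for b
    by (auto simp: half_ends_def)
  ultimately show ?thesis by (simp add: oriented_def)
qed

text \<open>The smoothing as an involution of the four ends. For both markers it exchanges even and
  odd ends, hence incoming and outgoing ones if these alternate.\<close>

definition joined_end :: "bool \<Rightarrow> nat \<Rightarrow> nat" where
  "joined_end m p = (if m = even p then p + 1 else p + 3) mod 4"

lemma less_4_cases: "(p::nat) < 4 \<longleftrightarrow> p = 0 \<or> p = 1 \<or> p = 2 \<or> p = 3"
  by auto

lemma joined_end:
  assumes "p < 4"
  shows "joined_end m p < 4" "joined_end m (joined_end m p) = p" "even (joined_end m p) \<longleftrightarrow> odd p"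
  using assms by (auto simp: joined_end_def less_4_cases)

lemma smoothing_joined_end:
  "smoothing x m \<union> (smoothing x m)\<inverse> = {(x ! p, x ! joined_end m p) | p. p < 4}"
proof -
  have "{(x ! p, x ! joined_end m p) | p. p < 4} = (\<lambda>p. (x ! p, x ! joined_end m p)) ` {0, 1, 2, 3}"
    unfolding less_4_cases by blast
  moreover have "(smoothing x m)\<inverse> = (if m then {(x ! 1, x ! 0), (x ! 3, x ! 2)} else {(x ! 2, x ! 1), (x ! 0, x ! 3)})"
    by (auto simp only: smoothing_def converse_iff split: if_splits)
  ultimately show ?thesis
    by (cases m) (simp_all add: smoothing_def joined_end_def, simp_all add: insert_commute numeral_2_eq_2)
qed

context
  fixes D c assumes oriented: "oriented D c"
begin

lemma length4: "k < ncr D \<Longrightarrow> length (crossings D ! k) = 4"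
  using oriented by (simp add: oriented_def)

lemma bij_half_ends: "bij_betw (arc_at D) (half_ends D c b) (edges D)"
  using oriented by (simp add: oriented_def)

lemma half_end_of_edge:
  assumes "a \<in> edges D"
  shows "\<exists>k p. (k, p) \<in> half_ends D c True \<and> a = arc_at D (k, p)"
  using assms bij_half_ends[of True] unfolding bij_betw_def by (metis imageE surj_pair)

text \<open>The successor of an arc when its circle is traversed in the given direction: the
  crossing is entered at the incoming end of the arc and left by the end joined to it.\<close>

definition next_arc :: "bool list \<Rightarrow> nat \<Rightarrow> nat" where
  "next_arc s a = (case inv_into (half_ends D c True) (arc_at D) a of
     (k, p) \<Rightarrow> arc_at D (k, joined_end (s ! k) p))"

lemma next_arc_at:
  assumes "(k, p) \<in> half_ends D c True"
  shows "next_arc s (arc_at D (k, p)) = arc_at D (k, joined_end (s ! k) p)"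
  using assms bij_half_ends[of True] by (simp add: next_arc_def bij_betw_def)

lemma bij_next_arc: "bij_betw (next_arc s) (edges D) (edges D)"
proof -
  let ?j = "\<lambda>(k, p). (k, joined_end (s ! k) p)"
  have "bij_betw ?j (half_ends D c True) (half_ends D c False)"
    by (rule bij_betw_byWitness[where f' = ?j]) (auto simp: half_ends_def ends_def joined_end)
  from bij_betw_trans[OF this bij_half_ends]
  have "bij_betw (arc_at D \<circ> ?j \<circ> inv_into (half_ends D c True) (arc_at D)) (edges D) (edges D)"
    using bij_betw_trans[OF bij_betw_inv_into[OF bij_half_ends]] by blast
  moreover have "next_arc s = arc_at D \<circ> ?j \<circ> inv_into (half_ends D c True) (arc_at D)"
    by (auto simp: next_arc_def fun_eq_iff split: prod.splits)
  ultimately show ?thesis by simp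
qed

text \<open>Every joined pair of ends has exactly one incoming member, so the pairs are the
  successor steps up to order. Circles through crossings thereby become orbits of a
  permutation.\<close>

lemma conn_next_arc:
  defines "N s \<equiv> {(a, next_arc s a) | a. a \<in> edges D}"
  shows "conn D s = (N s \<union> (N s)\<inverse>)\<^sup>*"
proof -
  show ?thesis unfolding conn_def Let_def
  proof (rule symcl_eq)
    show "N s \<subseteq> ((\<Union>k<ncr D. smoothing (crossings D ! k) (s ! k)) \<union> (\<Union>k<ncr D. smoothing (crossings D ! k) (s ! k))\<inverse>)\<^sup>*"
    proof
      fix z assume "z \<in> N s"
      then obtain k p where kp: "(k, p) \<in> half_ends D c True" "z = (arc_at D (k, p), arc_at D (k, joined_end (s ! k) p))"
        using half_end_of_edge next_arc_at unfolding N_def by blast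
      then have "k < ncr D" "p < 4" by (auto simp: half_ends_def ends_def)
      then have "z \<in> smoothing (crossings D ! k) (s ! k) \<union> (smoothing (crossings D ! k) (s ! k))\<inverse>"
        unfolding smoothing_joined_end kp(2) arc_at_def by auto
      then show "z \<in> ((\<Union>k<ncr D. smoothing (crossings D ! k) (s ! k)) \<union> (\<Union>k<ncr D. smoothing (crossings D ! k) (s ! k))\<inverse>)\<^sup>*"
        using \<open>k < ncr D\<close> by (intro r_into_rtrancl) blast
    qed
    show "(\<Union>k<ncr D. smoothing (crossings D ! k) (s ! k)) \<subseteq> (N s \<union> (N s)\<inverse>)\<^sup>*"
    proof (rule UN_least)
      fix k assume "k \<in> {..<ncr D}"
      then have k: "k < ncr D" by simp
      show "smoothing (crossings D ! k) (s ! k) \<subseteq> (N s \<union> (N s)\<inverse>)\<^sup>*"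
      proof
        fix z assume "z \<in> smoothing (crossings D ! k) (s ! k)"
        then have "z \<in> {(crossings D ! k ! p, crossings D ! k ! joined_end (s ! k) p) | p. p < 4}"
          unfolding smoothing_joined_end[symmetric] by blast
        then obtain p where p: "p < 4" "z = (arc_at D (k, p), arc_at D (k, joined_end (s ! k) p))"
          unfolding arc_at_def by auto
        have *: "(arc_at D (k, q), arc_at D (k, joined_end (s ! k) q)) \<in> N s" if "q < 4" "even q = c k" for q
        proof -
          have h: "(k, q) \<in> half_ends D c True" using that k by (auto simp: half_ends_def ends_def)
          then have "arc_at D (k, q) \<in> edges D" using bij_half_ends unfolding bij_betw_def by blast
          then show ?thesis unfolding N_def using next_arc_at[OF h] by auto
        qed
        have "z \<in> N s \<or> z \<in> (N s)\<inverse>"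
          using *[of p] *[of "joined_end (s ! k) p"] p joined_end[OF p(1), of "s ! k"] by (cases "even p = c k") auto
        then show "z \<in> (N s \<union> (N s)\<inverse>)\<^sup>*" by blast
      qed
    qed
  qed
qed

end

text \<open>The two markers at \<open>v\<close> give successor permutations that differ by
  exchanging two values, which is the situation of \<open>orbit_swap\<close>.\<close>

lemma oriented_xor:
  assumes "oriented D c" and v: "v < ncr D" and s: "length s = ncr D"
  shows "(crossings D ! v ! 0, crossings D ! v ! 2) \<in> conn D (s[v := True])
    \<longleftrightarrow> (crossings D ! v ! 0, crossings D ! v ! 2) \<notin> conn D (s[v := False])"
proof -
  \<comment> \<open>After reversing all directions if necessary, the ends 0 and 2 of
    \<open>v\<close> are incoming; their arcs are the two whose successors are exchanged.\<close>
  obtain c where D: "oriented D c" and cv: "c v"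
    using assms(1) oriented_uminus by metis
  let ?a = "arc_at D (v, 0)" and ?b = "arc_at D (v, 2)"
  let ?f = "next_arc D c (s[v := True])" and ?g = "next_arc D c (s[v := False])"
  note bij = bij_half_ends[OF D, of True]
  have half: "(v, 0) \<in> half_ends D c True" "(v, 2) \<in> half_ends D c True"
    using v cv by (auto simp: half_ends_def ends_def)
  have "?a \<in> edges D" "?b \<in> edges D" using half bij by (auto simp: bij_betw_def)
  moreover have "?a \<noteq> ?b" using bij_betw_imp_inj_on[OF bij] half by (auto dest: inj_onD)
  moreover have "?g x = ?f x" if x0: "x \<in> edges D" "x \<noteq> ?a" "x \<noteq> ?b" for x
  proof -
    obtain k p where x: "x = arc_at D (k, p)" and kp: "(k, p) \<in> half_ends D c True"
      using half_end_of_edge[OF D x0(1)] by blast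
    have "p < 4" using kp by (auto simp: half_ends_def ends_def)
    then have "k \<noteq> v" using x0 x kp cv by (auto simp: half_ends_def less_4_cases)
    then show ?thesis unfolding x by (simp add: next_arc_at[OF D kp])
  qed
  moreover have "?g ?a = ?f ?b" "?g ?b = ?f ?a"
    using v s by (simp_all add: next_arc_at[OF D half(1)] next_arc_at[OF D half(2)] joined_end_def)
  moreover have "finite (edges D)" by (simp add: edges_def)
  ultimately have "(?a, ?b) \<in> conn D (s[v := True]) \<longleftrightarrow> (?a, ?b) \<notin> conn D (s[v := False])"
    unfolding conn_next_arc[OF D] by (intro orbit_swap[OF bij_next_arc[OF D] bij_next_arc[OF D]]) auto
  then show ?thesis by (simp add: arc_at_def)
qed

lemma conn_switch:
  assumes v: "v < ncr D" and s: "length s = ncr D"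
    and "(crossings D ! v ! 0, crossings D ! v ! 2) \<in> conn D (s[v := m])"
  shows "conn D (s[v := m]) = join_rel (conn D (s[v := \<not> m])) (crossings D ! v ! 0) (crossings D ! v ! 2)"
proof -
  let ?x = "crossings D ! v"
  define r0 where "r0 = (\<Union>k\<in>{..<ncr D} - {v}. smoothing (crossings D ! k) (s ! k))"
  have r: "(\<Union>k<ncr D. smoothing (crossings D ! k) (s[v := b] ! k)) = r0 \<union> smoothing ?x b" for b
  proof -
    have ins: "{..<ncr D} = insert v ({..<ncr D} - {v})" using v by auto
    have "(\<Union>k<ncr D. smoothing (crossings D ! k) (s[v := b] ! k)) =
       (\<Union>k\<in>{..<ncr D} - {v}. smoothing (crossings D ! k) (s[v := b] ! k)) \<union> smoothing ?x b"
      by (subst ins) (simp only: UN_insert Un_commute nth_list_update_eq[OF v[folded s]])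
    also have "(\<Union>k\<in>{..<ncr D} - {v}. smoothing (crossings D ! k) (s[v := b] ! k)) = r0"
      unfolding r0_def by (intro SUP_cong refl) simp
    finally show ?thesis .
  qed
  show ?thesis
  proof (cases m)
    case True
    have e: "(?x ! 0, ?x ! 1) \<in> conn D (s[v := True])" "(?x ! 2, ?x ! 3) \<in> conn D (s[v := True])"
      using conn_crossing[OF v, of "s[v := True]"] v s by auto
    have ac: "(?x ! 1, ?x ! 3) \<in> conn D (s[v := True])"
      using conn_trans[OF conn_trans[OF conn_sym[OF e(1)]] e(2)] assms(3) True by simp
    \<comment> \<open>For the positive marker the roles of the ends rotate by one: first the odd
      ends are glued, and with the negative marker these are connected to the ends 2 and 0.\<close>
    have "conn D (s[v := True]) = join_rel (conn D (s[v := False])) (?x ! 1) (?x ! 3)"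
      using resmoothing_join[of "r0 \<union> smoothing ?x False" r0 "?x ! 1" "?x ! 2" "?x ! 3" "?x ! 0" "r0 \<union> smoothing ?x True"] ac
      unfolding conn_def Let_def r by (simp add: smoothing_def insert_commute)
    also have "\<dots> = join_rel (conn D (s[v := False])) (?x ! 2) (?x ! 0)"
      using conn_crossing[OF v, of "s[v := False]"] v s by (intro join_cong[OF equiv_conn]) auto
    finally show ?thesis using True by (simp add: join_commute)
  next
    case False
    have "conn D (s[v := False]) = join_rel (conn D (s[v := True])) (?x ! 0) (?x ! 2)"
      using resmoothing_join[of "r0 \<union> smoothing ?x True" r0 "?x ! 0" "?x ! 1" "?x ! 2" "?x ! 3" "r0 \<union> smoothing ?x False"] assms(3) False
      unfolding conn_def Let_def r by (simp add: smoothing_def insert_commute)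
    then show ?thesis using False by simp
  qed
qed

section \<open>The differential without gradings\<close>

lemma enhanced_states_iff [simp]:
  "(s, P) \<in> enhanced_states D \<longleftrightarrow> length s = ncr D \<and> P \<subseteq> circles D s"
  by (simp add: enhanced_states_def)

text \<open>The condition on \<open>tau\<close> says that the second grading is preserved.\<close>

definition transition :: "link_diagram \<Rightarrow> nat \<Rightarrow> estate \<Rightarrow> estate \<Rightarrow> bool" where
  "transition D v S S' \<longleftrightarrow> S \<in> enhanced_states D \<and> S' \<in> enhanced_states D \<and>
     incident D v S S' \<and> fst S ! v \<and> tau D S' = tau D S + 1"

text \<open>All edges of the cube of resolutions in the direction \<open>v\<close>, without signs
  and on all bidegrees at once.\<close>

definition del :: "link_diagram \<Rightarrow> nat \<Rightarrow> (estate \<Rightarrow> 'r::ring) \<Rightarrow> estate \<Rightarrow> 'r" where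
  "del D v c = (\<lambda>S'. \<Sum>S | transition D v S S'. c S)"

text \<open>If negative circles are read as \<open>1\<close> and positive ones as \<open>x\<close> with \<open>x\<^sup>2 = 0\<close>, this is the
  multiplication by \<open>x\<close> at the arc \<open>a\<close>.\<close>

definition mult_arc :: "link_diagram \<Rightarrow> nat \<Rightarrow> (estate \<Rightarrow> 'r::ring) \<Rightarrow> estate \<Rightarrow> 'r" where
  "mult_arc D a c = (\<lambda>(s, P). if circ D s a \<in> P then c (s, P - {circ D s a}) else 0)"

definition single :: "estate \<Rightarrow> 'r \<Rightarrow> estate \<Rightarrow> 'r::ring" where
  "single S r = (\<lambda>T. if T = S then r else 0)"

lemma finite_circles:
  assumes "finite (loops D)" shows "finite (circles D s)"
  using assms by (simp add: circles_eq arcs_def edges_def)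

lemma finite_enhanced_states:
  assumes "finite (loops D)" shows "finite (enhanced_states D)"
proof -
  have "enhanced_states D = (SIGMA s:{s. set s \<subseteq> UNIV \<and> length s = ncr D}. Pow (circles D s))"
    by (auto simp: enhanced_states_def)
  moreover have "finite {s :: bool list. set s \<subseteq> UNIV \<and> length s = ncr D}"
    by (rule finite_lists_length_eq) simp
  ultimately show ?thesis using finite_circles[OF assms] by auto
qed

lemma transition_states: "transition D v S S' \<Longrightarrow> S \<in> enhanced_states D \<and> S' \<in> enhanced_states D"
  by (simp add: transition_def)

lemma finite_transitions:
  assumes "finite (loops D)" shows "finite {S. transition D v S S'}"
  by (rule finite_subset[OF _ finite_enhanced_states[OF assms]]) (auto dest: transition_states)

lemma transition_iff:
  assumes "v < ncr D" "length (crossings D ! v) = 4"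
  shows "transition D v (s, P) (s', P') \<longleftrightarrow>
    length s = ncr D \<and> s ! v \<and> s' = s[v := False] \<and> P \<subseteq> circles D s \<and> P' \<subseteq> circles D s' \<and>
    P - {circ D s (crossings D ! v ! 0), circ D s (crossings D ! v ! 2)} =
      P' - {circ D s' (crossings D ! v ! 0), circ D s' (crossings D ! v ! 2)} \<and>
    tau D (s', P') = tau D (s, P) + 1"
proof -
  have eq: "s' = s[v := False] \<longleftrightarrow> length s' = ncr D \<and> (\<forall>k<ncr D. s ! k \<noteq> s' ! k \<longleftrightarrow> k = v)"
    if "length s = ncr D" "s ! v"
  proof
    assume "length s' = ncr D \<and> (\<forall>k<ncr D. s ! k \<noteq> s' ! k \<longleftrightarrow> k = v)"
    then show "s' = s[v := False]"
      using that assms(1) by (intro nth_equalityI) (auto simp: nth_list_update)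
  qed (use that assms(1) in \<open>auto simp: nth_list_update\<close>)
  show ?thesis
  proof (cases "length s = ncr D \<and> s ! v \<and> P \<subseteq> circles D s \<and> P' \<subseteq> circles D s'")
    case True
    then have u: "P \<subseteq> circles D s" "P' \<subseteq> circles D s'" and s: "length s = ncr D" "s ! v" by auto
    show ?thesis
      unfolding transition_def incident_def prod.case enhanced_states_iff fst_conv
        untouched_circles[OF assms u(1)] untouched_circles[OF assms u(2)] eq[OF s]
      using True assms(1) by argo
  next
    case False
    then show ?thesis
      unfolding transition_def prod.case enhanced_states_iff fst_conv by argo
  qed
qed

lemma tau_eq: "finite (loops D) \<Longrightarrow> P \<subseteq> circles D s \<Longrightarrow>
    tau D (s, P) = 2 * int (card P) - int (card (circles D s))"
  using finite_circles[of D s] by (simp add: tau_def card_Diff_subset finite_subset card_mono of_nat_diff)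

subsection \<open>Merging and splitting of circles\<close>

text \<open>The multiplication table \<open>1 * 1 = 1\<close> and \<open>1 * x = x * 1 = x\<close>;
  the last clause accounts for \<open>x * x = 0\<close>.\<close>

definition merge_rel :: "'a \<Rightarrow> 'a \<Rightarrow> 'a \<Rightarrow> 'a set \<Rightarrow> 'a set \<Rightarrow> bool" where
  "merge_rel K0 K2 K P P' \<longleftrightarrow> P - {K0, K2} = P' - {K} \<and> (K \<in> P' \<longleftrightarrow> K0 \<in> P \<or> K2 \<in> P) \<and> \<not> (K0 \<in> P \<and> K2 \<in> P)"

text \<open>The comultiplication that sends 1 to 1 (x) x + x (x) 1 and x to x (x) x.\<close>

definition split_rel :: "'a \<Rightarrow> 'a \<Rightarrow> 'a \<Rightarrow> 'a set \<Rightarrow> 'a set \<Rightarrow> bool" where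
  "split_rel K K0 K2 P P' \<longleftrightarrow> P - {K} = P' - {K0, K2} \<and> (K0 \<in> P' \<or> K2 \<in> P') \<and> (K \<in> P \<longleftrightarrow> K0 \<in> P' \<and> K2 \<in> P')"

lemma card_remove_one:
  assumes "finite P" shows "card P = card (P - {K}) + of_bool (K \<in> P)"
  using card_Suc_Diff1[OF assms, of K] by (cases "K \<in> P") simp_all

lemma card_remove_two:
  assumes "finite P" "K0 \<noteq> K2"
  shows "card P = card (P - {K0, K2}) + of_bool (K0 \<in> P) + of_bool (K2 \<in> P)"
proof -
  have "P - {K0, K2} = P - {K0} - {K2}" by auto
  then show ?thesis
    using card_remove_one[OF assms(1), of K0] card_remove_one[of "P - {K0}" K2] assms by simp
qed

text \<open>As nothing changes away from the touched circles, preserving the number of positive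
  circles already enforces the multiplication table. For splits, one more positive circle enforces
  the comultiplication in the same way.\<close>

lemma merge_rel_card:
  assumes "finite P" "finite P'" "K0 \<noteq> K2"
  shows "merge_rel K0 K2 K P P' \<longleftrightarrow> P - {K0, K2} = P' - {K} \<and> card P' = card P"
proof (cases "P - {K0, K2} = P' - {K}")
  case True
  then have "card P' = card P \<longleftrightarrow> (of_bool (K \<in> P') :: nat) = of_bool (K0 \<in> P) + of_bool (K2 \<in> P)"
    using card_remove_two[OF assms(1,3), unfolded True] card_remove_one[OF assms(2), of K]
    by (simp only: add.assoc add_left_cancel)
  then show ?thesis
    unfolding merge_rel_def by (cases "K \<in> P'"; cases "K0 \<in> P"; cases "K2 \<in> P") simp_all
qed (simp add: merge_rel_def)

lemma split_rel_card:
  assumes "finite P" "finite P'" "K0 \<noteq> K2"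
  shows "split_rel K K0 K2 P P' \<longleftrightarrow> P - {K} = P' - {K0, K2} \<and> card P' = card P + 1"
proof (cases "P - {K} = P' - {K0, K2}")
  case True
  then have "card P' = card P + 1 \<longleftrightarrow> (of_bool (K \<in> P) :: nat) + 1 = of_bool (K0 \<in> P') + of_bool (K2 \<in> P')"
    using card_remove_two[OF assms(2,3), folded True] card_remove_one[OF assms(1), of K]
    by (simp only: add.assoc add_left_cancel eq_commute)
  then show ?thesis
    unfolding split_rel_def by (cases "K \<in> P"; cases "K0 \<in> P'"; cases "K2 \<in> P'") simp_all
qed (simp add: split_rel_def)

text \<open>Together with the next three lemmas this is linearity over x in combinatorial form:
  \<open>L\<close> and \<open>L'\<close> stand for the circles through one arc before and after the
  change, and removing them undoes multiplication by x at this arc.\<close>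

lemma merge_rel_delete:
  assumes "merge_rel K0 K2 K P P'" "L \<in> P" "L' = (if L \<in> {K0, K2} then K else L)"
    "K \<notin> P" "K0 \<notin> P'" "K2 \<notin> P'"
  shows "L' \<in> P' \<and> merge_rel K0 K2 K (P - {L}) (P' - {L'})"
  using assms unfolding merge_rel_def set_eq_iff Diff_iff insert_iff empty_iff
  by (smt (verit))

lemma merge_rel_insert:
  assumes "merge_rel K0 K2 K P (P' - {L'})" "L' \<in> P'" "L' = (if L \<in> {K0, K2} then K else L)"
    "K \<notin> P" "K0 \<notin> P'" "K2 \<notin> P'" "L \<noteq> K" "K0 \<noteq> K2"
  shows "L \<notin> P \<and> merge_rel K0 K2 K (insert L P) P'"
  using assms unfolding merge_rel_def set_eq_iff Diff_iff insert_iff empty_iff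
  by (smt (verit))

lemma split_rel_delete:
  assumes "split_rel K K0 K2 P P'" "L \<in> P" "L = (if L' \<in> {K0, K2} then K else L')"
    "K \<notin> P'" "K0 \<notin> P" "K2 \<notin> P" "L' \<noteq> K" "K0 \<noteq> K2"
  shows "L' \<in> P' \<and> split_rel K K0 K2 (P - {L}) (P' - {L'})"
  using assms unfolding split_rel_def set_eq_iff Diff_iff insert_iff empty_iff
  by (smt (verit))

lemma split_rel_insert:
  assumes "split_rel K K0 K2 P (P' - {L'})" "L' \<in> P'" "L = (if L' \<in> {K0, K2} then K else L')"
    "K \<notin> P'" "K0 \<notin> P" "K2 \<notin> P" "L' \<noteq> K" "K0 \<noteq> K2"
  shows "L \<notin> P \<and> split_rel K K0 K2 (insert L P) P'"
  using assms unfolding split_rel_def set_eq_iff Diff_iff insert_iff empty_iff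
  by (smt (verit))

text \<open>A split from \<open>s\<close> to \<open>t\<close> is expressed as a merge from
  \<open>t\<close> to \<open>s\<close>, so that circles are compared only once.\<close>

definition merges :: "link_diagram \<Rightarrow> nat \<Rightarrow> nat \<Rightarrow> bool list \<Rightarrow> bool list \<Rightarrow> bool" where
  "merges D a b s t \<longleftrightarrow> (a, b) \<notin> conn D s \<and> conn D t = join_rel (conn D s) a b"

text \<open>The merged circle differs from all old ones because it contains both \<open>a\<close>
  and \<open>b\<close>, which lie on different circles of \<open>s\<close>.\<close>

lemma circ_merges:
  assumes "merges D a b s t"
  shows "circ D t x = (if circ D s x \<in> {circ D s a, circ D s b} then circ D t a else circ D s x)"
    and "circ D t b = circ D t a"
    and "circ D s a \<noteq> circ D s b"
    and "circ D t a \<noteq> circ D s x"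
    and "circ D s a \<noteq> circ D t x" "circ D s b \<noteq> circ D t x"
proof -
  have ne: "(a, b) \<notin> conn D s" and t: "conn D t = join_rel (conn D s) a b"
    using assms by (auto simp: merges_def)
  have sym: "(x, y) \<in> conn D s \<longleftrightarrow> (y, x) \<in> conn D s" for x y by (auto dest: conn_sym)
  have ta: "circ D t y = circ D s a \<union> circ D s b" if "(y, a) \<in> conn D s \<or> (y, b) \<in> conn D s" for y
  proof -
    have "(z, a) \<in> conn D s \<or> (z, b) \<in> conn D s" if "(y, z) \<in> conn D s" for z
      using conn_trans[OF conn_sym[OF that]] \<open>(y, a) \<in> conn D s \<or> (y, b) \<in> conn D s\<close> by blast
    then have "(y, z) \<in> join_rel (conn D s) a b \<longleftrightarrow> (z, a) \<in> conn D s \<or> (z, b) \<in> conn D s" for z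
      using that unfolding join_rel_def by blast
    then show ?thesis unfolding set_eq_iff Un_iff in_circ t using sym by blast
  qed
  have ta': "circ D t y = circ D s y" if "\<not> ((y, a) \<in> conn D s \<or> (y, b) \<in> conn D s)" for y
    using that unfolding circ_def t join_rel_def by auto
  show 1: "circ D t x = (if circ D s x \<in> {circ D s a, circ D s b} then circ D t a else circ D s x)" for x
    using ta ta' by (auto simp: circ_eq_iff)
  show "circ D t b = circ D t a" using 1[of b] by simp
  show "circ D s a \<noteq> circ D s b" using ne by (simp add: circ_eq_iff)
  have ab: "a \<in> circ D t a" "b \<in> circ D t a" using ta[of a] by (auto simp: in_circ)
  show 2: "circ D t a \<noteq> circ D s x" for x
    using ab ne by (metis in_circ circ_eq_iff)
  show "circ D s a \<noteq> circ D t x" "circ D s b \<noteq> circ D t x"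
    using 1[of x] 2 by (metis insert_iff)+
qed

lemma circles_merges:
  assumes m: "merges D a b s t" and a: "a \<in> arcs D" and b: "b \<in> arcs D"
  shows "circles D s = insert (circ D s a) (insert (circ D s b) (circles D t - {circ D t a}))"
    and "circ D s a \<notin> circles D t" "circ D s b \<notin> circles D t" "circ D t a \<notin> circles D s"
proof -
  note 1 = circ_merges[OF m]
  have s: "circ D s x \<in> {circ D s a, circ D s b} \<or> circ D s x = circ D t x \<and> circ D s x \<noteq> circ D t a" for x
    using 1(1)[of x] 1(4)[of x] by (simp split: if_splits)
  have t: "circ D t x = circ D t a \<or> circ D t x = circ D s x" for x using 1(1)[of x] by (simp split: if_splits)
  show "circles D s = insert (circ D s a) (insert (circ D s b) (circles D t - {circ D t a}))" (is "_ = ?R")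
  proof
    show "circles D s \<subseteq> ?R"
    proof
      fix C assume "C \<in> circles D s"
      then obtain x where x: "x \<in> arcs D" "C = circ D s x" by (auto simp: circles_eq)
      then have "circ D t x \<in> circles D t" by (simp add: circles_eq)
      then show "C \<in> ?R" using s[of x] x by (metis DiffI insert_iff singletonD)
    qed
    show "?R \<subseteq> circles D s"
    proof
      fix C assume C: "C \<in> ?R"
      have "circ D s y \<in> circles D s" if "y \<in> arcs D" for y using that by (simp add: circles_eq)
      moreover have "\<exists>x\<in>arcs D. C = circ D t x" if "C \<in> circles D t" using that by (auto simp: circles_eq)
      ultimately show "C \<in> circles D s" using C t a b by (metis DiffD1 DiffD2 insertE insertI1)
    qed
  qed
  show "circ D s a \<notin> circles D t" "circ D s b \<notin> circles D t" "circ D t a \<notin> circles D s"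
    using 1(4,5,6) unfolding circles_eq by blast+
qed

lemma card_circles_merges:
  assumes m: "merges D a b s t" and "a \<in> arcs D" "b \<in> arcs D" "finite (loops D)"
  shows "card (circles D s) = card (circles D t) + 1"
proof -
  have "circ D t a \<in> circles D t" using assms by (simp add: circles_eq)
  then have "0 < card (circles D t)" using finite_circles[OF assms(4)] by (auto simp: card_gt_0_iff)
  then show ?thesis
    unfolding circles_merges(1)[OF assms(1-3)]
    using circles_merges[OF assms(1-3)] circ_merges(3)[OF m] finite_circles[OF assms(4), of t] \<open>circ D t a \<in> circles D t\<close>
    by (simp add: card_insert_if card_Diff_singleton_if)
qed

section \<open>Edge maps of a diagram with directed arcs\<close>

locale oriented_diagram =
  fixes D :: link_diagram and c0 :: "nat \<Rightarrow> bool"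
  assumes oriented: "oriented D c0" and finite_loops: "finite (loops D)"
begin

abbreviation "arc0 v \<equiv> crossings D ! v ! 0"
abbreviation "arc2 v \<equiv> crossings D ! v ! 2"

lemma arcs_crossing: "v < ncr D \<Longrightarrow> arc0 v \<in> arcs D" "v < ncr D \<Longrightarrow> arc2 v \<in> arcs D"
  using length4[OF oriented, of v] unfolding arcs_def edges_def by (auto intro!: bexI[of _ "crossings D ! v"])

text \<open>This is where the directions, and with them planarity, are used: exactly one of the two
  states connects the ends 0 and 2, and it arises from the other by gluing two circles.\<close>

lemma merge_or_split:
  assumes "v < ncr D" "length s = ncr D" "s ! v"
  shows "merges D (arc0 v) (arc2 v) s (s[v := False]) \<noteq> merges D (arc0 v) (arc2 v) (s[v := False]) s"
proof -
  have "s[v := True] = s" using assms by (metis list_update_id)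
  then show ?thesis
    using oriented_xor[OF oriented assms(1,2)] conn_switch[OF assms(1,2), of True] conn_switch[OF assms(1,2), of False]
    unfolding merges_def by (cases "(arc0 v, arc2 v) \<in> conn D s") auto
qed

text \<open>\<open>tau\<close> is twice the number of positive circles minus the number of all
  circles. The loss of a circle already raises it by one, so the number of positive circles has to
  stay the same.\<close>

lemma transition_merge:
  assumes v: "v < ncr D" "length s = ncr D" "s ! v" and m: "merges D (arc0 v) (arc2 v) s (s[v := False])"
    and PP: "P \<subseteq> circles D s" "P' \<subseteq> circles D (s[v := False])"
  shows "transition D v (s, P) (s[v := False], P') \<longleftrightarrow>
    merge_rel (circ D s (arc0 v)) (circ D s (arc2 v)) (circ D (s[v := False]) (arc0 v)) P P'"
proof -
  have fin: "finite P" "finite P'" using PP finite_circles[OF finite_loops] finite_subset by metis+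
  have "tau D (s[v := False], P') = tau D (s, P) + 1 \<longleftrightarrow> card P' = card P"
    using tau_eq[OF finite_loops] PP card_circles_merges[OF m arcs_crossing[OF v(1)] finite_loops] by auto
  then show ?thesis
    unfolding transition_iff[OF v(1) length4[OF oriented v(1)]] merge_rel_card[OF fin circ_merges(3)[OF m]]
    using v PP circ_merges(2)[OF m] by simp
qed

lemma transition_split:
  assumes v: "v < ncr D" "length s = ncr D" "s ! v" and m: "merges D (arc0 v) (arc2 v) (s[v := False]) s"
    and PP: "P \<subseteq> circles D s" "P' \<subseteq> circles D (s[v := False])"
  shows "transition D v (s, P) (s[v := False], P') \<longleftrightarrow>
    split_rel (circ D s (arc0 v)) (circ D (s[v := False]) (arc0 v)) (circ D (s[v := False]) (arc2 v)) P P'"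
proof -
  have fin: "finite P" "finite P'" using PP finite_circles[OF finite_loops] finite_subset by metis+
  have "tau D (s[v := False], P') = tau D (s, P) + 1 \<longleftrightarrow> card P' = card P + 1"
    using tau_eq[OF finite_loops] PP card_circles_merges[OF m arcs_crossing[OF v(1)] finite_loops] by auto
  then show ?thesis
    unfolding transition_iff[OF v(1) length4[OF oriented v(1)]] split_rel_card[OF fin circ_merges(3)[OF m]]
    using v PP circ_merges(2)[OF m] by simp
qed

lemma transitionD:
  assumes "transition D v (s, P) (t, P')" "v < ncr D"
  shows "length s = ncr D" "s ! v" "t = s[v := False]" "P \<subseteq> circles D s" "P' \<subseteq> circles D t"
  using assms by (auto simp: transition_iff[OF assms(2) length4[OF oriented assms(2)]])

lemma transition_delete:
  assumes v: "v < ncr D" and tr: "transition D v (s, P) (t, P')" and L: "circ D s x \<in> P"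
  shows "circ D t x \<in> P' \<and> transition D v (s, P - {circ D s x}) (t, P' - {circ D t x})"
proof -
  note tD = transitionD[OF tr v]
  have PP: "P - {circ D s x} \<subseteq> circles D s" "P' - {circ D t x} \<subseteq> circles D t" using tD(4,5) by blast+
  consider "merges D (arc0 v) (arc2 v) s t" | "merges D (arc0 v) (arc2 v) t s"
    using merge_or_split[OF v tD(1,2)] tD(3) by auto
  then show ?thesis
  proof cases
    case 1
    note cm = circles_merges(2-4)[OF 1 arcs_crossing[OF v]]
    note trm = transition_merge[OF v tD(1,2), folded tD(3), OF 1]
    have ni: "circ D t (arc0 v) \<notin> P" "circ D s (arc0 v) \<notin> P'" "circ D s (arc2 v) \<notin> P'"
      using cm tD(4,5) by blast+
    show ?thesis
      using merge_rel_delete[OF trm[OF tD(4,5), THEN iffD1, OF tr] L circ_merges(1)[OF 1, of x] ni]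
      unfolding trm[OF PP] .
  next
    case 2
    note cm = circles_merges(2-4)[OF 2 arcs_crossing[OF v]]
    note trs = transition_split[OF v tD(1,2), folded tD(3), OF 2]
    have ni: "circ D s (arc0 v) \<notin> P'" "circ D t (arc0 v) \<notin> P" "circ D t (arc2 v) \<notin> P"
      using cm tD(4,5) by blast+
    show ?thesis
      using split_rel_delete[OF trs[OF tD(4,5), THEN iffD1, OF tr] L circ_merges(1)[OF 2, of x] ni
        circ_merges(4)[OF 2, symmetric] circ_merges(3)[OF 2]]
      unfolding trs[OF PP] .
  qed
qed

lemma transition_insert:
  assumes v: "v < ncr D" and tr: "transition D v (s, P) (t, P' - {circ D t x})" and L: "circ D t x \<in> P'"
    and x: "x \<in> arcs D"
  shows "circ D s x \<notin> P \<and> transition D v (s, insert (circ D s x) P) (t, P')"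
proof -
  note tD = transitionD[OF tr v]
  have "circ D s x \<in> circles D s" "circ D t x \<in> circles D t" using x by (simp_all add: circles_eq)
  then have PP: "insert (circ D s x) P \<subseteq> circles D s" "P' \<subseteq> circles D t" using tD(4,5) by blast+
  consider "merges D (arc0 v) (arc2 v) s t" | "merges D (arc0 v) (arc2 v) t s"
    using merge_or_split[OF v tD(1,2)] tD(3) by auto
  then show ?thesis
  proof cases
    case 1
    note cm = circles_merges(2-4)[OF 1 arcs_crossing[OF v]]
    note trm = transition_merge[OF v tD(1,2), folded tD(3), OF 1]
    have ni: "circ D t (arc0 v) \<notin> P" "circ D s (arc0 v) \<notin> P'" "circ D s (arc2 v) \<notin> P'"
      using cm tD(4) PP(2) by blast+
    show ?thesis
      using merge_rel_insert[OF trm[OF tD(4,5), THEN iffD1, OF tr] L circ_merges(1)[OF 1, of x] ni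
        circ_merges(4)[OF 1, symmetric] circ_merges(3)[OF 1]]
      unfolding trm[OF PP] .
  next
    case 2
    note cm = circles_merges(2-4)[OF 2 arcs_crossing[OF v]]
    note trs = transition_split[OF v tD(1,2), folded tD(3), OF 2]
    have ni: "circ D s (arc0 v) \<notin> P'" "circ D t (arc0 v) \<notin> P" "circ D t (arc2 v) \<notin> P"
      using cm tD(4) PP(2) by blast+
    show ?thesis
      using split_rel_insert[OF trs[OF tD(4,5), THEN iffD1, OF tr] L circ_merges(1)[OF 2, of x] ni
        circ_merges(4)[OF 2, symmetric] circ_merges(3)[OF 2]]
      unfolding trs[OF PP] .
  qed
qed

text \<open>If the circle through \<open>x\<close> is positive in the target, removing it is a
  bijection from the transitions that start with this circle positive onto the transitions into the
  reduced target. If it is negative there, it was not positive before.\<close>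

lemma del_mult_arc:
  assumes v: "v < ncr D" and x: "x \<in> arcs D"
  shows "del D v (mult_arc D x c) = mult_arc D x (del D v c)"
proof
  fix S' :: estate
  obtain t P' where S': "S' = (t, P')" by (cases S')
  let ?g = "\<lambda>(s, P). (s, P - {circ D s x})" and ?h = "\<lambda>(s, P). (s, insert (circ D s x) P)"
  let ?A = "{S. transition D v S (t, P') \<and> circ D (fst S) x \<in> snd S}"
  let ?B = "{S. transition D v S (t, P' - {circ D t x})}"
  have "del D v (mult_arc D x c) S' = (\<Sum>S | transition D v S (t, P'). if circ D (fst S) x \<in> snd S then c (?g S) else 0)"
    unfolding del_def S' mult_arc_def by (intro sum.cong refl) (simp add: case_prod_beta)
  also have "\<dots> = (\<Sum>S\<in>?A. c (?g S))"
    using finite_transitions[OF finite_loops, of v] by (simp add: sum.inter_filter[symmetric])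
  also have "\<dots> = mult_arc D x (del D v c) S'"
  proof (cases "circ D t x \<in> P'")
    case False
    then have "?A = {}" using transition_delete[OF v] by fastforce
    then have "(\<Sum>S\<in>?A. c (?g S)) = 0" by (simp only: sum.empty)
    then show ?thesis using False by (simp add: mult_arc_def S')
  next
    case True
    have "(\<Sum>S\<in>?A. c (?g S)) = (\<Sum>S\<in>?B. c S)"
    proof (rule sum.reindex_bij_witness[of _ ?h ?g])
      fix S assume "S \<in> ?A"
      then show "?h (?g S) = S" "?g S \<in> ?B"
        using transition_delete[OF v, of "fst S" "snd S"] by (cases S, auto)+
    next
      fix S assume "S \<in> ?B"
      then show "?g (?h S) = S" "?h S \<in> ?A"
        using transition_insert[OF v _ True x, of "fst S" "snd S"] by (cases S, auto)+
    qed simp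
    then show ?thesis using True by (simp add: mult_arc_def S' del_def)
  qed
  finally show "del D v (mult_arc D x c) S' = mult_arc D x (del D v c) S'" .
qed

end

section \<open>Commutation of edge maps on states without positive circles\<close>

lemma mult_arc_single:
  assumes "circ D s a \<notin> P"
  shows "mult_arc D a (single (s, P) r) = single (s, insert (circ D s a) P) r"
proof
  fix T :: estate
  obtain t Q where T: "T = (t, Q)" by (cases T)
  have "circ D s a \<in> Q \<and> Q - {circ D s a} = P \<longleftrightarrow> Q = insert (circ D s a) P"
    using assms by auto
  then show "mult_arc D a (single (s, P) r) T = single (s, insert (circ D s a) P) r T"
    by (auto simp: mult_arc_def single_def T)
qed

lemma single_add: "A \<noteq> B \<Longrightarrow> (if T = A \<or> T = B then r else 0) = single A r T + single B r T"
  by (auto simp: single_def)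

lemma notin_empty: "x \<notin> {}" by simp

lemma mult_arc_commute: "mult_arc D a (mult_arc D b c) = mult_arc D b (mult_arc D a c)"
proof -
  have "P - {x} - {y} = P - {y} - {x}" for P :: "nat set set" and x y by auto
  then show ?thesis by (auto simp: mult_arc_def fun_eq_iff)
qed

lemma del_add: "del D v (c + c') = del D v c + del D v c'"
  by (auto simp: del_def fun_eq_iff sum.distrib)

lemma mult_arc_add: "mult_arc D a (c + c') = mult_arc D a c + mult_arc D a c'"
  by (auto simp: mult_arc_def fun_eq_iff)

lemma split_rel_empty:
  assumes "K0 \<noteq> K2" shows "split_rel K K0 K2 {} P \<longleftrightarrow> P = {K0} \<or> P = {K2}"
  using assms unfolding split_rel_def set_eq_iff Diff_iff insert_iff empty_iff by (smt (verit))

lemma merged_pair: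
  assumes m: "merges D a b s t" and eq: "circ D t x = circ D t y" and ne: "circ D s x \<noteq> circ D s y"
  shows "circ D s x = circ D s a \<and> circ D s y = circ D s b \<or> circ D s x = circ D s b \<and> circ D s y = circ D s a"
proof -
  have "circ D s z \<in> {circ D s a, circ D s b} \<or> circ D t z = circ D s z \<and> circ D s z \<noteq> circ D t a" for z
    using circ_merges(1)[OF m, of z] circ_merges(4)[OF m, of z] by (simp split: if_splits)
  then show ?thesis using eq ne circ_merges(1)[OF m] by (metis insertE singletonD)
qed

context oriented_diagram
begin

lemma del_single:
  "del D v (single S r) = (\<lambda>S'. if transition D v S S' then r else 0)"
  using finite_transitions[OF finite_loops] by (simp add: del_def single_def fun_eq_iff sum.delta')

lemma del_single_merge:
  assumes v: "v < ncr D" "length s = ncr D" "s ! v" and m: "merges D (arc0 v) (arc2 v) s (s[v := False])"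
  shows "del D v (single (s, {}) r) = single (s[v := False], {}) r"
proof -
  have "transition D v (s, {}) (t, P) \<longleftrightarrow> (t, P) = (s[v := False], {})" for t P
  proof (cases "t = s[v := False] \<and> P \<subseteq> circles D t")
    case True
    then have P: "P \<subseteq> circles D (s[v := False])" by metis
    show ?thesis
      using True transition_merge[OF v m empty_subsetI P] by (auto simp: merge_rel_def)
  next
    case False
    then show ?thesis using transitionD(3,5)[of v s "{}" t P, OF _ v(1)] by auto
  qed
  then show ?thesis unfolding del_single by (auto simp: single_def fun_eq_iff)
qed

lemma del_single_split:
  assumes v: "v < ncr D" "length s = ncr D" "s ! v" and m: "merges D (arc0 v) (arc2 v) (s[v := False]) s"
  shows "del D v (single (s, {}) r) =
    mult_arc D (arc0 v) (single (s[v := False], {}) r) + mult_arc D (arc2 v) (single (s[v := False], {}) r)"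
proof -
  let ?a = "circ D (s[v := False]) (arc0 v)" and ?b = "circ D (s[v := False]) (arc2 v)"
  have "?a \<noteq> ?b" by (rule circ_merges(3)[OF m])
  have "transition D v (s, {}) (t, P) \<longleftrightarrow> (t, P) = (s[v := False], {?a}) \<or> (t, P) = (s[v := False], {?b})" for t P
  proof (cases "t = s[v := False] \<and> P \<subseteq> circles D t")
    case True
    then have P: "P \<subseteq> circles D (s[v := False])" by metis
    have "split_rel (circ D s (arc0 v)) ?a ?b {} P \<longleftrightarrow> P = {?a} \<or> P = {?b}"
      by (rule split_rel_empty[OF \<open>?a \<noteq> ?b\<close>])
    then show ?thesis
      using True transition_split[OF v m empty_subsetI P] by auto
  next
    case False
    have "?a \<in> circles D (s[v := False])" "?b \<in> circles D (s[v := False])"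
      using arcs_crossing[OF v(1)] by (simp_all add: circles_eq)
    then show ?thesis using False transitionD(3,5)[of v s "{}" t P, OF _ v(1)] by auto
  qed
  then have *: "transition D v (s, {}) T \<longleftrightarrow> T = (s[v := False], {?a}) \<or> T = (s[v := False], {?b})" for T
    by (cases T) blast
  have "(s[v := False], {?a}) \<noteq> (s[v := False], {?b})" using \<open>?a \<noteq> ?b\<close> by blast
  then have "(if T = (s[v := False], {?a}) \<or> T = (s[v := False], {?b}) then r else 0) =
      single (s[v := False], {?a}) r T + single (s[v := False], {?b}) r T" for T
    by (rule single_add)
  then show ?thesis
    unfolding del_single * mult_arc_single[OF notin_empty] by (auto simp: fun_eq_iff)
qed

lemma card_circles_switch:
  assumes v: "v < ncr D" "length s = ncr D" "s ! v"
  shows "int (card (circles D (s[v := False]))) =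
    int (card (circles D s)) + (if merges D (arc0 v) (arc2 v) s (s[v := False]) then - 1 else 1)"
  using merge_or_split[OF v] card_circles_merges[OF _ arcs_crossing[OF v(1)] finite_loops] by auto

text \<open>In the absence of positive circles, a merge yields no positive circles either, and a split
  multiplies by the sum of two arcs at the crossing. Both orders contain the same number of splits,
  so the results can differ only if both orders begin with a merge or both with a split; but then
  the arcs at the two crossings lie on the same circles in the end.\<close>

lemma del_commute_one:
  assumes v: "v < ncr D" and w: "w < ncr D" and "v \<noteq> w" and s: "length s = ncr D" "s ! v" "s ! w"
  shows "del D w (del D v (single (s, {}) r)) = del D v (del D w (single (s, {}) r))"
proof -
  define s1 where "s1 = s[v := False]"
  define s2 where "s2 = s[w := False]"
  define s3 where "s3 = s1[w := False]"
  have s3: "s3 = s2[v := False]" unfolding s3_def s2_def s1_def using \<open>v \<noteq> w\<close> by (simp add: list_update_swap)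
  have s1: "length s1 = ncr D" "s1 ! w" and s2: "length s2 = ncr D" "s2 ! v"
    using s \<open>v \<noteq> w\<close> by (auto simp: s1_def s2_def)
  let ?M = "\<lambda>v s t. merges D (arc0 v) (arc2 v) s t"
  let ?Y = "\<lambda>v c. mult_arc D (arc0 v) c + mult_arc D (arc2 v) c"
  let ?o = "\<lambda>s. single (s, {}) r"
  have a: "del D v (?o s) = (if ?M v s s1 then ?o s1 else ?Y v (?o s1))"
    using del_single_merge[OF v s(1,2)] del_single_split[OF v s(1,2)] merge_or_split[OF v s(1,2)] by (auto simp: s1_def)
  have b: "del D w (?o s1) = (if ?M w s1 s3 then ?o s3 else ?Y w (?o s3))"
    using del_single_merge[OF w s1] del_single_split[OF w s1] merge_or_split[OF w s1] by (auto simp: s3_def)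
  have c: "del D w (?o s) = (if ?M w s s2 then ?o s2 else ?Y w (?o s2))"
    using del_single_merge[OF w s(1,3)] del_single_split[OF w s(1,3)] merge_or_split[OF w s(1,3)] by (auto simp: s2_def)
  have d: "del D v (?o s2) = (if ?M v s2 s3 then ?o s3 else ?Y v (?o s3))"
    using del_single_merge[OF v s2] del_single_split[OF v s2] merge_or_split[OF v s2] by (auto simp: s3)
  have L: "del D w (del D v (?o s)) = (if ?M v s s1 then del D w (?o s1) else ?Y v (del D w (?o s1)))"
    unfolding a by (simp add: del_add del_mult_arc[OF w] arcs_crossing[OF v])
  have R: "del D v (del D w (?o s)) = (if ?M w s s2 then del D v (?o s2) else ?Y w (del D v (?o s2)))"
    unfolding c by (simp add: del_add del_mult_arc[OF v] arcs_crossing[OF w])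
  have YY: "?Y v (?Y w c) = ?Y w (?Y v c)" for c
    by (simp add: mult_arc_add mult_arc_commute[of D "arc0 v"] mult_arc_commute[of D "arc2 v"] algebra_simps)
  have xor: "?M v s s1 \<noteq> ?M v s1 s" "?M w s1 s3 \<noteq> ?M w s3 s1" "?M w s s2 \<noteq> ?M w s2 s" "?M v s2 s3 \<noteq> ?M v s3 s2"
    using merge_or_split[OF v s(1,2)] merge_or_split[OF w s1] merge_or_split[OF w s(1,3)] merge_or_split[OF v s2]
    by (simp_all add: s1_def s2_def s3_def) (simp add: s3_def[symmetric] s3 s2_def[symmetric] s1_def[symmetric])
  \<comment> \<open>The number of circles of \<open>s3\<close> is computed in both orders; every
    merge contributes -1 and every split 1.\<close>
  have "(if ?M v s s1 then - 1 else 1) + (if ?M w s1 s3 then - 1 else 1) =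
     (if ?M w s s2 then - 1 else 1) + (if ?M v s2 s3 then - 1 else (1::int))"
    using card_circles_switch[OF v s(1,2)] card_circles_switch[OF w s1] card_circles_switch[OF w s(1,3)] card_circles_switch[OF v s2]
    unfolding s1_def[symmetric] s2_def[symmetric] s3_def[symmetric] s3[symmetric] by linarith
  \<comment> \<open>In \<open>same\<close> all four changes are of one kind; in \<open>cross\<close>
    the two orders begin with different kinds; in \<open>square\<close> both begin with one kind and
    end with the other.\<close>
  then consider (same) "?M v s s1 = ?M w s s2" "?M w s1 s3 = ?M v s2 s3" "?M v s s1 = ?M w s1 s3"
    | (cross) "?M v s s1 \<noteq> ?M w s s2" "?M w s1 s3 \<noteq> ?M v s2 s3" "?M v s s1 \<noteq> ?M w s1 s3"
    | (square) "?M v s s1 = ?M w s s2" "?M w s1 s3 = ?M v s2 s3" "?M v s s1 \<noteq> ?M w s1 s3"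
    by (auto split: if_splits)
  then show ?thesis
  proof cases
    case same
    then show ?thesis unfolding L R unfolding b d using YY by auto
  next
    case cross
    then show ?thesis unfolding L R unfolding b d by auto
  next
    case square
    \<comment> \<open>One order yields the sum over the arcs at \<open>v\<close>, the other the sum
      over the arcs at \<open>w\<close>.\<close>
    have "?Y v (?o s3) = ?Y w (?o s3)"
    proof -
      have "circ D s3 (arc0 v) = circ D s3 (arc0 w) \<and> circ D s3 (arc2 v) = circ D s3 (arc2 w) \<or>
        circ D s3 (arc0 v) = circ D s3 (arc2 w) \<and> circ D s3 (arc2 v) = circ D s3 (arc0 w)"
      proof (cases "?M v s s1")
        case True
        then have "?M w s3 s1" "?M v s3 s2" using square xor by auto
        moreover have "circ D s1 (arc0 v) = circ D s1 (arc2 v)" using circ_merges(2)[OF True] by simp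
        ultimately show ?thesis using merged_pair[of D "arc0 w" "arc2 w" s3 s1 "arc0 v" "arc2 v"] circ_merges(3) by blast
      next
        case False
        \<comment> \<open>Here both orders split first and then merge, and all four arcs end up on
          one circle of \<open>s3\<close>.\<close>
        then have m: "?M v s1 s" "?M w s1 s3" "?M w s2 s" "?M v s2 s3" using square xor by auto
        have "circ D s (arc0 w) = circ D s (arc2 w)" using circ_merges(2)[OF m(3)] by simp
        from merged_pair[OF m(1) this circ_merges(3)[OF m(2)]]
        have "circ D s1 (arc0 w) = circ D s1 (arc0 v) \<or> circ D s1 (arc0 w) = circ D s1 (arc2 v)" by blast
        then have "circ D s3 (arc0 w) = circ D s3 (arc0 v) \<or> circ D s3 (arc0 w) = circ D s3 (arc2 v)"
          using circ_merges(1)[OF m(2)] by metis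
        then show ?thesis using circ_merges(2)[OF m(2)] circ_merges(2)[OF m(4)] by simp
      qed
      then show ?thesis by (auto simp: mult_arc_single add.commute)
    qed
    then show ?thesis using square unfolding L R unfolding b d by auto
  qed
qed

end

section \<open>Signs and the total differential\<close>

definition sign_after :: "link_diagram \<Rightarrow> nat \<Rightarrow> (estate \<Rightarrow> 'r::ring) \<Rightarrow> estate \<Rightarrow> 'r" where
  "sign_after D v c = (\<lambda>S. if even (negative_after D v S) then c S else - c S)"

text \<open>The operator E of the overview: the sign met by a crossing that precedes all crossings
  of \<open>D\<close>.\<close>

definition sign_all :: "link_diagram \<Rightarrow> (estate \<Rightarrow> 'r::ring) \<Rightarrow> estate \<Rightarrow> 'r" where
  "sign_all D c = (\<lambda>S. if even (card {k. k < ncr D \<and> \<not> fst S ! k}) then c S else - c S)"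

definition differential :: "link_diagram \<Rightarrow> (estate \<Rightarrow> 'r::ring) \<Rightarrow> estate \<Rightarrow> 'r" where
  "differential D c = (\<Sum>v<ncr D. del D v (sign_after D v c))"

lemma sum_fun_apply: "(\<Sum>i\<in>A. f i) x = (\<Sum>i\<in>A. f i x)"
  by (induction A rule: infinite_finite_induct) auto

lemma additive_del: "additive (del D v)"
  by (rule additive.intro) (rule del_add)

lemma additive_mult_arc: "additive (mult_arc D a)"
  by (rule additive.intro) (rule mult_arc_add)

lemma additive_sign_after: "additive (sign_after D v)"
  by (rule additive.intro) (auto simp: sign_after_def fun_eq_iff)

lemma additive_sign_all: "additive (sign_all D)"
  by (rule additive.intro) (auto simp: sign_all_def fun_eq_iff)

lemma additive_differential: "additive (differential D)"
  by (rule additive.intro)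
    (simp add: differential_def additive.add[OF additive_del] additive.add[OF additive_sign_after] sum.distrib)

lemma mult_arc_sign_after: "mult_arc D a (sign_after D v c) = sign_after D v (mult_arc D a c)"
  by (auto simp: mult_arc_def sign_after_def negative_after_def fun_eq_iff)

lemma mult_arc_sign_all: "mult_arc D a (sign_all D c) = sign_all D (mult_arc D a c)"
  by (auto simp: mult_arc_def sign_all_def fun_eq_iff)

lemma sign_all_sign_all: "sign_all D (sign_all D c) = c"
  by (auto simp: sign_all_def fun_eq_iff)

lemma sign_all_sign_after: "sign_all D (sign_after D v c) = sign_after D v (sign_all D c)"
  by (auto simp: sign_all_def sign_after_def fun_eq_iff)

lemma sign_after_commute: "sign_after D w (sign_after D v c) = sign_after D v (sign_after D w c)"
  by (auto simp: sign_after_def fun_eq_iff)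

lemma incident_update:
  assumes "incident D v (s, P) (s', P')" "length s = ncr D" "length s' = ncr D"
  shows "v < ncr D" "s' = s[v := \<not> s ! v]"
proof -
  show v: "v < ncr D" using assms by (auto simp: incident_def)
  have *: "s ! k \<noteq> s' ! k \<longleftrightarrow> k = v" if "k < ncr D" for k using assms(1) that by (auto simp: incident_def)
  show "s' = s[v := \<not> s ! v]"
  proof (rule nth_equalityI)
    fix k assume "k < length s'"
    then show "s' ! k = s[v := \<not> s ! v] ! k"
      using *[of k] assms(2,3) by (cases "k = v") auto
  qed (use assms in simp)
qed

lemma transition_update:
  assumes "transition D v S S'"
  shows "v < ncr D" "length (fst S) = ncr D" "fst S ! v" "fst S' = (fst S)[v := False]"
proof -
  obtain s P s' P' where S: "S = (s, P)" "S' = (s', P')" by (cases S; cases S')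
  have i: "incident D v (s, P) (s', P')" "length s = ncr D" "length s' = ncr D" "s ! v"
    using assms by (auto simp: S transition_def)
  show "v < ncr D" "length (fst S) = ncr D" "fst S ! v" "fst S' = (fst S)[v := False]"
    using incident_update[OF i(1-3)] i by (simp_all add: S)
qed

lemma card_negative_update:
  assumes "v < n" "length s = n" "s ! v" and Q: "\<And>k. Q k \<Longrightarrow> k < n"
  shows "card {k. Q k \<and> \<not> s[v := False] ! k} = card {k. Q k \<and> \<not> s ! k} + of_bool (Q v)"
proof -
  have eq: "{k. Q k \<and> \<not> s[v := False] ! k} = (if Q v then insert v {k. Q k \<and> \<not> s ! k} else {k. Q k \<and> \<not> s ! k})"
    using assms by (auto simp: nth_list_update)
  have "{k. Q k \<and> \<not> s ! k} \<subseteq> {..<n}"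
  proof
    fix k assume "k \<in> {k. Q k \<and> \<not> s ! k}"
    then have "Q k" by simp
    then show "k \<in> {..<n}" by (simp add: Q)
  qed
  then have "finite {k. Q k \<and> \<not> s ! k}" by (rule finite_subset) simp
  then show ?thesis unfolding eq using \<open>s ! v\<close> by simp
qed

text \<open>The change at \<open>v\<close> adds one negative marker, which is counted at
  \<open>w\<close> exactly if \<open>w < v\<close>. This asymmetry makes the signed edge maps
  anticommute.\<close>

lemma sign_after_del:
  "sign_after D w (del D v c) = (if w < v then - del D v (sign_after D w c) else del D v (sign_after D w c))"
proof -
  have "negative_after D w S' = negative_after D w S + of_bool (w < v)"
    if "transition D v S S'" for S S'
    using card_negative_update[of v "ncr D" "fst S" "\<lambda>k. w < k \<and> k < ncr D"] transition_update[OF that]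
    by (simp add: negative_after_def case_prod_beta conj_assoc)
  then have "sign_after D w c S = (if even (negative_after D w S') = (w \<ge> v) then c S else - c S)"
    if "transition D v S S'" for S S'
    using that by (cases "w < v") (simp_all add: sign_after_def)
  then have "(\<Sum>S | transition D v S S'. sign_after D w c S) =
      (\<Sum>S | transition D v S S'. if even (negative_after D w S') = (w \<ge> v) then c S else - c S)" for S'
    by (intro sum.cong refl) simp
  then have "(\<Sum>S | transition D v S S'. sign_after D w c S) =
      (if even (negative_after D w S') = (w \<ge> v) then \<Sum>S | transition D v S S'. c S else - (\<Sum>S | transition D v S S'. c S))" for S'
    by (simp add: sum_negf)
  then show ?thesis by (auto simp: del_def sign_after_def fun_eq_iff)
qed

lemma sign_all_del: "sign_all D (del D v c) = - del D v (sign_all D c)"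
proof -
  have "card {k. k < ncr D \<and> \<not> fst S' ! k} = card {k. k < ncr D \<and> \<not> fst S ! k} + 1"
    if "transition D v S S'" for S S'
    using card_negative_update[of v "ncr D" "fst S" "\<lambda>k. k < ncr D"] transition_update[OF that] by simp
  then have "sign_all D c S = (if even (card {k. k < ncr D \<and> \<not> fst S' ! k}) then - c S else c S)"
    if "transition D v S S'" for S S'
    using that by (simp add: sign_all_def)
  then have "(\<Sum>S | transition D v S S'. sign_all D c S) =
      (\<Sum>S | transition D v S S'. if even (card {k. k < ncr D \<and> \<not> fst S' ! k}) then - c S else c S)" for S'
    by (intro sum.cong refl) simp
  then have "(\<Sum>S | transition D v S S'. sign_all D c S) =
      (if even (card {k. k < ncr D \<and> \<not> fst S' ! k}) then - (\<Sum>S | transition D v S S'. c S) else \<Sum>S | transition D v S S'. c S)" for S'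
    by (simp add: sum_negf)
  then show ?thesis by (auto simp: del_def sign_all_def fun_eq_iff)
qed

lemma differential_sign_all: "differential D (sign_all D c) = - sign_all D (differential D c)"
  by (simp add: differential_def additive.sum[OF additive_sign_all] sign_all_del sign_all_sign_after sum_negf)

lemma del_eq_0:
  assumes "\<And>S. fst S ! v \<Longrightarrow> c S = 0" shows "del D v c = 0"
  using assms transition_update(3) by (force simp: del_def fun_eq_iff intro!: sum.neutral)

lemma del_marker:
  assumes "\<And>S. fst S ! v \<Longrightarrow> c S = 0" "v \<noteq> w" "fst S' ! v" shows "del D w c S' = 0"
  unfolding del_def
proof (rule sum.neutral, intro ballI)
  fix S assume "S \<in> {S. transition D w S S'}"
  then have "fst S' = (fst S)[w := False]" using transition_update by blast
  then have "fst S ! v" using assms(2,3) by simp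
  then show "c S = 0" by (rule assms(1))
qed

lemma del_del_same: "del D v (del D v c) = 0"
proof (rule del_eq_0)
  fix S :: estate assume S: "fst S ! v"
  have "\<not> transition D v S0 S" for S0
    using transition_update(1,2,4)[of D v S0 S] S by (metis nth_list_update_eq)
  then show "del D v c S = 0" by (simp add: del_def)
qed

context oriented_diagram
begin

text \<open>Every enhanced state is the product of arcs with a state without positive circles.\<close>

lemma del_commute_single:
  assumes v: "v < ncr D" and w: "w < ncr D" and vw: "v \<noteq> w"
  shows "del D w (del D v (single S r)) = del D v (del D w (single S r))"
proof -
  obtain s P where S: "S = (s, P)" by (cases S)
  consider "S \<notin> enhanced_states D" | "\<not> s ! v" | "\<not> s ! w" | "S \<in> enhanced_states D" "s ! v" "s ! w" by blast
  then show ?thesis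
  proof cases
    case 1
    then have "del D u (single S r) = 0" for u
      using transition_states by (fastforce simp: del_single fun_eq_iff)
    then show ?thesis by (simp add: additive.zero[OF additive_del])
  next
    case 2
    then have z: "\<And>T. fst T ! v \<Longrightarrow> single S r T = 0" by (auto simp: single_def S)
    have "del D v (del D w (single S r)) = 0" by (rule del_eq_0) (rule del_marker[OF z vw])
    moreover have "del D v (single S r) = 0" using z by (rule del_eq_0)
    ultimately show ?thesis by (simp add: additive.zero[OF additive_del])
  next
    case 3
    then have z: "\<And>T. fst T ! w \<Longrightarrow> single S r T = 0" by (auto simp: single_def S)
    have "del D w (del D v (single S r)) = 0" by (rule del_eq_0) (rule del_marker[OF z vw[symmetric]])
    moreover have "del D w (single S r) = 0" using z by (rule del_eq_0)
    ultimately show ?thesis by (simp add: additive.zero[OF additive_del])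
  next
    case 4
    then have s: "length s = ncr D" and P: "P \<subseteq> circles D s" by (simp_all add: S)
    have "finite P" using P finite_circles[OF finite_loops] by (rule finite_subset)
    then have "del D w (del D v (single (s, P) r)) = del D v (del D w (single (s, P) r))" using P
    proof (induction P rule: finite_induct)
      case empty
      show ?case by (rule del_commute_one[OF v w vw s 4(2,3)])
    next
      case (insert C P)
      then obtain x where x: "x \<in> arcs D" "C = circ D s x" by (auto simp: circles_eq)
      then have "single (s, insert C P) r = mult_arc D x (single (s, P) r)"
        using insert.hyps by (simp add: mult_arc_single)
      then show ?case using insert by (simp add: del_mult_arc v w x)
    qed
    then show ?thesis by (simp add: S)
  qed
qed

lemma del_commute:
  assumes v: "v < ncr D" and w: "w < ncr D" and vw: "v \<noteq> w"
  shows "del D w (del D v c) = del D v (del D w c)"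
proof -
  \<comment> \<open>\<open>c\<close> may be nonzero at infinitely many pairs, but \<open>del\<close>
    sees only the finitely many enhanced states; cut down to these, \<open>c\<close> is a finite sum
    of \<open>single\<close> chains.\<close>
  define cut where "cut F = (\<lambda>S. if S \<in> F then c S else 0)" for F
  have "del D u c = del D u (cut (enhanced_states D))" for u
    unfolding del_def cut_def using transition_states by (auto intro!: sum.cong simp: fun_eq_iff)
  moreover have "del D w (del D v (cut F)) = del D v (del D w (cut F))" if "finite F" for F
    using that
  proof (induction F rule: finite_induct)
    case empty
    have "cut {} = 0" by (simp add: cut_def fun_eq_iff)
    then show ?case by (simp only: additive.zero[OF additive_del])
  next
    case (insert S F)
    have "cut (insert S F) = single S (c S) + cut F" using insert.hyps by (auto simp: cut_def single_def fun_eq_iff)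
    show ?case
      unfolding \<open>cut (insert S F) = single S (c S) + cut F\<close> del_add insert.IH del_commute_single[OF assms] ..
  qed
  ultimately show ?thesis using finite_enhanced_states[OF finite_loops] by metis
qed

text \<open>The double sum is antisymmetric in the two crossings: the same term \<open>G\<close>
  occurs with opposite signs for the two orders, and changing one marker twice gives 0.\<close>

lemma differential_differential: "differential D (differential D c) = 0"
proof -
  define G where "G w v = del D w (del D v (sign_after D w (sign_after D v c)))" for w v
  let ?n = "ncr D"
  have G: "G w v = G v w" if "v < ?n" "w < ?n" for v w
    using del_commute[OF that] sign_after_commute unfolding G_def by (metis (no_types))
  have term_eq: "del D w (sign_after D w (del D v (sign_after D v c))) =
      (if v < w then G w v else 0) - (if w < v then G w v else 0)" for v w
    using del_del_same by (cases v w rule: linorder_cases)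
      (simp_all add: sign_after_del G_def additive.minus[OF additive_del])
  have "differential D (differential D c) = (\<Sum>w<?n. \<Sum>v<?n. del D w (sign_after D w (del D v (sign_after D v c))))"
    by (simp add: differential_def additive.sum[OF additive_del] additive.sum[OF additive_sign_after])
  also have "\<dots> = (\<Sum>w<?n. \<Sum>v<?n. if v < w then G w v else 0) - (\<Sum>w<?n. \<Sum>v<?n. if w < v then G w v else 0)"
    by (simp add: term_eq sum_subtractf)
  also have "(\<Sum>w<?n. \<Sum>v<?n. if w < v then G w v else 0) = (\<Sum>v<?n. \<Sum>w<?n. if w < v then G w v else 0)"
    by (rule sum.swap)
  also have "\<dots> = (\<Sum>w<?n. \<Sum>v<?n. if v < w then G w v else 0)"
    by (intro sum.cong refl) (simp add: G)
  finally show ?thesis by (simp only: diff_self)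
qed

lemma differential_mult_arc:
  "x \<in> arcs D \<Longrightarrow> differential D (mult_arc D x c) = mult_arc D x (differential D c)"
  by (simp add: differential_def additive.sum[OF additive_mult_arc] del_mult_arc mult_arc_sign_after flip: mult_arc_sign_after)

end

lemma differential_scale: "differential D (\<lambda>S. a * c S) = (\<lambda>S. a * differential D c S)"
  by (auto simp: differential_def sum_fun_apply del_def sign_after_def sum_distrib_left fun_eq_iff intro!: sum.cong)

section \<open>Comparison with the graded differential\<close>

lemma sigma_update:
  assumes "v < length s"
  shows "sigma (s[v := b], P') = sigma (s, P) + (if b then 1 else - 1) - (if s ! v then 1 else - 1)"
proof -
  have eq: "sigma (t, Q) = (\<Sum>k<length t. if t ! k then 1 else - 1)" for t Q
    by (simp add: sigma_def sum_list_sum_nth atLeast0LessThan)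
  have rem: "(\<Sum>k<length s. f k) = f v + (\<Sum>k\<in>{..<length s} - {v}. f k)" for f :: "nat \<Rightarrow> int"
    using assms by (simp add: sum.remove)
  have "(\<Sum>k\<in>{..<length s} - {v}. if s[v := b] ! k then 1 else - 1 :: int) = (\<Sum>k\<in>{..<length s} - {v}. if s ! k then 1 else - 1)"
    by (intro sum.cong refl) auto
  then show ?thesis unfolding eq length_list_update rem using assms by simp
qed

lemma in_chains: "c \<in> carrier (chains D i j) \<longleftrightarrow> (\<forall>S. S \<notin> generators D i j \<longrightarrow> c S = 0)"
  by (simp add: chains_def)

text \<open>Lowering \<open>sigma\<close> by 2 forces a positive marker to become negative, and
  keeping \<open>sigma + 2 * tau\<close> then raises \<open>tau\<close> by 1; so incidences between
  the two bidegrees are exactly the transitions.\<close>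

lemma khovanov_d_eq:
  assumes fin: "finite (loops D)" and c: "c \<in> carrier (chains D i j)"
  shows "khovanov_d D i j c = differential D c"
proof
  fix S' :: estate
  have c0: "c S = 0" if "S \<notin> generators D i j" for S using c that unfolding in_chains by blast
  have gen: "transition D v S S' \<longleftrightarrow> incident D v S S'"
    if "S \<in> generators D i j" "S' \<in> generators D (i - 2) j" for S v
  proof
    assume inc: "incident D v S S'"
    obtain s P s' P' where S: "S = (s, P)" "S' = (s', P')" by (cases S; cases S')
    have l: "length s = ncr D" "length s' = ncr D" using that by (auto simp: S generators_def)
    note u = incident_update[OF inc[unfolded S] l]
    have "sigma S' = sigma S - 2" using that by (simp add: generators_def)
    then have "s ! v" using sigma_update[of v s "\<not> s ! v" P' P] u l by (auto simp: S split: if_splits)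
    moreover have "tau D S' = tau D S + 1" using that by (auto simp: generators_def)
    ultimately show "transition D v S S'" using inc that by (simp add: transition_def generators_def S)
  qed (simp add: transition_def)
  have gen': "S' \<in> generators D (i - 2) j" if "transition D v S S'" "S \<in> generators D i j" for S v
  proof -
    have "sigma S' = sigma S - 2"
      using sigma_update[of v "fst S" False "snd S'" "snd S"] transition_update[OF that(1)]
      by (simp del: prod.collapse) (metis prod.collapse)
    then show ?thesis using that by (auto simp: generators_def transition_def)
  qed
  have finG: "finite (generators D i j)"
    using finite_enhanced_states[OF fin] by (simp add: generators_def)
  have R: "differential D c S' = (\<Sum>v<ncr D. \<Sum>S\<in>generators D i j. if transition D v S S' then sign_after D v c S else 0)"
  proof -
    have "(\<Sum>S | transition D v S S'. sign_after D v c S) = (\<Sum>S\<in>generators D i j. if transition D v S S' then sign_after D v c S else 0)" for v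
    proof -
      have "(\<Sum>S | transition D v S S'. sign_after D v c S) = (\<Sum>S | S \<in> generators D i j \<and> transition D v S S'. sign_after D v c S)"
        using finite_transitions[OF fin, of v S'] c0 by (intro sum.mono_neutral_right) (auto simp: sign_after_def)
      then show ?thesis using finG by (simp add: sum.inter_filter[symmetric])
    qed
    then show ?thesis by (simp add: differential_def sum_fun_apply del_def)
  qed
  show "khovanov_d D i j c S' = differential D c S'"
  proof (cases "S' \<in> generators D (i - 2) j")
    case False
    then have "differential D c S' = 0" unfolding R using gen' by (intro sum.neutral ballI) auto
    then show ?thesis using False by (simp add: khovanov_d_def)
  next
    case True
    have "(\<Sum>v<ncr D. if transition D v S S' then sign_after D v c S else 0) = (\<Sum>v | incident D v S S'. sign_after D v c S)"
      if "S \<in> generators D i j" for S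
    proof -
      have "{v. incident D v S S'} = {v \<in> {..<ncr D}. transition D v S S'}"
        using gen[OF that True] transition_update(1) by blast
      then show ?thesis by (simp only: sum.inter_filter finite_lessThan)
    qed
    then show ?thesis
      unfolding R by (subst sum.swap) (simp add: khovanov_d_def True sign_after_def)
  qed
qed

lemma differential_chains:
  assumes "finite (loops D)" "c \<in> carrier (chains D i j)"
  shows "differential D c \<in> carrier (chains D (i - 2) j)"
  unfolding khovanov_d_eq[OF assms, symmetric] by (simp add: in_chains khovanov_d_def)

section \<open>The circles of a diagram with an added Hopf link\<close>

lemma conn_arcs:
  assumes "\<And>k. k < ncr D \<Longrightarrow> length (crossings D ! k) = 4" "(a, b) \<in> conn D s"
  shows "a = b \<or> a \<in> edges D \<and> b \<in> edges D"
proof -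
  have "crossings D ! k ! p \<in> edges D" if "k < ncr D" "p < 4" for k p
    using that assms(1)[OF that(1)] unfolding edges_def by (auto intro!: bexI[of _ "crossings D ! k"])
  then have "smoothing (crossings D ! k) m \<subseteq> {(a, b). a = b \<or> a \<in> edges D \<and> b \<in> edges D}" if "k < ncr D" for k m
    using that by (auto simp: smoothing_def)
  then have "conn D s \<subseteq> {(a, b). a = b \<or> a \<in> edges D \<and> b \<in> edges D}"
    unfolding conn_def Let_def
    by (intro symcl_subset_equiv UN_least) (auto simp: equiv_def refl_on_def sym_def trans_def)
  then show ?thesis using assms(2) by auto
qed

text \<open>The common form of both kinds of Hopf link addition: \<open>w\<close> is fresh if the
  cut arc ends at crossings, and equals \<open>e\<close> if it is a loop. Renaming \<open>w\<close>
  to \<open>e\<close> in \<open>cs\<close> restores the crossings of \<open>D\<close>. The loops are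
  compared up to \<open>e\<close>, which is no longer among them once it has been cut.\<close>

locale hopf = oriented_diagram D c0 for D c0 +
  fixes D' :: link_diagram and u l r e w :: nat and h0 h1 :: "nat list" and cs :: "nat list list"
  assumes e_arc: "e \<in> arcs D" and fresh: "u \<notin> arcs D" "l \<notin> arcs D" "r \<notin> arcs D"
    and w: "w = e \<or> w \<notin> arcs D" and distinct: "u \<noteq> l" "u \<noteq> r" "l \<noteq> r" "w \<noteq> u" "w \<noteq> l" "w \<noteq> r"
    and crossings': "crossings D' = h0 # h1 # cs" and length_cs: "length cs = ncr D"
    and cs: "\<And>k. k < ncr D \<Longrightarrow> map (id(w := e)) (cs ! k) = crossings D ! k"
    and hs: "h0 = [l, e, r, u] \<and> h1 = [u, r, w, l] \<or> h0 = [u, r, w, l] \<and> h1 = [l, e, r, u]"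
    and loops': "insert e (loops D') = insert e (loops D)"
begin

lemma ncr': "ncr D' = Suc (Suc (ncr D))"
  by (simp add: crossings' length_cs)

lemma finite_loops': "finite (loops D')"
  using finite_loops loops' by (metis finite_insert)

text \<open>The retraction onto the arcs of \<open>D\<close>, together with \<open>u\<close> standing for the small circle if there
  is one.\<close>

definition retr :: "bool \<Rightarrow> bool \<Rightarrow> nat \<Rightarrow> nat" where
  "retr m0 m1 a = (if a = w then e else if a = u then (if m0 = m1 then u else e)
     else if a = l then (if m0 \<or> m1 then e else u) else if a = r then (if m0 \<and> m1 then u else e) else a)"

lemma e_neq: "e \<noteq> u" "e \<noteq> l" "e \<noteq> r"
  using e_arc fresh by auto

lemma retr_simps [simp]:
  "retr m0 m1 w = e" "retr m0 m1 e = e" "retr m0 m1 u = (if m0 = m1 then u else e)"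
  "retr m0 m1 l = (if m0 \<or> m1 then e else u)" "retr m0 m1 r = (if m0 \<and> m1 then u else e)"
  using distinct e_neq by (simp_all add: retr_def not_sym[OF distinct(1)] not_sym[OF distinct(2)] not_sym[OF distinct(3)]
    not_sym[OF distinct(4)] not_sym[OF distinct(5)] not_sym[OF distinct(6)])

lemma retr_arcs: "a \<in> arcs D \<Longrightarrow> retr m0 m1 a = a"
  using fresh w by (auto simp: retr_def)

lemma cs_nth:
  assumes "k < ncr D" "p < 4"
  shows "retr m0 m1 (cs ! k ! p) = crossings D ! k ! p" "cs ! k ! p \<in> insert w (arcs D)"
proof -
  have l: "length (crossings D ! k) = 4" by (rule length4[OF oriented assms(1)])
  have l': "length (cs ! k) = 4" using arg_cong[OF cs[OF assms(1)], of length] l by simp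
  have eq: "(id(w := e)) (cs ! k ! p) = crossings D ! k ! p"
    using cs[OF assms(1), symmetric] assms(2) l' by simp
  have "crossings D ! k ! p \<in> edges D"
    using assms l unfolding edges_def by (auto intro!: bexI[of _ "crossings D ! k"])
  then have arc: "crossings D ! k ! p \<in> arcs D" by (simp add: arcs_def)
  then show in_arcs: "cs ! k ! p \<in> insert w (arcs D)" using eq by (auto split: if_splits)
  show "retr m0 m1 (cs ! k ! p) = crossings D ! k ! p"
  proof (cases "cs ! k ! p = w")
    case True
    then show ?thesis using eq retr_simps(1) by simp
  next
    case False
    then show ?thesis using eq in_arcs retr_arcs[of "cs ! k ! p"] by simp
  qed
qed

lemma length_cs_nth: "k < ncr D \<Longrightarrow> length (cs ! k) = 4"
  using arg_cong[OF cs, of k length] length4[OF oriented, of k] by simp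

lemma length4': "k < ncr D' \<Longrightarrow> length (crossings D' ! k) = 4"
  using hs length_cs_nth by (auto simp: crossings' length_cs nth_Cons split: nat.splits)

lemma arcs': "arcs D' = arcs D \<union> {u, w, l, r}"
proof -
  have E: "edges D' = {l, e, r, u, w} \<union> \<Union> (set ` set cs)"
    using hs by (auto simp: edges_def crossings')
  have 1: "\<Union> (set ` set cs) \<subseteq> insert w (arcs D)"
  proof
    fix a assume "a \<in> \<Union> (set ` set cs)"
    then obtain x where "x \<in> set cs" "a \<in> set x" by blast
    then obtain k p where "k < length cs" "p < length (cs ! k)" "a = cs ! k ! p" by (metis in_set_conv_nth)
    then show "a \<in> insert w (arcs D)" using cs_nth(2)[of k p] length_cs_nth[of k] by (simp add: length_cs)
  qed
  have 2: "edges D \<subseteq> insert e (\<Union> (set ` set cs))"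
  proof
    fix a assume "a \<in> edges D"
    then obtain x where "x \<in> set (crossings D)" "a \<in> set x" by (auto simp: edges_def)
    then obtain k where k: "k < ncr D" "a \<in> set (crossings D ! k)" by (metis in_set_conv_nth)
    then have "a \<in> (id(w := e)) ` set (cs ! k)" using cs[OF k(1), symmetric] by (simp only: set_map)
    then have "a = e \<or> a \<in> set (cs ! k)" by (auto split: if_splits)
    moreover have "cs ! k \<in> set cs" using k length_cs by simp
    ultimately show "a \<in> insert e (\<Union> (set ` set cs))" by blast
  qed
  have "arcs D' = {l, e, r, u, w} \<union> \<Union> (set ` set cs) \<union> insert e (loops D')"
    unfolding arcs_def E by blast
  also have "\<dots> = {l, e, r, u, w} \<union> \<Union> (set ` set cs) \<union> loops D"
    unfolding loops' by blast
  also have "\<dots> = arcs D \<union> {u, w, l, r}"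
    using 1 2 e_arc unfolding arcs_def by blast
  finally show ?thesis .
qed

lemma smoothing_hopf:
  assumes "(a, b) \<in> smoothing h0 m0 \<union> smoothing h1 m1"
  shows "retr m0 m1 a = retr m0 m1 b"
  using assms hs by (auto simp: smoothing_def split: if_splits)

lemma conn_smoothing':
  "k < ncr D \<Longrightarrow> smoothing (cs ! k) (s ! k) \<subseteq> conn D' (m0 # m1 # s)"
  "smoothing h0 m0 \<subseteq> conn D' (m0 # m1 # s)" "smoothing h1 m1 \<subseteq> conn D' (m0 # m1 # s)"
  using smoothing_subset_conn[of "Suc (Suc k)" D' "m0 # m1 # s"] smoothing_subset_conn[of 0 D' "m0 # m1 # s"]
    smoothing_subset_conn[of 1 D' "m0 # m1 # s"] by (simp_all add: ncr' crossings' length_cs)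

lemma circ_hopf_eq:
  "circ D' (m0 # m1 # s) (retr m0 m1 a) = circ D' (m0 # m1 # s) a"
proof -
  define K where "K = circ D' (m0 # m1 # s)"
  have K: "K a = K b" if "(a, b) \<in> smoothing h0 m0 \<or> (a, b) \<in> smoothing h1 m1" for a b
    using that conn_smoothing'[where ?m0.0 = m0 and ?m1.0 = m1 and s = s] unfolding K_def circ_eq_iff by blast
  have "K u = K (retr m0 m1 u) \<and> K w = K e \<and> K l = K (retr m0 m1 l) \<and> K r = K (retr m0 m1 r)"
    using hs K[of "h0 ! 0" "h0 ! 1"] K[of "h0 ! 2" "h0 ! 3"] K[of "h0 ! 1" "h0 ! 2"] K[of "h0 ! 3" "h0 ! 0"]
      K[of "h1 ! 0" "h1 ! 1"] K[of "h1 ! 2" "h1 ! 3"] K[of "h1 ! 1" "h1 ! 2"] K[of "h1 ! 3" "h1 ! 0"]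
    by (cases m0; cases m1) (auto simp: smoothing_def)
  then have "K (retr m0 m1 a) = K a" by (cases "a \<in> {u, w, l, r}") (auto simp: retr_def)
  then show ?thesis by (simp add: K_def)
qed

text \<open>The retraction collapses the smoothings of the new crossings, and conversely every label
  lies on the same circle of \<open>D'\<close> as its retraction.\<close>

lemma conn_hopf: "(a, b) \<in> conn D' (m0 # m1 # s) \<longleftrightarrow> (retr m0 m1 a, retr m0 m1 b) \<in> conn D s"
proof -
  let ?t = "m0 # m1 # s" and ?\<rho> = "retr m0 m1"
  have "conn D' ?t \<subseteq> {(a, b). (?\<rho> a, ?\<rho> b) \<in> conn D s}"
    unfolding conn_def[of D'] Let_def
  proof (rule symcl_subset_equiv, rule UN_least)
    fix k assume "k \<in> {..<ncr D'}"
    then consider "k = 0" | "k = 1" | j where "k = Suc (Suc j)" "j < ncr D"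
      by (cases k; cases "k - 1") (auto simp: ncr')
    then show "smoothing (crossings D' ! k) (?t ! k) \<subseteq> {(a, b). (?\<rho> a, ?\<rho> b) \<in> conn D s}"
    proof cases
      case 1
      then show ?thesis using smoothing_hopf by (fastforce simp: crossings')
    next
      case 2
      then show ?thesis using smoothing_hopf by (fastforce simp: crossings')
    next
      case 3
      have "(?\<rho> a, ?\<rho> b) \<in> smoothing (crossings D ! j) (s ! j)" if "(a, b) \<in> smoothing (cs ! j) (s ! j)" for a b
        using that cs_nth(1)[OF 3(2)] by (auto simp: smoothing_def split: if_splits)
      then show ?thesis using smoothing_subset_conn[OF 3(2), of s] 3(1) by (auto simp: crossings')
    qed
  next
    show "equiv UNIV {(a, b). (?\<rho> a, ?\<rho> b) \<in> conn D s}"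
      by (rule equivI) (auto simp: refl_on_def sym_def trans_def intro: conn_sym conn_trans)
  qed
  moreover have "conn D s \<subseteq> conn D' ?t"
    unfolding conn_def[of D] Let_def
  proof (rule symcl_subset_equiv[OF UN_least equiv_conn])
    fix k assume "k \<in> {..<ncr D}"
    then have k: "k < ncr D" by simp
    have *: "(?\<rho> a, ?\<rho> b) \<in> conn D' ?t" if "(a, b) \<in> smoothing (cs ! k) (s ! k)" for a b
    proof -
      have "(a, b) \<in> conn D' ?t" using conn_smoothing'(1)[OF k] that by blast
      then show ?thesis unfolding circ_eq_iff[symmetric] circ_hopf_eq .
    qed
    have "(crossings D ! k ! p, crossings D ! k ! q) \<in> conn D' ?t"
      if "(cs ! k ! p, cs ! k ! q) \<in> smoothing (cs ! k) (s ! k)" "p < 4" "q < 4" for p q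
      using *[OF that(1)] cs_nth(1)[OF k] that(2,3) by simp
    from this[of 0 1] this[of 2 3] this[of 1 2] this[of 3 0]
    show "smoothing (crossings D ! k) (s ! k) \<subseteq> conn D' ?t"
      by (cases "s ! k") (simp_all add: smoothing_def)
  qed
  moreover have "(a, b) \<in> conn D' ?t \<longleftrightarrow> (?\<rho> a, ?\<rho> b) \<in> conn D' ?t"
    unfolding circ_eq_iff[symmetric] circ_hopf_eq ..
  ultimately show ?thesis by blast
qed

lemma circ_hopf: "circ D' (m0 # m1 # s) a = retr m0 m1 -` circ D s (retr m0 m1 a)"
  by (auto simp: in_circ conn_hopf)

definition base :: "bool \<Rightarrow> bool \<Rightarrow> nat set" where
  "base m0 m1 = (if m0 = m1 then insert u (arcs D) else arcs D)"

lemma retr_base: "a \<in> base m0 m1 \<Longrightarrow> retr m0 m1 a = a"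
  using retr_arcs by (auto simp: base_def split: if_splits)

lemma retr_image: "retr m0 m1 ` arcs D' = base m0 m1"
proof
  show "retr m0 m1 ` arcs D' \<subseteq> base m0 m1"
    using retr_arcs e_arc by (auto simp: arcs' base_def)
  have "base m0 m1 \<subseteq> arcs D'" by (auto simp: base_def arcs')
  show "base m0 m1 \<subseteq> retr m0 m1 ` arcs D'"
  proof
    fix a assume a: "a \<in> base m0 m1"
    then have "a \<in> arcs D'" using \<open>base m0 m1 \<subseteq> arcs D'\<close> by blast
    then have "retr m0 m1 a \<in> retr m0 m1 ` arcs D'" by (rule imageI)
    then show "a \<in> retr m0 m1 ` arcs D'" by (simp only: retr_base[OF a])
  qed
qed

text \<open>As \<open>u\<close> is not an arc of \<open>D\<close>, it forms a class of its own,
  which serves as a model of the small circle.\<close>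

lemma circ_u: "circ D s u = {u}"
proof -
  have "b = u" if "(u, b) \<in> conn D s" for b
    using conn_arcs[OF length4[OF oriented] that] fresh(1) by (auto simp: arcs_def)
  then show ?thesis unfolding circ_def by auto
qed

lemma circ_subset:
  assumes "a \<in> arcs D" shows "circ D s a \<subseteq> arcs D"
proof
  fix b assume "b \<in> circ D s a"
  then show "b \<in> arcs D"
    using conn_arcs[OF length4[OF oriented], of a b s] assms by (auto simp: in_circ arcs_def)
qed

lemma circles_subset: "K \<in> circles D s \<Longrightarrow> K \<subseteq> arcs D"
  using circ_subset by (auto simp: circles_eq)

lemma u_notin_circle: "K \<in> circles D s \<Longrightarrow> u \<notin> K" "{u} \<notin> circles D s"
  using circles_subset fresh(1) by blast+

definition circles_u :: "bool \<Rightarrow> bool \<Rightarrow> bool list \<Rightarrow> nat set set" where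
  "circles_u m0 m1 s = (if m0 = m1 then insert {u} (circles D s) else circles D s)"

lemma circles_hopf: "circles D' (m0 # m1 # s) = vimage (retr m0 m1) ` circles_u m0 m1 s"
proof -
  have "circles D' (m0 # m1 # s) = vimage (retr m0 m1) ` circ D s ` retr m0 m1 ` arcs D'"
    by (simp add: circles_eq circ_hopf image_image)
  also have "circ D s ` retr m0 m1 ` arcs D' = circles_u m0 m1 s"
    unfolding retr_image by (simp add: base_def circles_u_def circles_eq circ_u)
  finally show ?thesis .
qed

lemma inj_vimage_retr: "inj_on (vimage (retr m0 m1)) (Pow (base m0 m1))"
proof (rule inj_onI)
  fix A B assume "A \<in> Pow (base m0 m1)" "B \<in> Pow (base m0 m1)" "retr m0 m1 -` A = retr m0 m1 -` B"
  moreover have "retr m0 m1 -` C \<inter> base m0 m1 = C" if C: "C \<subseteq> base m0 m1" for C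
  proof -
    have "a \<in> retr m0 m1 -` C \<longleftrightarrow> a \<in> C" if "a \<in> base m0 m1" for a
      unfolding vimage_eq retr_base[OF that] ..
    then show ?thesis using C by blast
  qed
  ultimately show "A = B" by (metis PowD)
qed

lemma circles_u_base: "circles_u m0 m1 s \<subseteq> Pow (base m0 m1)"
  using circles_subset by (auto simp: circles_u_def base_def)

text \<open>The retraction depends on the markers of the new crossings, but circles away from the
  cut arc are the same sets for all of them. This makes states before and after a change at a new
  crossing comparable.\<close>

lemma vimage_untouched:
  assumes "K \<subseteq> arcs D" "e \<notin> K" shows "retr m0 m1 -` K = K"
proof -
  have "retr m0 m1 a \<in> K \<longleftrightarrow> a \<in> K" for a
  proof (cases "a \<in> {u, w, l, r}")
    case True
    moreover have "a \<notin> K" using True assms fresh w by auto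
    moreover have "u \<notin> K" using assms fresh by auto
    ultimately show ?thesis using assms(2) by (auto split: if_splits)
  qed (auto simp: retr_def)
  then show ?thesis by auto
qed

end

section \<open>The Khovanov complex after Hopf link addition\<close>

context hopf
begin

definition plus_u :: "bool \<Rightarrow> nat set set \<Rightarrow> nat set set" where
  "plus_u z P = (if z then insert {u} P else P)"

text \<open>The markers of the two new crossings being \<open>m0\<close> and \<open>m1\<close>, the sign of the small circle
  is \<open>z\<close>; for different markers there is no small circle, and \<open>z\<close> is required to be \<open>False\<close>.\<close>

definition emb :: "bool \<Rightarrow> bool \<Rightarrow> bool \<Rightarrow> estate \<Rightarrow> estate" where
  "emb m0 m1 z S = (m0 # m1 # fst S, vimage (retr m0 m1) ` plus_u z (snd S))"

lemma in_plus_u: "{u} \<notin> P \<Longrightarrow> {u} \<in> plus_u z P \<longleftrightarrow> z"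
  by (simp add: plus_u_def)

lemma plus_u_eq_iff:
  assumes "{u} \<notin> P" "{u} \<notin> Q"
  shows "plus_u z P = plus_u y Q \<longleftrightarrow> z = y \<and> P = Q"
  using assms insert_ident[OF assms] unfolding plus_u_def by (cases z; cases y) auto

lemma plus_u_subset:
  assumes "P \<subseteq> circles D s" "z \<longrightarrow> m0 = m1" shows "plus_u z P \<subseteq> circles_u m0 m1 s"
  using assms by (auto simp: plus_u_def circles_u_def)

lemma plus_u_base:
  assumes "P \<subseteq> circles D s" "z \<longrightarrow> m0 = m1" shows "plus_u z P \<subseteq> Pow (base m0 m1)"
  using plus_u_subset[OF assms] circles_u_base by blast

lemma small_notin: "P \<subseteq> circles D s \<Longrightarrow> {u} \<notin> P"
  using u_notin_circle(2) by blast

lemma inj_vimage: "A \<subseteq> Pow (base m0 m1) \<Longrightarrow> inj_on (vimage (retr m0 m1)) A"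
  using inj_vimage_retr by (rule inj_on_subset)

lemma vimage_image_eq_iff:
  "A \<subseteq> Pow (base m0 m1) \<Longrightarrow> B \<subseteq> Pow (base m0 m1) \<Longrightarrow>
    vimage (retr m0 m1) ` A = vimage (retr m0 m1) ` B \<longleftrightarrow> A = B"
  using inj_vimage_retr by (rule inj_on_image_eq_iff)

lemma emb_states:
  assumes "S \<in> enhanced_states D" "z \<longrightarrow> m0 = m1"
  shows "emb m0 m1 z S \<in> enhanced_states D'"
proof -
  obtain s P where S: "S = (s, P)" by (cases S)
  show ?thesis
    using assms plus_u_subset[of P s z m0 m1] by (auto simp: S emb_def circles_hopf ncr')
qed

lemma emb_eq_iff:
  assumes "S \<in> enhanced_states D" "S' \<in> enhanced_states D" "z \<longrightarrow> m0 = m1" "y \<longrightarrow> n0 = n1"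
  shows "emb m0 m1 z S = emb n0 n1 y S' \<longleftrightarrow> m0 = n0 \<and> m1 = n1 \<and> z = y \<and> S = S'"
proof -
  obtain s P s' P' where S: "S = (s, P)" "S' = (s', P')" by (cases S; cases S')
  have P: "P \<subseteq> circles D s" "P' \<subseteq> circles D s'" using assms by (simp_all add: S)
  have "vimage (retr m0 m1) ` plus_u z P = vimage (retr m0 m1) ` plus_u y P' \<longleftrightarrow> z = y \<and> P = P'"
    if "m0 = n0" "m1 = n1"
    using vimage_image_eq_iff plus_u_base[OF P(1) assms(3)] plus_u_base[OF P(2) assms(4)]
      plus_u_eq_iff[OF small_notin[OF P(1)] small_notin[OF P(2)]] that by simp
  then show ?thesis by (auto simp: emb_def S)
qed

lemma emb_cases:
  assumes "T \<in> enhanced_states D'"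
  obtains m0 m1 z S where "z \<longrightarrow> m0 = m1" "S \<in> enhanced_states D" "T = emb m0 m1 z S"
proof -
  obtain t Q where T: "T = (t, Q)" by (cases T)
  have t: "length t = Suc (Suc (ncr D))" and Q: "Q \<subseteq> circles D' t" using assms by (simp_all add: T ncr')
  obtain m0 m1 s where s: "t = m0 # m1 # s" "length s = ncr D" using t by (auto simp: length_Suc_conv)
  obtain R where R: "R \<subseteq> circles_u m0 m1 s" "Q = vimage (retr m0 m1) ` R"
    using Q unfolding s(1) circles_hopf by (auto simp: subset_image_iff)
  have "R - {{u}} \<subseteq> circles D s" "{u} \<in> R \<longrightarrow> m0 = m1"
    using R(1) u_notin_circle(2) by (auto simp: circles_u_def split: if_splits)
  moreover have "plus_u ({u} \<in> R) (R - {{u}}) = R" by (auto simp: plus_u_def)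
  ultimately show ?thesis
    using that[of "{u} \<in> R" m0 m1 "(s, R - {{u}})"] s R by (simp add: T emb_def)
qed

lemma card_circles_hopf: "card (circles D' (m0 # m1 # s)) = card (circles D s) + of_bool (m0 = m1)"
  unfolding circles_hopf card_image[OF inj_vimage[OF circles_u_base]]
  using finite_circles[OF finite_loops] u_notin_circle(2) by (simp add: circles_u_def)

lemma tau_emb:
  assumes "S \<in> enhanced_states D" "z \<longrightarrow> m0 = m1"
  shows "tau D' (emb m0 m1 z S) = tau D S + (if m0 = m1 then if z then 1 else - 1 else 0)"
proof -
  obtain s P where S: "S = (s, P)" by (cases S)
  have P: "P \<subseteq> circles D s" using assms by (simp add: S)
  have fin: "finite P" using P finite_circles[OF finite_loops] by (rule finite_subset)
  have "card (vimage (retr m0 m1) ` plus_u z P) = card P + of_bool z"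
    unfolding card_image[OF inj_vimage[OF plus_u_base[OF P assms(2)]]]
    using fin small_notin[OF P] by (simp add: plus_u_def)
  moreover have "vimage (retr m0 m1) ` plus_u z P \<subseteq> circles D' (m0 # m1 # s)"
    using emb_states[OF assms] by (simp add: emb_def S)
  ultimately show ?thesis
    using tau_eq[OF finite_loops P] tau_eq[OF finite_loops', of "vimage (retr m0 m1) ` plus_u z P"] assms(2)
    by (auto simp: emb_def S card_circles_hopf)
qed

text \<open>A change at a crossing of \<open>D\<close> leaves the small circle alone. Taking
  preimages is injective, so the condition on untouched circles carries over, and both values of
  \<open>tau\<close> are shifted by the same amount.\<close>

lemma transition_old:
  assumes k: "k < ncr D" and S: "S \<in> enhanced_states D" "S' \<in> enhanced_states D"
    and z: "z \<longrightarrow> m0 = m1" and y: "y \<longrightarrow> n0 = n1"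
  shows "transition D' (Suc (Suc k)) (emb m0 m1 z S) (emb n0 n1 y S') \<longleftrightarrow>
    m0 = n0 \<and> m1 = n1 \<and> z = y \<and> transition D k S S'"
proof (cases "fst S ! k \<and> n0 # n1 # fst S' = (m0 # m1 # fst S)[Suc (Suc k) := False]")
  case False
  then show ?thesis
    using transition_update(3,4)[of D' "Suc (Suc k)" "emb m0 m1 z S" "emb n0 n1 y S'"] transition_update(3,4)[of D k S S']
    by (auto simp: emb_def)
next
  case True
  obtain s P s' P' where SP: "S = (s, P)" "S' = (s', P')" by (cases S; cases S')
  from True have m: "n0 = m0" "n1 = m1" "s' = s[k := False]" "s ! k" by (auto simp: SP)
  have P: "P \<subseteq> circles D s" "P' \<subseteq> circles D s'" "length s = ncr D" using S by (simp_all add: SP)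
  have k': "Suc (Suc k) < ncr D'" using k by (simp add: ncr')
  let ?x0 = "crossings D ! k ! 0" and ?x2 = "crossings D ! k ! 2"
  let ?\<rho> = "vimage (retr m0 m1)"
  have arc: "?x0 \<in> arcs D" "?x2 \<in> arcs D" by (rule arcs_crossing[OF k])+
  have diff: "?\<rho> ` plus_u b Q - {circ D' (m0 # m1 # q) (crossings D' ! Suc (Suc k) ! 0), circ D' (m0 # m1 # q) (crossings D' ! Suc (Suc k) ! 2)}
      = ?\<rho> ` plus_u b (Q - {circ D q ?x0, circ D q ?x2})"
    if Q: "Q \<subseteq> circles D q" and b: "b \<longrightarrow> m0 = m1" for Q q b
  proof -
    have c: "circ D q ?x0 \<in> circles D q" "circ D q ?x2 \<in> circles D q" using arc by (simp_all add: circles_eq)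
    then have "plus_u b (Q - {circ D q ?x0, circ D q ?x2}) = plus_u b Q - {circ D q ?x0, circ D q ?x2}"
      using u_notin_circle(2)[of q] by (auto simp: plus_u_def)
    moreover have "?\<rho> ` (plus_u b Q - {circ D q ?x0, circ D q ?x2}) = ?\<rho> ` plus_u b Q - ?\<rho> ` {circ D q ?x0, circ D q ?x2}"
    proof (rule inj_on_image_set_diff[OF inj_vimage_retr])
      show "plus_u b Q - {circ D q ?x0, circ D q ?x2} \<subseteq> Pow (base m0 m1)" using plus_u_base[OF Q b] by blast
      show "{circ D q ?x0, circ D q ?x2} \<subseteq> Pow (base m0 m1)"
        using c circles_u_base[of m0 m1 q] by (auto simp: circles_u_def split: if_splits)
    qed
    moreover have "circ D' (m0 # m1 # q) (crossings D' ! Suc (Suc k) ! p) = ?\<rho> (circ D q (crossings D ! k ! p))" if "p < 4" for p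
      using cs_nth(1)[OF k that] by (simp add: circ_hopf crossings')
    ultimately show ?thesis by simp
  qed
  have y': "y \<longrightarrow> m0 = m1" using y m by simp
  have sets: "?\<rho> ` plus_u z (P - {circ D s ?x0, circ D s ?x2}) = ?\<rho> ` plus_u y (P' - {circ D s' ?x0, circ D s' ?x2})
     \<longleftrightarrow> z = y \<and> P - {circ D s ?x0, circ D s ?x2} = P' - {circ D s' ?x0, circ D s' ?x2}"
  proof -
    have sub: "P - {circ D s ?x0, circ D s ?x2} \<subseteq> circles D s" "P' - {circ D s' ?x0, circ D s' ?x2} \<subseteq> circles D s'"
      using P by auto
    show ?thesis
      unfolding vimage_image_eq_iff[OF plus_u_base[OF sub(1) z] plus_u_base[OF sub(2) y']]
      by (rule plus_u_eq_iff[OF small_notin[OF sub(1)] small_notin[OF sub(2)]])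
  qed
  have emb: "emb m0 m1 z S = (m0 # m1 # s, ?\<rho> ` plus_u z P)" "emb n0 n1 y S' = (m0 # m1 # s', ?\<rho> ` plus_u y P')"
    by (simp_all add: emb_def SP m)
  have sub': "?\<rho> ` plus_u z P \<subseteq> circles D' (m0 # m1 # s)" "?\<rho> ` plus_u y P' \<subseteq> circles D' (m0 # m1 # s')"
    using emb_states[OF S(1) z] emb_states[OF S(2) y] unfolding emb by simp_all
  have tau: "tau D' (m0 # m1 # s', ?\<rho> ` plus_u y P') = tau D' (m0 # m1 # s, ?\<rho> ` plus_u z P) + 1
      \<longleftrightarrow> tau D S' = tau D S + 1" if "z = y"
    using tau_emb[OF S(1) z] tau_emb[OF S(2) y] that unfolding emb by (simp add: m)
  have len: "length (m0 # m1 # s) = ncr D'" "(m0 # m1 # s) ! Suc (Suc k)" "m0 # m1 # s' = (m0 # m1 # s)[Suc (Suc k) := False]"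
    using P(3) m by (simp_all add: ncr')
  show ?thesis
    unfolding emb transition_iff[OF k' length4'[OF k']] diff[OF P(1) z] diff[OF P(2) y'] sets
    unfolding SP transition_iff[OF k length4[OF oriented k]]
    using len sub' tau P m SP by argo
qed

end

text \<open>At a new crossing the only circle of \<open>D\<close> that is touched is the one through
  the cut arc. The number of positive circles then decides between the identity and multiplication
  by x at this circle.\<close>

lemma card_raise:
  assumes "finite P" "finite P'"
  shows "P - {K} = P' - {K} \<and> card P' = card P + of_bool b \<longleftrightarrow> (if b then K \<notin> P \<and> P' = insert K P else P' = P)"
proof (cases "P - {K} = P' - {K}")
  case True
  then have c: "card P' = card P + of_bool b \<longleftrightarrow> (of_bool (K \<in> P') :: nat) = of_bool (K \<in> P) + of_bool b"
    using card_remove_one[OF assms(1), of K, unfolded True] card_remove_one[OF assms(2), of K]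
    by (simp only: add.assoc add_left_cancel)
  have "P' = P \<longleftrightarrow> (K \<in> P' \<longleftrightarrow> K \<in> P)" "K \<notin> P \<and> P' = insert K P \<longleftrightarrow> K \<notin> P \<and> K \<in> P'"
    using True by blast+
  moreover have "(of_bool (K \<in> P') :: nat) = of_bool (K \<in> P) + of_bool b \<longleftrightarrow>
      (if b then K \<notin> P \<and> K \<in> P' else K \<in> P' \<longleftrightarrow> K \<in> P)"
    by (simp split: if_splits)
  ultimately show ?thesis using c True by (smt (verit))
next
  case False
  moreover have "P' = insert K P \<longrightarrow> P - {K} = P' - {K}" "P' = P \<longrightarrow> P - {K} = P' - {K}" by blast+
  ultimately show ?thesis by (smt (verit))
qed

lemma insert_iff_remove: "K \<notin> P \<and> P' = insert K P \<longleftrightarrow> K \<in> P' \<and> P = P' - {K}"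
  by auto

context hopf
begin

text \<open>The touched circles are the one through \<open>e\<close> and, for equal markers, the
  small one. What remains does not depend on the markers, since untouched circles are their own
  preimages.\<close>

lemma touched_diff:
  assumes x: "x \<in> {h0, h1}" and P: "P \<subseteq> circles D s" and z: "z \<longrightarrow> m0 = m1"
  shows "vimage (retr m0 m1) ` plus_u z P - {circ D' (m0 # m1 # s) (x ! 0), circ D' (m0 # m1 # s) (x ! 2)}
    = P - {circ D s e}"
proof -
  let ?\<rho> = "vimage (retr m0 m1)" and ?R = "if m0 = m1 then {circ D s e, {u}} else {circ D s e}"
  \<comment> \<open>The ends 0 and 2 are \<open>l\<close> and \<open>r\<close> where the arc passes
    over the circle, and \<open>u\<close> and \<open>w\<close> where it passes under.\<close>
  have "{retr m0 m1 (x ! 0), retr m0 m1 (x ! 2)} = (if m0 = m1 then {e, u} else {e})"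
    using x hs by (cases m0; cases m1) auto
  from arg_cong[OF this, of "image (circ D s)", unfolded image_insert image_empty]
  have "{circ D s (retr m0 m1 (x ! 0)), circ D s (retr m0 m1 (x ! 2))} = circ D s ` (if m0 = m1 then {e, u} else {e})" .
  also have "\<dots> = ?R" by (simp add: circ_u)
  finally have "{circ D s (retr m0 m1 (x ! 0)), circ D s (retr m0 m1 (x ! 2))} = ?R" .
  from arg_cong[OF this, of "image ?\<rho>", unfolded image_insert image_empty]
  have R: "{circ D' (m0 # m1 # s) (x ! 0), circ D' (m0 # m1 # s) (x ! 2)} = ?\<rho> ` ?R"
    unfolding circ_hopf .
  have u: "{u} \<notin> P" by (rule small_notin[OF P])
  have "?\<rho> ` plus_u z P - ?\<rho> ` ?R = ?\<rho> ` (plus_u z P - ?R)"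
  proof (rule inj_on_image_set_diff[OF inj_vimage_retr, symmetric])
    show "plus_u z P - ?R \<subseteq> Pow (base m0 m1)" using plus_u_base[OF P z] by blast
    show "?R \<subseteq> Pow (base m0 m1)"
      using circ_subset[OF e_arc, of s] by (auto simp: base_def)
  qed
  also have "plus_u z P - ?R = P - {circ D s e}"
    using z u by (auto simp: plus_u_def)
  also have "?\<rho> ` (P - {circ D s e}) = P - {circ D s e}"
  proof -
    have "?\<rho> K = K" if "K \<in> P - {circ D s e}" for K
    proof (rule vimage_untouched)
      have K: "K \<in> circles D s" using that P by blast
      then show "K \<subseteq> arcs D" by (rule circles_subset)
      show "e \<notin> K" using circ_memb[OF K] that by blast
    qed
    then have "?\<rho> ` (P - {circ D s e}) = (\<lambda>K. K) ` (P - {circ D s e})" by (intro image_cong refl)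
    then show ?thesis by (simp only: image_ident)
  qed
  finally show ?thesis unfolding R .
qed

text \<open>Leaving two positive markers, the small circle merges into the one through
  \<open>e\<close>, and a positive sign on it multiplies by x. Arriving at two negative markers, it
  is split off again: with a positive sign it leaves the other circle as it was, with a negative
  sign it comes with multiplication by x there.\<close>

lemma transition_new:
  assumes v: "v = 0 \<and> m0 \<and> \<not> n0 \<and> n1 = m1 \<or> v = 1 \<and> m1 \<and> \<not> n1 \<and> n0 = m0"
    and S: "(s, P) \<in> enhanced_states D" "(s, P') \<in> enhanced_states D"
    and z: "z \<longrightarrow> m0 = m1" and y: "y \<longrightarrow> n0 = n1"
  shows "transition D' v (emb m0 m1 z (s, P)) (emb n0 n1 y (s, P')) \<longleftrightarrow>
    (if (if m0 = m1 then z else \<not> y) then circ D s e \<notin> P \<and> P' = insert (circ D s e) P else P' = P)"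
proof -
  have v': "v < ncr D'" using v by (auto simp: ncr')
  have x: "crossings D' ! v \<in> {h0, h1}" using v by (auto simp: crossings')
  have P: "P \<subseteq> circles D s" "P' \<subseteq> circles D s" "length s = ncr D" using S by simp_all
  have fin: "finite P" "finite P'" using P finite_circles[OF finite_loops] finite_subset by metis+
  let ?Q = "vimage (retr m0 m1) ` plus_u z P" and ?Q' = "vimage (retr n0 n1) ` plus_u y P'"
  have emb: "emb m0 m1 z (s, P) = (m0 # m1 # s, ?Q)" "emb n0 n1 y (s, P') = (n0 # n1 # s, ?Q')"
    by (simp_all add: emb_def)
  have sub: "?Q \<subseteq> circles D' (m0 # m1 # s)" "?Q' \<subseteq> circles D' (n0 # n1 # s)"
    using emb_states[OF S(1) z] emb_states[OF S(2) y] unfolding emb by simp_all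
  have len: "length (m0 # m1 # s) = ncr D'" "(m0 # m1 # s) ! v" "n0 # n1 # s = (m0 # m1 # s)[v := False]"
    using P(3) v by (auto simp: ncr')
  have tau: "tau D' (n0 # n1 # s, ?Q') = tau D' (m0 # m1 # s, ?Q) + 1 \<longleftrightarrow>
      card P' = card P + of_bool (if m0 = m1 then z else \<not> y)"
    using tau_emb[OF S(1) z] tau_emb[OF S(2) y] v z y
    unfolding emb tau_eq[OF finite_loops P(1)] tau_eq[OF finite_loops P(2)]
    by (cases z; cases y) (auto split: if_splits)
  show ?thesis
    unfolding emb transition_iff[OF v' length4'[OF v']] touched_diff[OF x P(1) z] touched_diff[OF x P(2) y]
      tau card_raise[OF fin, symmetric]
    using len sub by argo
qed

lemma new_transitions:
  assumes v: "v = 0 \<and> m0 \<and> \<not> n0 \<and> n1 = m1 \<or> v = 1 \<and> m1 \<and> \<not> n1 \<and> n0 = m0"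
    and S': "(s, P') \<in> enhanced_states D" and y: "y \<longrightarrow> n0 = n1"
  shows "transition D' v T (emb n0 n1 y (s, P')) \<longleftrightarrow>
    (\<exists>z P. (z \<longrightarrow> m0 = m1) \<and> T = emb m0 m1 z (s, P) \<and>
      (if (if m0 = m1 then z else \<not> y) then circ D s e \<in> P' \<and> P = P' - {circ D s e} else P' = P))"
    (is "_ \<longleftrightarrow> ?R")
proof
  assume tr: "transition D' v T (emb n0 n1 y (s, P'))"
  then have "T \<in> enhanced_states D'" using transition_states by blast
  then obtain k0 k1 z t P where T: "z \<longrightarrow> k0 = k1" "(t, P) \<in> enhanced_states D" "T = emb k0 k1 z (t, P)"
    by (metis emb_cases surj_pair)
  have eq: "k0 = m0" "k1 = m1" "t = s"
    using transition_update(3,4)[OF tr] v by (auto simp: T(3) emb_def)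
  have "if (if m0 = m1 then z else \<not> y) then circ D s e \<notin> P \<and> P' = insert (circ D s e) P else P' = P"
    using tr transition_new[OF v T(2)[unfolded eq] S' T(1)[unfolded eq] y] unfolding T(3) eq by blast
  then show ?R using T(1,3) unfolding eq insert_iff_remove by (intro exI conjI)
next
  assume ?R
  then obtain z P where z: "z \<longrightarrow> m0 = m1" and T: "T = emb m0 m1 z (s, P)"
    and P: "if (if m0 = m1 then z else \<not> y) then circ D s e \<in> P' \<and> P = P' - {circ D s e} else P' = P" by blast
  have "P \<subseteq> P'" using P by (auto split: if_splits)
  then have sP: "(s, P) \<in> enhanced_states D" using S' by auto
  show "transition D' v T (emb n0 n1 y (s, P'))"
    unfolding T transition_new[OF v sP S' z y] insert_iff_remove by (rule P)
qed

text \<open>The two kinds of sources differ in the sign of the small circle: 1 is merged as the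
  identity and x as multiplication by x. This is q + X p.\<close>

lemma del_new_mixed:
  assumes v: "v = 0 \<and> \<not> n0 \<and> n1 \<or> v = 1 \<and> \<not> n1 \<and> n0" and S': "(s, P') \<in> enhanced_states D"
  shows "del D' v c (emb n0 n1 False (s, P')) = c (emb True True False (s, P')) +
    (if circ D s e \<in> P' then c (emb True True True (s, P' - {circ D s e})) else 0)"
proof -
  let ?A = "emb True True False (s, P')" and ?B = "emb True True True (s, P' - {circ D s e})"
  have v': "v = 0 \<and> True \<and> \<not> n0 \<and> n1 = True \<or> v = 1 \<and> True \<and> \<not> n1 \<and> n0 = True" using v by blast
  have "{T. transition D' v T (emb n0 n1 False (s, P'))} = {T. T = ?A \<or> circ D s e \<in> P' \<and> T = ?B}"
    unfolding new_transitions[OF v' S', of False, simplified] by (auto split: if_splits intro: exI[of _ True] exI[of _ False])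
  also have "\<dots> = (if circ D s e \<in> P' then {?A, ?B} else {?A})" by auto
  finally have eq: "{T. transition D' v T (emb n0 n1 False (s, P'))} = (if circ D s e \<in> P' then {?A, ?B} else {?A})" .
  have "(s, P' - {circ D s e}) \<in> enhanced_states D" using S' by auto
  then have "?A \<noteq> ?B" using S' by (simp add: emb_eq_iff del: enhanced_states_iff)
  then show ?thesis unfolding del_def eq by simp
qed

lemma del_new_negative:
  assumes v: "v = 0 \<and> m0 \<and> \<not> m1 \<or> v = 1 \<and> m1 \<and> \<not> m0" and S': "(s, P') \<in> enhanced_states D"
  shows "del D' v c (emb False False True (s, P')) = c (emb m0 m1 False (s, P'))"
    and "del D' v c (emb False False False (s, P')) =
      (if circ D s e \<in> P' then c (emb m0 m1 False (s, P' - {circ D s e})) else 0)"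
proof -
  have v': "v = 0 \<and> m0 \<and> \<not> False \<and> False = m1 \<or> v = 1 \<and> m1 \<and> \<not> False \<and> False = m0" using v by blast
  have ne: "m0 \<noteq> m1" using v by blast
  have 1: "{T. transition D' v T (emb False False True (s, P'))} = {emb m0 m1 False (s, P')}"
    unfolding new_transitions[OF v' S', of True, simplified] using ne by auto
  have 2: "{T. transition D' v T (emb False False False (s, P'))} =
      (if circ D s e \<in> P' then {emb m0 m1 False (s, P' - {circ D s e})} else {})"
    unfolding new_transitions[OF v' S', of False, simplified] using ne by auto
  show "del D' v c (emb False False True (s, P')) = c (emb m0 m1 False (s, P'))"
    unfolding del_def 1 by simp
  show "del D' v c (emb False False False (s, P')) =
      (if circ D s e \<in> P' then c (emb m0 m1 False (s, P' - {circ D s e})) else 0)"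
    unfolding del_def 2 by simp
qed

section \<open>The differential in block form\<close>

definition block :: "bool \<Rightarrow> bool \<Rightarrow> bool \<Rightarrow> (estate \<Rightarrow> 'r::ring) \<Rightarrow> estate \<Rightarrow> 'r" where
  "block m0 m1 z y S = (if S \<in> enhanced_states D then y (emb m0 m1 z S) else 0)"

lemma card_shift: "card {k. Suc (Suc j) \<le> k \<and> k < Suc (Suc n) \<and> Q (k - 2)} = card {k. j \<le> k \<and> k < n \<and> Q k}"
proof -
  have "{k. Suc (Suc j) \<le> k \<and> k < Suc (Suc n) \<and> Q (k - 2)} = (\<lambda>k. Suc (Suc k)) ` {k. j \<le> k \<and> k < n \<and> Q k}"
  proof (intro equalityI subsetI)
    fix k assume "k \<in> {k. Suc (Suc j) \<le> k \<and> k < Suc (Suc n) \<and> Q (k - 2)}"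
    then show "k \<in> (\<lambda>k. Suc (Suc k)) ` {k. j \<le> k \<and> k < n \<and> Q k}"
      by (intro image_eqI[of _ _ "k - 2"]) auto
  qed auto
  then show ?thesis by (simp add: card_image inj_on_def)
qed

text \<open>As the new crossings come first, the signs at the old ones are unaffected, while each
  new one counts all negative markers of \<open>D\<close>. The first one also counts the marker of
  the second, which is the source of the minus sign in b - a.\<close>

lemma negative_after_emb:
  "negative_after D' (Suc (Suc k)) (emb m0 m1 z S) = negative_after D k S"
  "negative_after D' (Suc 0) (emb m0 m1 z S) = card {k. k < ncr D \<and> \<not> fst S ! k}"
  "negative_after D' 0 (emb m0 m1 z S) = card {k. k < ncr D \<and> \<not> fst S ! k} + of_bool (\<not> m1)"
proof -
  have nth: "(m0 # m1 # fst S) ! k = fst S ! (k - 2)" if "k \<ge> 2" for k using that by (auto simp: nth_Cons' numeral_2_eq_2)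
  have tail: "card {k. Suc (Suc j) \<le> k \<and> k < ncr D' \<and> \<not> (m0 # m1 # fst S) ! k} = card {k. j \<le> k \<and> k < ncr D \<and> \<not> fst S ! k}" for j
  proof -
    have "{k. Suc (Suc j) \<le> k \<and> k < ncr D' \<and> \<not> (m0 # m1 # fst S) ! k} =
        {k. Suc (Suc j) \<le> k \<and> k < Suc (Suc (ncr D)) \<and> \<not> fst S ! (k - 2)}"
      by (intro Collect_cong conj_cong) (auto simp: ncr' nth numeral_2_eq_2)
    then show ?thesis by (simp add: card_shift[of j "ncr D" "\<lambda>k. \<not> fst S ! k"])
  qed
  show "negative_after D' (Suc (Suc k)) (emb m0 m1 z S) = negative_after D k S"
    using tail[of "Suc k"] by (simp add: negative_after_def emb_def case_prod_beta Suc_le_eq)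
  have 1: "card {k. Suc 0 < k \<and> k < ncr D' \<and> \<not> (m0 # m1 # fst S) ! k} = card {k. k < ncr D \<and> \<not> fst S ! k}"
    using tail[of 0] by (simp add: Suc_le_eq)
  then show "negative_after D' (Suc 0) (emb m0 m1 z S) = card {k. k < ncr D \<and> \<not> fst S ! k}"
    by (simp add: negative_after_def emb_def)
  have "{k. 0 < k \<and> k < ncr D' \<and> \<not> (m0 # m1 # fst S) ! k} =
      (if m1 then {} else {Suc 0}) \<union> {k. Suc 0 < k \<and> k < ncr D' \<and> \<not> (m0 # m1 # fst S) ! k}"
    (is "?A = ?B")
  proof (rule Set.set_eqI)
    fix k show "k \<in> ?A \<longleftrightarrow> k \<in> ?B"
    proof (cases "k = Suc 0")
      case True
      then show ?thesis by (simp add: ncr')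
    next
      case False
      then have "0 < k \<longleftrightarrow> Suc 0 < k" by arith
      then show ?thesis using False by simp
    qed
  qed
  then have "card {k. 0 < k \<and> k < ncr D' \<and> \<not> (m0 # m1 # fst S) ! k} =
      of_bool (\<not> m1) + card {k. Suc 0 < k \<and> k < ncr D' \<and> \<not> (m0 # m1 # fst S) ! k}"
    by (simp add: card_insert_if)
  then show "negative_after D' 0 (emb m0 m1 z S) = card {k. k < ncr D \<and> \<not> fst S ! k} + of_bool (\<not> m1)"
    unfolding 1 by (simp add: negative_after_def emb_def)
qed

lemma del_old:
  assumes k: "k < ncr D" and S': "S' \<in> enhanced_states D" and z: "z \<longrightarrow> m0 = m1"
  shows "del D' (Suc (Suc k)) (sign_after D' (Suc (Suc k)) y) (emb m0 m1 z S') =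
    del D k (sign_after D k (block m0 m1 z y)) S'"
proof -
  have "{T. transition D' (Suc (Suc k)) T (emb m0 m1 z S')} = emb m0 m1 z ` {S. transition D k S S'}"
  proof (intro equalityI subsetI)
    fix T assume "T \<in> {T. transition D' (Suc (Suc k)) T (emb m0 m1 z S')}"
    then have tr: "transition D' (Suc (Suc k)) T (emb m0 m1 z S')" by simp
    then have "T \<in> enhanced_states D'" using transition_states by blast
    then obtain n0 n1 x S where T: "x \<longrightarrow> n0 = n1" "S \<in> enhanced_states D" "T = emb n0 n1 x S"
      by (rule emb_cases)
    then show "T \<in> emb m0 m1 z ` {S. transition D k S S'}"
      using tr transition_old[OF k T(2) S' T(1) z] by auto
  next
    fix T assume "T \<in> emb m0 m1 z ` {S. transition D k S S'}"
    then obtain S where S: "transition D k S S'" "T = emb m0 m1 z S" by blast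
    then have "S \<in> enhanced_states D" using transition_states by blast
    then show "T \<in> {T. transition D' (Suc (Suc k)) T (emb m0 m1 z S')}"
      using S transition_old[OF k _ S' z z] by simp
  qed
  moreover have "inj_on (emb m0 m1 z) {S. transition D k S S'}"
  proof (rule inj_onI)
    fix S T assume "S \<in> {S. transition D k S S'}" "T \<in> {S. transition D k S S'}"
    then have "S \<in> enhanced_states D" "T \<in> enhanced_states D" using transition_states by blast+
    moreover assume "emb m0 m1 z S = emb m0 m1 z T"
    ultimately show "S = T" using emb_eq_iff[OF _ _ z z, of S T] by blast
  qed
  ultimately have "del D' (Suc (Suc k)) (sign_after D' (Suc (Suc k)) y) (emb m0 m1 z S') =
      (\<Sum>S | transition D k S S'. sign_after D' (Suc (Suc k)) y (emb m0 m1 z S))"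
    by (simp add: del_def sum.reindex)
  also have "\<dots> = del D k (sign_after D k (block m0 m1 z y)) S'"
    unfolding del_def
  proof (intro sum.cong refl)
    fix S assume "S \<in> {S. transition D k S S'}"
    then have "S \<in> enhanced_states D" using transition_states by blast
    then show "sign_after D' (Suc (Suc k)) y (emb m0 m1 z S) = sign_after D k (block m0 m1 z y) S"
      unfolding sign_after_def negative_after_emb block_def by simp
  qed
  finally show ?thesis .
qed

lemma differential_emb:
  assumes S': "S' \<in> enhanced_states D" and z: "z \<longrightarrow> m0 = m1"
  shows "differential D' y (emb m0 m1 z S') = differential D (block m0 m1 z y) S' +
    del D' 0 (sign_after D' 0 y) (emb m0 m1 z S') + del D' 1 (sign_after D' 1 y) (emb m0 m1 z S')"
proof -
  have "differential D' y (emb m0 m1 z S') = del D' 0 (sign_after D' 0 y) (emb m0 m1 z S') +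
      (del D' 1 (sign_after D' 1 y) (emb m0 m1 z S') +
      (\<Sum>k<ncr D. del D' (Suc (Suc k)) (sign_after D' (Suc (Suc k)) y) (emb m0 m1 z S')))"
    by (simp add: differential_def sum_fun_apply ncr' sum.lessThan_Suc_shift del: sum.lessThan_Suc)
  also have "(\<Sum>k<ncr D. del D' (Suc (Suc k)) (sign_after D' (Suc (Suc k)) y) (emb m0 m1 z S')) = differential D (block m0 m1 z y) S'"
    by (simp add: differential_def sum_fun_apply del_old[OF _ S' z])
  finally show ?thesis by (simp add: add_ac)
qed

end

lemma differential_outside: "S \<notin> enhanced_states D \<Longrightarrow> differential D c S = 0"
proof -
  assume "S \<notin> enhanced_states D"
  then have "{T. transition D v T S} = {}" for v using transition_states by blast
  then show ?thesis
    by (simp only: differential_def sum_fun_apply del_def sum.empty sum.neutral_const)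
qed

lemma del_target_marker: "fst S ! v \<Longrightarrow> del D v c S = 0"
proof -
  assume S: "fst S ! v"
  have "\<not> transition D v T S" for T
    using transition_update(1,2,4)[of D v T S] S by (metis nth_list_update_eq)
  then have "{T. transition D v T S} = {}" by blast
  then show ?thesis by (simp only: del_def sum.empty)
qed

context hopf
begin

lemma mult_arc_outside:
  assumes "S \<notin> enhanced_states D" "\<And>S. S \<notin> enhanced_states D \<Longrightarrow> c S = 0"
  shows "mult_arc D e c S = 0"
proof -
  obtain s P where S: "S = (s, P)" by (cases S)
  have "circ D s e \<in> circles D s" using e_arc by (simp add: circles_eq)
  then have "(s, P - {circ D s e}) \<notin> enhanced_states D" if "circ D s e \<in> P"
    using assms(1) that by (auto simp: S)
  then show ?thesis using assms(2) by (simp add: mult_arc_def S)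
qed

lemma block_outside: "S \<notin> enhanced_states D \<Longrightarrow> block m0 m1 z y S = 0"
  by (simp add: block_def)

lemma fst_emb: "fst (emb m0 m1 z S) = m0 # m1 # fst S"
  by (simp add: emb_def)

text \<open>No change of a marker leads to two positive new markers, so only the changes in
  \<open>D\<close> contribute.\<close>

lemma block_positive:
  fixes y :: "estate \<Rightarrow> 'r::ring"
  shows "block True True z (differential D' y) = differential D (block True True z y)"
proof
  fix S
  show "block True True z (differential D' y) S = differential D (block True True z y) S"
  proof (cases "S \<in> enhanced_states D")
    case True
    then show ?thesis
      by (simp add: block_def[of _ _ _ "differential D' y"] differential_emb del_target_marker fst_emb)
  qed (simp add: block_outside differential_outside)
qed

lemma block_mixed:
  fixes y :: "estate \<Rightarrow> 'r::ring"
  assumes "m0 \<noteq> m1"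
  shows "block m0 m1 False (differential D' y) = differential D (block m0 m1 False y) +
    sign_all D (block True True False y + mult_arc D e (block True True True y))"
proof
  fix S
  let ?c = "block True True False y + mult_arc D e (block True True True y)"
  show "block m0 m1 False (differential D' y) S = (differential D (block m0 m1 False y) + sign_all D ?c) S"
  proof (cases "S \<in> enhanced_states D")
    case False
    then show ?thesis
      using mult_arc_outside[OF False block_outside]
      by (simp add: block_outside differential_outside sign_all_def)
  next
    case True
    obtain s P where S: "S = (s, P)" by (cases S)
    \<comment> \<open>The new crossing whose marker has just become negative.\<close>
    define v :: nat where "v = (if m0 then 1 else 0)"
    have v: "v = 0 \<and> \<not> m0 \<and> m1 \<or> v = 1 \<and> \<not> m1 \<and> m0" using assms by (auto simp: v_def)
    have sign: "sign_after D' v y (emb True True x T) = (if even (card {k. k < ncr D \<and> \<not> fst T ! k}) then y (emb True True x T) else - y (emb True True x T))" for x T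
      by (simp add: v_def sign_after_def negative_after_emb)
    have sP: "(s, P - {circ D s e}) \<in> enhanced_states D" using True by (auto simp: S)
    have "del D' v (sign_after D' v y) (emb m0 m1 False S) = sign_all D ?c S"
      unfolding S del_new_mixed[OF v True[unfolded S]] sign sign_all_def
      using True[unfolded S] sP by (simp add: block_def mult_arc_def del: enhanced_states_iff)
    moreover have "del D' (1 - v) c (emb m0 m1 False S) = 0" for c :: "estate \<Rightarrow> 'r"
      using assms by (intro del_target_marker) (auto simp: fst_emb v_def)
    ultimately show ?thesis
      using True by (cases m0) (simp_all add: v_def block_def[of _ _ _ "differential D' y"] differential_emb)
  qed
qed

lemma block_negative:
  fixes y :: "estate \<Rightarrow> 'r::ring"
  shows "block False False True (differential D' y) = differential D (block False False True y) +
      sign_all D (block False True False y - block True False False y)" (is ?t)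
    and "block False False False (differential D' y) = differential D (block False False False y) +
      mult_arc D e (sign_all D (block False True False y - block True False False y))" (is ?f)
proof -
  have sign: "sign_after D' 0 y (emb True False False T) =
      - (if even (card {k. k < ncr D \<and> \<not> fst T ! k}) then y (emb True False False T) else - y (emb True False False T))"
    "sign_after D' 1 y (emb False True False T) =
      (if even (card {k. k < ncr D \<and> \<not> fst T ! k}) then y (emb False True False T) else - y (emb False True False T))" for T
    by (simp_all add: sign_after_def negative_after_emb)
  have v: "0 = (0::nat) \<and> True \<and> \<not> False \<or> 0 = (1::nat) \<and> False \<and> \<not> True"
    "1 = (0::nat) \<and> False \<and> \<not> True \<or> 1 = (1::nat) \<and> True \<and> \<not> False" by simp_all
  let ?b = "sign_all D (block False True False y - block True False False y)"
  have b0: "?b S = 0" if "S \<notin> enhanced_states D" for S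
    using that by (simp add: sign_all_def block_outside)
  have t: "block False False True (differential D' y) S = (differential D (block False False True y) + ?b) S"
    and f: "block False False False (differential D' y) S = (differential D (block False False False y) + mult_arc D e ?b) S" for S
  proof -
    have "block False False True (differential D' y) S = (differential D (block False False True y) + ?b) S \<and>
      block False False False (differential D' y) S = (differential D (block False False False y) + mult_arc D e ?b) S"
    proof (cases "S \<in> enhanced_states D")
      case False
      then show ?thesis
        using mult_arc_outside[OF False b0] b0[OF False] by (simp add: block_outside differential_outside)
    next
      case True
      obtain s P where S: "S = (s, P)" by (cases S)
      note True' = True[unfolded S]
      have sP: "(s, P - {circ D s e}) \<in> enhanced_states D" using True by (auto simp: S)
      show ?thesis
        unfolding S using True' sP
        by (simp add: block_def[of _ _ _ "differential D' y"] differential_emb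
            del_new_negative[OF v(1) True'] del_new_negative[OF v(2) True', unfolded One_nat_def] sign sign[unfolded One_nat_def]
            sign_all_def block_def[of True] block_def[of False True] mult_arc_def del: enhanced_states_iff)
    qed
    then show "block False False True (differential D' y) S = (differential D (block False False True y) + ?b) S"
      "block False False False (differential D' y) S = (differential D (block False False False y) + mult_arc D e ?b) S"
      by blast+
  qed
  show ?t using t by (rule ext)
  show ?f using f by (rule ext)
qed

subsection \<open>Gradings\<close>

definition sigma_shift :: "bool \<Rightarrow> bool \<Rightarrow> int" where
  "sigma_shift m0 m1 = (if m0 then 1 else - 1) + (if m1 then 1 else - 1)"

definition degree_shift :: "bool \<Rightarrow> bool \<Rightarrow> bool \<Rightarrow> int" where
  "degree_shift m0 m1 z = sigma_shift m0 m1 + 2 * (if m0 = m1 then if z then 1 else - 1 else 0)"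

lemma emb_generators:
  assumes "S \<in> enhanced_states D" "z \<longrightarrow> m0 = m1"
  shows "emb m0 m1 z S \<in> generators D' i j \<longleftrightarrow> S \<in> generators D (i - sigma_shift m0 m1) (j - degree_shift m0 m1 z)"
proof -
  have "sigma (emb m0 m1 z S) = sigma S + sigma_shift m0 m1"
    by (cases S) (simp add: emb_def sigma_def sigma_shift_def)
  then show ?thesis
    using emb_states[OF assms] tau_emb[OF assms] assms(1)
    unfolding generators_def degree_shift_def by (auto split: if_splits)
qed

text \<open>Converse to \<open>block\<close>: the chain on \<open>D'\<close> with \<open>c\<close>
  as its only component.\<close>

definition lift :: "bool \<Rightarrow> bool \<Rightarrow> bool \<Rightarrow> (estate \<Rightarrow> 'r::ring) \<Rightarrow> estate \<Rightarrow> 'r" where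
  "lift m0 m1 z c T = (\<Sum>S | S \<in> enhanced_states D \<and> emb m0 m1 z S = T. c S)"

lemma lift_emb:
  assumes "S \<in> enhanced_states D" "z \<longrightarrow> m0 = m1" "x \<longrightarrow> n0 = n1"
  shows "lift m0 m1 z c (emb n0 n1 x S) = (if m0 = n0 \<and> m1 = n1 \<and> z = x then c S else 0)"
proof -
  have "{T. T \<in> enhanced_states D \<and> emb m0 m1 z T = emb n0 n1 x S} = (if m0 = n0 \<and> m1 = n1 \<and> z = x then {S} else {})"
    using emb_eq_iff[OF _ assms(1,2,3)] assms(1) by (auto simp del: enhanced_states_iff split: if_splits)
  then show ?thesis unfolding lift_def by simp
qed

lemma block_lift:
  assumes "z \<longrightarrow> m0 = m1" "x \<longrightarrow> n0 = n1" "\<And>S. S \<notin> enhanced_states D \<Longrightarrow> c S = 0"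
  shows "block n0 n1 x (lift m0 m1 z c) = (if m0 = n0 \<and> m1 = n1 \<and> z = x then c else 0)"
proof
  fix S
  show "block n0 n1 x (lift m0 m1 z c) S = (if m0 = n0 \<and> m1 = n1 \<and> z = x then c else 0) S"
    using assms(3)[of S] lift_emb[OF _ assms(1,2), of S c] by (cases "S \<in> enhanced_states D") (simp_all add: block_def del: enhanced_states_iff)
qed

lemma chains_outside: "c \<in> carrier (chains X i j) \<Longrightarrow> S \<notin> enhanced_states X \<Longrightarrow> c S = 0"
  unfolding in_chains generators_def by blast

lemma lift_chains:
  assumes c: "c \<in> carrier (chains D (i - sigma_shift m0 m1) (j - degree_shift m0 m1 z))" and z: "z \<longrightarrow> m0 = m1"
  shows "lift m0 m1 z c \<in> carrier (chains D' i j)"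
  unfolding in_chains
proof (intro allI impI)
  fix T assume T: "T \<notin> generators D' i j"
  show "lift m0 m1 z c T = 0"
    unfolding lift_def
  proof (rule sum.neutral, rule ballI)
    fix S assume "S \<in> {S. S \<in> enhanced_states D \<and> emb m0 m1 z S = T}"
    then have "S \<notin> generators D (i - sigma_shift m0 m1) (j - degree_shift m0 m1 z)"
      using T emb_generators[OF _ z] by blast
    then show "c S = 0" using c unfolding in_chains by blast
  qed
qed

lemma block_chains:
  assumes y: "y \<in> carrier (chains D' i j)" and z: "z \<longrightarrow> m0 = m1"
  shows "block m0 m1 z y \<in> carrier (chains D (i - sigma_shift m0 m1) (j - degree_shift m0 m1 z))"
  unfolding in_chains
proof (intro allI impI)
  fix S assume S: "S \<notin> generators D (i - sigma_shift m0 m1) (j - degree_shift m0 m1 z)"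
  then have "S \<in> enhanced_states D \<Longrightarrow> y (emb m0 m1 z S) = 0"
    using y emb_generators[OF _ z] unfolding in_chains by blast
  then show "block m0 m1 z y S = 0" by (simp add: block_def)
qed

lemma chains_eqI:
  assumes y: "y \<in> carrier (chains D' i j)" "y' \<in> carrier (chains D' i' j')"
    and "\<And>m0 m1 z. z \<longrightarrow> m0 = m1 \<Longrightarrow> block m0 m1 z y = block m0 m1 z y'"
  shows "y = y'"
proof
  fix T
  show "y T = y' T"
  proof (cases "T \<in> enhanced_states D'")
    case True
    then obtain m0 m1 z S where T: "z \<longrightarrow> m0 = m1" "S \<in> enhanced_states D" "T = emb m0 m1 z S"
      by (rule emb_cases)
    then show ?thesis using fun_cong[OF assms(3)[OF T(1)], of S] by (simp add: block_def)
  next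
    case False
    then show ?thesis using chains_outside[OF y(1)] chains_outside[OF y(2)] by simp
  qed
qed

subsection \<open>The chain maps\<close>

lemma vimage_inter_arcs: "K \<subseteq> arcs D \<Longrightarrow> retr m0 m1 -` K \<inter> arcs D = K"
  using retr_arcs by auto

lemma vimage_u_inter_arcs: "retr m0 m1 -` {u} \<inter> arcs D = {}"
  using retr_arcs fresh(1) by auto

lemma alpha_state_emb:
  assumes "S \<in> enhanced_states D"
  shows "alpha_state D D' S = Some (emb False False False S)"
proof -
  obtain s P where S: "S = (s, P)" by (cases S)
  have P: "P \<subseteq> circles D s" using assms by (simp add: S)
  have "K \<noteq> {}" if "K \<in> circles D s" for K
  proof -
    obtain a where "K = circ D s a" using \<open>K \<in> circles D s\<close> by (auto simp: circles_eq)
    then have "a \<in> K" by (simp add: in_circ)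
    then show ?thesis by blast
  qed
  \<comment> \<open>The small circle meets the arcs of \<open>D\<close> in the empty set. As no
    circle of \<open>D\<close> is empty, the small circle is never selected and thus receives the
    negative sign.\<close>
  then have "{} \<notin> P" using P by blast
  have "{c \<in> circles D' (False # False # s). c \<inter> arcs D \<in> P} = vimage (retr False False) ` P"
  proof (intro equalityI subsetI)
    fix C assume "C \<in> {c \<in> circles D' (False # False # s). c \<inter> arcs D \<in> P}"
    then obtain K where K: "K \<in> insert {u} (circles D s)" "C = retr False False -` K" "C \<inter> arcs D \<in> P"
      by (auto simp: circles_hopf circles_u_def)
    then have "K \<noteq> {u}" using vimage_u_inter_arcs \<open>{} \<notin> P\<close> by metis
    then have "K \<in> P" using K vimage_inter_arcs[OF circles_subset] by (metis insertE)
    then show "C \<in> vimage (retr False False) ` P" using K(2) by blast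
  next
    fix C assume "C \<in> vimage (retr False False) ` P"
    then obtain K where K: "K \<in> P" "C = retr False False -` K" by blast
    then have "K \<in> circles D s" using P by blast
    then show "C \<in> {c \<in> circles D' (False # False # s). c \<inter> arcs D \<in> P}"
      using K vimage_inter_arcs[OF circles_subset] by (simp add: circles_hopf circles_u_def)
  qed
  then show ?thesis by (simp add: S alpha_state_def emb_def plus_u_def)
qed

lemma alpha_eq_lift:
  assumes c: "c \<in> carrier (chains D i j)"
  shows "linear_ext (generators D i j) (alpha_state D D') c = lift False False False c"
proof
  fix T
  have sub: "generators D i j \<subseteq> enhanced_states D" by (auto simp: generators_def)
  have "{S. S \<in> generators D i j \<and> alpha_state D D' S = Some T} \<subseteq> {S. S \<in> enhanced_states D \<and> emb False False False S = T}"
    using sub alpha_state_emb by auto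
  moreover have "c S = 0" if "S \<in> {S. S \<in> enhanced_states D \<and> emb False False False S = T} - {S. S \<in> generators D i j \<and> alpha_state D D' S = Some T}" for S
    using that c alpha_state_emb[of S] unfolding in_chains by blast
  moreover have "finite {S. S \<in> enhanced_states D \<and> emb False False False S = T}"
    using finite_enhanced_states[OF finite_loops] by simp
  ultimately show "linear_ext (generators D i j) (alpha_state D D') c T = lift False False False c T"
    unfolding linear_ext_def lift_def by (intro sum.mono_neutral_left) auto
qed

lemma vimage_u: "retr True True -` {u} = {u, r}"
  using distinct e_neq fresh w unfolding retr_def by (auto split: if_splits)

lemma beta_state_emb:
  assumes "T \<in> enhanced_states D'"
  shows "beta_state D u r T = Some S \<longleftrightarrow> S \<in> enhanced_states D \<and> T = emb True True True S"
proof -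
  obtain m0 m1 z S0 where T: "z \<longrightarrow> m0 = m1" "S0 \<in> enhanced_states D" "T = emb m0 m1 z S0"
    using assms by (rule emb_cases)
  obtain s P where S0: "S0 = (s, P)" by (cases S0)
  have P: "P \<subseteq> circles D s" using T(2) by (simp add: S0)
  have base: "plus_u z P \<subseteq> Pow (base m0 m1)" by (rule plus_u_base[OF P T(1)])
  have beta: "beta_state D u r T = (if m0 \<and> m1 \<and> z then Some S0 else None)"
  proof (cases "m0 \<and> m1")
    case True
    then have m: "m0" "m1" by auto
    have "{u, r} \<in> vimage (retr True True) ` plus_u z P \<longleftrightarrow> {u} \<in> plus_u z P"
      using inj_on_image_mem_iff[OF inj_vimage_retr _ base[unfolded m], of "{u}"] m
      by (simp add: vimage_u base_def)
    then have 1: "{u, r} \<in> vimage (retr True True) ` plus_u z P \<longleftrightarrow> z"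
      using in_plus_u[OF small_notin[OF P]] by simp
    have "(\<lambda>c. c \<inter> arcs D) ` (vimage (retr True True) ` plus_u z P - {{u, r}}) = P" if z
    proof -
      have "vimage (retr True True) ` plus_u z P - {{u, r}} = vimage (retr True True) ` P"
      proof -
        have "vimage (retr True True) ` plus_u z P - vimage (retr True True) ` {{u}} = vimage (retr True True) ` (plus_u z P - {{u}})"
          using base m by (intro inj_on_image_set_diff[OF inj_vimage_retr, symmetric]) (auto simp: base_def)
        moreover have "plus_u z P - {{u}} = P" using small_notin[OF P] that by (auto simp: plus_u_def)
        ultimately show ?thesis by (simp add: vimage_u)
      qed
      moreover have "(\<lambda>c. c \<inter> arcs D) ` vimage (retr True True) ` P = (\<lambda>c. c) ` P"
        unfolding image_image
      proof (intro image_cong refl)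
        fix K assume "K \<in> P"
        then have "K \<in> circles D s" using P by blast
        then show "retr True True -` K \<inter> arcs D = K" by (intro vimage_inter_arcs circles_subset)
      qed
      ultimately show ?thesis by (simp only: image_ident)
    qed
    then show ?thesis using m 1 by (simp add: beta_state_def T(3) emb_def S0 numeral_2_eq_2)
  next
    case False
    then show ?thesis by (auto simp: beta_state_def T(3) emb_def S0 numeral_2_eq_2)
  qed
  have eq: "T = emb True True True S \<longleftrightarrow> (m0 \<and> m1 \<and> z) \<and> S0 = S" if "S \<in> enhanced_states D"
    using emb_eq_iff[OF T(2) that T(1), of True True True] unfolding T(3) by simp
  show ?thesis
  proof (cases "m0 \<and> m1 \<and> z")
    case True
    show ?thesis unfolding beta if_P[OF True] option.inject using eq T(2) True by blast
  next
    case False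
    show ?thesis unfolding beta if_not_P[OF False] using eq False by blast
  qed
qed

lemma beta_eq_block:
  assumes y: "y \<in> carrier (chains D' i j)"
  shows "linear_ext (generators D' i j) (beta_state D u r) y = block True True True y"
proof
  fix S
  have "{T. T \<in> generators D' i j \<and> beta_state D u r T = Some S} =
      (if S \<in> enhanced_states D \<and> emb True True True S \<in> generators D' i j then {emb True True True S} else {})"
  proof -
    have "T \<in> generators D' i j \<and> beta_state D u r T = Some S \<longleftrightarrow>
        T \<in> generators D' i j \<and> S \<in> enhanced_states D \<and> T = emb True True True S" for T
      using beta_state_emb[of T S] by (auto simp: generators_def simp del: enhanced_states_iff)
    then show ?thesis by (auto simp del: enhanced_states_iff)
  qed
  moreover have "emb True True True S \<notin> generators D' i j \<Longrightarrow> y (emb True True True S) = 0"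
    using y unfolding in_chains by blast
  ultimately show "linear_ext (generators D' i j) (beta_state D u r) y S = block True True True y S"
    unfolding linear_ext_def block_def by simp
qed

end

section \<open>Quotients of groups of chains\<close>

text \<open>Chains, cycles and boundaries share their addition and differ only in the carrier, so
  cosets can be written without reference to a group.\<close>

definition chain_group :: "(estate \<Rightarrow> 'r::ring) set \<Rightarrow> (estate \<Rightarrow> 'r) monoid" where
  "chain_group Z = \<lparr>carrier = Z, mult = (\<lambda>c c' S. c S + c' S), one = (\<lambda>S. 0)\<rparr>"

definition closed_chains :: "(estate \<Rightarrow> 'r::ring) set \<Rightarrow> bool" where
  "closed_chains Z \<longleftrightarrow> 0 \<in> Z \<and> (\<forall>x\<in>Z. \<forall>y\<in>Z. x - y \<in> Z)"

definition chain_coset :: "(estate \<Rightarrow> 'r::ring) set \<Rightarrow> (estate \<Rightarrow> 'r) \<Rightarrow> (estate \<Rightarrow> 'r) set" where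
  "chain_coset B x = (\<lambda>b. b + x) ` B"

lemma closed_chainsD:
  assumes "closed_chains Z"
  shows "0 \<in> Z" "x \<in> Z \<Longrightarrow> y \<in> Z \<Longrightarrow> x - y \<in> Z" "x \<in> Z \<Longrightarrow> - x \<in> Z"
    "x \<in> Z \<Longrightarrow> y \<in> Z \<Longrightarrow> x + y \<in> Z"
proof -
  show z: "0 \<in> Z" and d: "x \<in> Z \<Longrightarrow> y \<in> Z \<Longrightarrow> x - y \<in> Z" for x y
    using assms unfolding closed_chains_def by blast+
  show m: "- x \<in> Z" if "x \<in> Z" for x using d[OF z that] by (simp only: diff_0)
  show "x + y \<in> Z" if "x \<in> Z" "y \<in> Z" for x y
    using d[OF that(1) m[OF that(2)]] by (simp only: diff_minus_eq_add)
qed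

lemma carrier_chain_group [simp]: "carrier (chain_group Z) = Z"
  by (simp add: chain_group_def)

lemma mult_chain_group: "x \<otimes>\<^bsub>chain_group Z\<^esub> y = x + y"
  by (simp add: chain_group_def plus_fun_def)

lemma one_chain_group: "\<one>\<^bsub>chain_group Z\<^esub> = 0"
  by (simp add: chain_group_def zero_fun_def)

lemma comm_group_chain_group:
  assumes "closed_chains Z" shows "comm_group (chain_group Z)"
proof (rule comm_groupI)
  note closed = closed_chainsD[OF assms]
  show "\<exists>y\<in>carrier (chain_group Z). y \<otimes>\<^bsub>chain_group Z\<^esub> x = \<one>\<^bsub>chain_group Z\<^esub>" if "x \<in> carrier (chain_group Z)" for x
    using closed(3)[of x] that unfolding mult_chain_group one_chain_group carrier_chain_group
    by (metis left_minus)
qed (use closed_chainsD[OF assms] in \<open>simp_all only: mult_chain_group one_chain_group carrier_chain_group add_ac add_0 add.right_neutral\<close>)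

lemma subgroup_chain_group:
  assumes "closed_chains Z" "closed_chains B" "B \<subseteq> Z" shows "subgroup B (chain_group Z)"
proof -
  interpret comm_group "chain_group Z" by (rule comm_group_chain_group[OF assms(1)])
  show ?thesis
  proof (rule subgroupI)
    show "inv\<^bsub>chain_group Z\<^esub> x \<in> B" if "x \<in> B" for x
    proof -
      have "inv\<^bsub>chain_group Z\<^esub> x = - x"
      proof (rule inv_equality)
        show "- x \<otimes>\<^bsub>chain_group Z\<^esub> x = \<one>\<^bsub>chain_group Z\<^esub>"
          by (simp only: mult_chain_group one_chain_group left_minus)
      qed (use that assms closed_chainsD(3)[OF assms(1)] in auto)
      then show ?thesis using closed_chainsD(3)[OF assms(2) that] by simp
    qed
  qed (use assms closed_chainsD[OF assms(2)] in \<open>auto simp: mult_chain_group\<close>)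
qed

lemma r_coset_eq_chain_coset: "mult G = mult (chain_group Z) \<Longrightarrow> B #>\<^bsub>G\<^esub> x = chain_coset B x"
  by (auto simp: r_coset_def chain_coset_def chain_group_def plus_fun_def)

lemma chain_coset_eq_iff:
  assumes "closed_chains B" shows "chain_coset B x = chain_coset B y \<longleftrightarrow> x - y \<in> B"
proof
  assume "chain_coset B x = chain_coset B y"
  moreover have "0 + x \<in> chain_coset B x" using closed_chainsD(1)[OF assms] unfolding chain_coset_def by (rule imageI)
  ultimately obtain b where "b \<in> B" "0 + x = b + y" unfolding chain_coset_def by auto
  then show "x - y \<in> B" by (metis add_0 add_diff_cancel_right')
next
  have sub: "chain_coset B x \<subseteq> chain_coset B y" if "x - y \<in> B" for x y
  proof
    fix c assume "c \<in> chain_coset B x"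
    then obtain b where b: "b \<in> B" "c = b + x" unfolding chain_coset_def by auto
    have "c = (b + (x - y)) + y" unfolding b(2) by (simp only: add.assoc diff_add_cancel)
    then show "c \<in> chain_coset B y"
      unfolding chain_coset_def using closed_chainsD(4)[OF assms b(1) that] by (rule image_eqI)
  qed
  assume xy: "x - y \<in> B"
  then have "y - x \<in> B" using closed_chainsD(3)[OF assms xy] by (simp only: minus_diff_eq)
  then show "chain_coset B x = chain_coset B y" using sub[OF xy] sub by blast
qed

locale chain_quotient =
  fixes Z B :: "(estate \<Rightarrow> 'r::ring) set"
  assumes Z: "closed_chains Z" and B: "closed_chains B" and BZ: "B \<subseteq> Z"
begin

abbreviation "Q \<equiv> chain_group Z Mod B"

lemma comm_group_Q: "comm_group Q"
  using comm_group.abelian_FactGroup[OF comm_group_chain_group[OF Z] subgroup_chain_group[OF Z B BZ]] .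

lemma group_Q: "group Q"
  using comm_group_Q by (simp add: comm_group_def)

lemma carrier_Q: "carrier Q = chain_coset B ` Z"
  unfolding carrier_FactGroup by (simp add: r_coset_eq_chain_coset[OF refl])

lemma one_Q: "\<one>\<^bsub>Q\<^esub> = chain_coset B 0"
  by (simp add: chain_coset_def)

lemma mult_Q: "x \<in> Z \<Longrightarrow> y \<in> Z \<Longrightarrow> chain_coset B x \<otimes>\<^bsub>Q\<^esub> chain_coset B y = chain_coset B (x + y)"
proof -
  assume xy: "x \<in> Z" "y \<in> Z"
  have "B \<lhd> chain_group Z"
    using comm_group.normal_iff_subgroup[OF comm_group_chain_group[OF Z]] subgroup_chain_group[OF Z B BZ] by simp
  from normal.rcos_sum[OF this, of x y] xy show ?thesis
    by (simp add: r_coset_eq_chain_coset[OF refl] mult_chain_group)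
qed

end

text \<open>Well-definedness of an induced map: all representatives have their images in one coset,
  so the union in \<open>induced\<close> is a single coset.\<close>

lemma Union_chain_coset:
  assumes B': "closed_chains B'" and B: "closed_chains B" and "B \<subseteq> Z" "x \<in> Z"
    and add: "\<And>x y. x \<in> Z \<Longrightarrow> y \<in> Z \<Longrightarrow> f (x + y) = f x + f y" and f: "f ` B \<subseteq> B'"
  shows "(\<Union>y\<in>chain_coset B x. chain_coset B' (f y)) = chain_coset B' (f x)"
proof -
  have "chain_coset B' (f y) = chain_coset B' (f x)" if "y \<in> chain_coset B x" for y
  proof -
    obtain b where b: "b \<in> B" "y = b + x" using \<open>y \<in> chain_coset B x\<close> unfolding chain_coset_def by auto
    then have "f y - f x = f b" using add[of b x] assms(3,4) by (metis add_diff_cancel_right' subsetD)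
    then show ?thesis using f b(1) unfolding chain_coset_eq_iff[OF B'] by auto
  qed
  moreover have "0 + x \<in> chain_coset B x" using closed_chainsD(1)[OF B] unfolding chain_coset_def by (rule imageI)
  ultimately show ?thesis by blast
qed

text \<open>Exactness in terms of representatives. The quotients are listed from the end of the
  sequence to its beginning, as in \<open>short_exact_sequence\<close>. Surjectivity is asked for on
  the nose, not just up to boundaries.\<close>

lemma short_exact_sequence_quotients:
  fixes Z1 B1 Z2 B2 Z3 B3 :: "(estate \<Rightarrow> 'r::ring) set"
  assumes q1: "chain_quotient Z1 B1" and q2: "chain_quotient Z2 B2" and q3: "chain_quotient Z3 B3"
    and aZ: "\<alpha> ` Z3 \<subseteq> Z2" and aB: "\<alpha> ` B3 \<subseteq> B2" and bZ: "\<beta> ` Z2 \<subseteq> Z1" and bB: "\<beta> ` B2 \<subseteq> B1"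
    and a_add: "\<And>x y. x \<in> Z3 \<Longrightarrow> y \<in> Z3 \<Longrightarrow> \<alpha> (x + y) = \<alpha> x + \<alpha> y"
    and b_add: "\<And>x y. x \<in> Z2 \<Longrightarrow> y \<in> Z2 \<Longrightarrow> \<beta> (x + y) = \<beta> x + \<beta> y"
    and inj: "\<And>x. x \<in> Z3 \<Longrightarrow> \<alpha> x \<in> B2 \<Longrightarrow> x \<in> B3"
    and comp: "\<And>x. x \<in> Z3 \<Longrightarrow> \<beta> (\<alpha> x) \<in> B1"
    and exact: "\<And>y. y \<in> Z2 \<Longrightarrow> \<beta> y \<in> B1 \<Longrightarrow> \<exists>x\<in>Z3. y - \<alpha> x \<in> B2"
    and surj: "\<And>z. z \<in> Z1 \<Longrightarrow> \<exists>y\<in>Z2. \<beta> y = z"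
  shows "short_exact_sequence (chain_group Z1 Mod B1) (chain_group Z2 Mod B2) (chain_group Z3 Mod B3)
    (\<lambda>X. \<Union>x\<in>X. chain_coset B1 (\<beta> x)) (\<lambda>X. \<Union>x\<in>X. chain_coset B2 (\<alpha> x))"
proof -
  interpret q1: chain_quotient Z1 B1 by (rule q1)
  interpret q2: chain_quotient Z2 B2 by (rule q2)
  interpret q3: chain_quotient Z3 B3 by (rule q3)
  let ?f = "\<lambda>X. \<Union>x\<in>X. chain_coset B1 (\<beta> x)" and ?g = "\<lambda>X. \<Union>x\<in>X. chain_coset B2 (\<alpha> x)"
  have g: "?g (chain_coset B3 x) = chain_coset B2 (\<alpha> x)" if "x \<in> Z3" for x
    by (rule Union_chain_coset[OF q2.B q3.B q3.BZ that a_add aB])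
  have f: "?f (chain_coset B2 x) = chain_coset B1 (\<beta> x)" if "x \<in> Z2" for x
    by (rule Union_chain_coset[OF q1.B q2.B q2.BZ that b_add bB])
  have aZ': "\<alpha> x \<in> Z2" if "x \<in> Z3" for x using aZ that by blast
  have bZ': "\<beta> x \<in> Z1" if "x \<in> Z2" for x using bZ that by blast
  have g_hom: "?g \<in> hom q3.Q q2.Q"
  proof (rule homI)
    fix X assume "X \<in> carrier q3.Q"
    then obtain x where "x \<in> Z3" "X = chain_coset B3 x" unfolding q3.carrier_Q by blast
    then show "?g X \<in> carrier q2.Q" unfolding q2.carrier_Q using g aZ' by simp
  next
    fix X Y assume "X \<in> carrier q3.Q" "Y \<in> carrier q3.Q"
    then obtain x y where "x \<in> Z3" "X = chain_coset B3 x" "y \<in> Z3" "Y = chain_coset B3 y" unfolding q3.carrier_Q by blast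
    then show "?g (X \<otimes>\<^bsub>q3.Q\<^esub> Y) = ?g X \<otimes>\<^bsub>q2.Q\<^esub> ?g Y"
      using closed_chainsD(4)[OF q3.Z] by (simp only: q3.mult_Q q2.mult_Q g aZ' a_add)
  qed
  have f_hom: "?f \<in> hom q2.Q q1.Q"
  proof (rule homI)
    fix X assume "X \<in> carrier q2.Q"
    then obtain x where "x \<in> Z2" "X = chain_coset B2 x" unfolding q2.carrier_Q by blast
    then show "?f X \<in> carrier q1.Q" unfolding q1.carrier_Q using f bZ' by simp
  next
    fix X Y assume "X \<in> carrier q2.Q" "Y \<in> carrier q2.Q"
    then obtain x y where "x \<in> Z2" "X = chain_coset B2 x" "y \<in> Z2" "Y = chain_coset B2 y" unfolding q2.carrier_Q by blast
    then show "?f (X \<otimes>\<^bsub>q2.Q\<^esub> Y) = ?f X \<otimes>\<^bsub>q1.Q\<^esub> ?f Y"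
      using closed_chainsD(4)[OF q2.Z] by (simp only: q2.mult_Q q1.mult_Q f bZ' b_add)
  qed
  have "?f \<in> epi q2.Q q1.Q"
  proof -
    have "Y \<in> ?f ` carrier q2.Q" if Y: "Y \<in> carrier q1.Q" for Y
    proof -
      obtain z where z: "z \<in> Z1" "Y = chain_coset B1 z" using Y unfolding q1.carrier_Q by blast
      obtain y where y: "y \<in> Z2" "\<beta> y = z" using surj[OF z(1)] by blast
      have "Y = ?f (chain_coset B2 y)" using f[OF y(1)] y(2) z(2) by simp
      then show ?thesis unfolding q2.carrier_Q using y(1) by blast
    qed
    then show ?thesis using f_hom unfolding epi_def hom_def by blast
  qed
  moreover have "?g \<in> mon q3.Q q2.Q"
  proof -
    have "inj_on ?g (carrier q3.Q)"
    proof (rule inj_onI)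
      fix X Y assume XY: "X \<in> carrier q3.Q" "Y \<in> carrier q3.Q" and eq: "?g X = ?g Y"
      then obtain x y where x: "x \<in> Z3" "X = chain_coset B3 x" and y: "y \<in> Z3" "Y = chain_coset B3 y" unfolding q3.carrier_Q by blast
      have "\<alpha> x - \<alpha> y \<in> B2" using eq unfolding x(2) y(2) g[OF x(1)] g[OF y(1)] chain_coset_eq_iff[OF q2.B] .
      moreover have xy: "x - y \<in> Z3" using closed_chainsD(2)[OF q3.Z x(1) y(1)] .
      moreover have "\<alpha> x - \<alpha> y = \<alpha> (x - y)" using a_add[OF xy y(1)] by (metis add_diff_cancel_right' diff_add_cancel)
      ultimately have "x - y \<in> B3" using inj by metis
      then show "X = Y" unfolding x(2) y(2) chain_coset_eq_iff[OF q3.B] .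
    qed
    then show ?thesis using g_hom by (simp add: mon_def)
  qed
  moreover have "kernel q2.Q q1.Q ?f = ?g ` carrier q3.Q"
  proof (intro equalityI subsetI)
    fix Y assume "Y \<in> kernel q2.Q q1.Q ?f"
    then have Y: "Y \<in> carrier q2.Q" "?f Y = chain_coset B1 0" unfolding kernel_def q1.one_Q by blast+
    then obtain y where y: "y \<in> Z2" "Y = chain_coset B2 y" unfolding q2.carrier_Q by blast
    have "\<beta> y - 0 \<in> B1" using Y(2) unfolding y(2) f[OF y(1)] chain_coset_eq_iff[OF q1.B] .
    then have "\<beta> y \<in> B1" by (simp only: diff_0_right)
    then obtain x where x: "x \<in> Z3" "y - \<alpha> x \<in> B2" using exact[OF y(1)] by blast
    then have "Y = ?g (chain_coset B3 x)" unfolding y(2) g[OF x(1)] chain_coset_eq_iff[OF q2.B] by blast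
    then show "Y \<in> ?g ` carrier q3.Q" unfolding q3.carrier_Q using x(1) by blast
  next
    fix Y assume "Y \<in> ?g ` carrier q3.Q"
    then obtain x where x: "x \<in> Z3" "Y = ?g (chain_coset B3 x)" unfolding q3.carrier_Q by blast
    have Y: "Y = chain_coset B2 (\<alpha> x)" using x(2) g[OF x(1)] by (rule trans)
    have "?f Y = chain_coset B1 0"
      unfolding Y f[OF aZ'[OF x(1)]] chain_coset_eq_iff[OF q1.B] using comp[OF x(1)] by (simp only: diff_0_right)
    moreover have "Y \<in> carrier q2.Q" unfolding Y q2.carrier_Q using aZ'[OF x(1)] by blast
    ultimately show "Y \<in> kernel q2.Q q1.Q ?f" unfolding kernel_def q1.one_Q by blast
  qed
  ultimately show ?thesis
    unfolding short_exact_sequence_iff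
    using g_hom f_hom q1.group_Q q2.group_Q q3.group_Q
    by (simp add: group_hom_def group_hom_axioms_def)
qed

section \<open>Homology as a quotient of groups of cycles\<close>

lemma homology_eq: "homology D i j = chain_group (cycles D i j) Mod boundaries D i j"
  by (simp add: homology_def chains_def chain_group_def)

lemma induced_eq: "induced D i j f X = (\<Union>x\<in>X. chain_coset (boundaries D i j) (f x))"
  unfolding induced_def by (subst r_coset_eq_chain_coset[of _ UNIV]) (simp_all add: chains_def chain_group_def)

lemma cycles_eq:
  "finite (loops D) \<Longrightarrow> cycles D i j = {c \<in> carrier (chains D i j). differential D c = 0}"
  by (auto simp: cycles_def kernel_def khovanov_d_eq) (auto simp: chains_def zero_fun_def)

lemma boundaries_eq:
  "finite (loops D) \<Longrightarrow> boundaries D i j = differential D ` carrier (chains D (i + 2) j)"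
  unfolding boundaries_def by (intro image_cong refl khovanov_d_eq)

lemma zero_chains: "0 \<in> carrier (chains D i j)"
  unfolding in_chains by simp

lemma diff_chains: "x \<in> carrier (chains D i j) \<Longrightarrow> y \<in> carrier (chains D i j) \<Longrightarrow> x - y \<in> carrier (chains D i j)"
  unfolding in_chains fun_diff_def by (metis diff_self)

lemma sign_all_chains: "x \<in> carrier (chains D i j) \<Longrightarrow> sign_all D x \<in> carrier (chains D i j)"
  unfolding in_chains sign_all_def by (metis minus_zero)

lemma scale_chains: "x \<in> carrier (chains D i j) \<Longrightarrow> (\<lambda>S. a * x S) \<in> carrier (chains D i j)"
  unfolding in_chains by (metis mult_zero_right)

text \<open>One circle turns from negative to positive, so \<open>tau\<close> grows by 2 and the
  second grading by 4.\<close>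

lemma mult_arc_chains:
  assumes fin: "finite (loops D)" and a: "a \<in> arcs D" and c: "c \<in> carrier (chains D i j)"
  shows "mult_arc D a c \<in> carrier (chains D i (j + 4))"
  unfolding in_chains
proof (intro allI impI)
  fix S assume S: "S \<notin> generators D i (j + 4)"
  obtain s P where sP: "S = (s, P)" by (cases S)
  let ?K = "circ D s a"
  have "(s, P - {?K}) \<notin> generators D i j" if "?K \<in> P"
  proof
    assume g: "(s, P - {?K}) \<in> generators D i j"
    have "?K \<in> circles D s" using a by (simp add: circles_eq)
    then have P: "P \<subseteq> circles D s" using g by (auto simp: generators_def)
    have "finite P" using P finite_circles[OF fin] by (rule finite_subset)
    then have "card P = card (P - {?K}) + 1" using card_remove_one[of P ?K] that by simp
    moreover have "P - {?K} \<subseteq> circles D s" using P by blast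
    ultimately have "tau D (s, P) = tau D (s, P - {?K}) + 2"
      using tau_eq[OF fin P] tau_eq[OF fin, of "P - {?K}" s] by linarith
    then have "S \<in> generators D i (j + 4)"
      using g P by (auto simp: sP generators_def sigma_def)
    then show False using S by blast
  qed
  then show "mult_arc D a c S = 0" using c unfolding in_chains by (simp add: mult_arc_def sP)
qed

lemma differential_scale': "differential D (\<lambda>S. a * c S) = 0" if "differential D c = 0" for a :: "'r::ring"
  unfolding differential_scale that by (simp add: zero_fun_def)

text \<open>The vanishing of the square is a hypothesis here because it has two different origins:
  the directions of the arcs for \<open>D\<close>, the block formulas for \<open>D'\<close>.\<close>

lemma complex_quotient:
  fixes D :: link_diagram and i j :: int
  assumes fin: "finite (loops D)"
    and dd: "\<And>c :: estate \<Rightarrow> 'r::ring. c \<in> carrier (chains D (i + 2) j) \<Longrightarrow> differential D (differential D c) = 0"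
  shows "chain_quotient (cycles D i j :: (estate \<Rightarrow> 'r) set) (boundaries D i j)"
proof
  note diff = additive.diff[OF additive_differential]
  have "0 \<in> cycles D i j"
    unfolding cycles_eq[OF fin] using zero_chains additive.zero[OF additive_differential] by blast
  moreover have "x - y \<in> cycles D i j" if "x \<in> cycles D i j" "y \<in> cycles D i j" for x y :: "estate \<Rightarrow> 'r"
    using that diff_chains diff[of D x y] unfolding cycles_eq[OF fin] mem_Collect_eq by (metis diff_self)
  ultimately show "closed_chains (cycles D i j :: (estate \<Rightarrow> 'r) set)" unfolding closed_chains_def by blast
  have "0 \<in> boundaries D i j"
    unfolding boundaries_eq[OF fin] using zero_chains additive.zero[OF additive_differential] by (metis imageI)
  moreover have "x - y \<in> boundaries D i j" if xy: "x \<in> boundaries D i j" "y \<in> boundaries D i j" for x y :: "estate \<Rightarrow> 'r"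
  proof -
    obtain a b where "x = differential D a" "y = differential D b" "a \<in> carrier (chains D (i + 2) j)" "b \<in> carrier (chains D (i + 2) j)"
      using xy unfolding boundaries_eq[OF fin] by blast
    then show ?thesis unfolding boundaries_eq[OF fin] using diff[of D a b] diff_chains[of a] by (metis imageI)
  qed
  ultimately show "closed_chains (boundaries D i j :: (estate \<Rightarrow> 'r) set)" unfolding closed_chains_def by blast
  show "boundaries D i j \<subseteq> (cycles D i j :: (estate \<Rightarrow> 'r) set)"
  proof
    fix x :: "estate \<Rightarrow> 'r" assume "x \<in> boundaries D i j"
    then obtain a where a: "x = differential D a" "a \<in> carrier (chains D (i + 2) j)" unfolding boundaries_eq[OF fin] by blast
    have "differential D a \<in> carrier (chains D (i + 2 - 2) j)" by (rule differential_chains[OF fin a(2)])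
    then show "x \<in> cycles D i j" using dd[OF a(2)] unfolding a(1) cycles_eq[OF fin] by simp
  qed
qed

lemma scale_coset:
  fixes D :: link_diagram and i j :: int and a :: "'r::ring"
  assumes fin: "finite (loops D)" and q: "chain_quotient (cycles D i j :: (estate \<Rightarrow> 'r) set) (boundaries D i j)"
    and x: "x \<in> cycles D i j"
  shows "scale D i j a (chain_coset (boundaries D i j) x) = chain_coset (boundaries D i j) (\<lambda>S. a * x S)"
    and "(\<lambda>S. a * x S) \<in> cycles D i j"
proof -
  interpret chain_quotient "cycles D i j :: (estate \<Rightarrow> 'r) set" "boundaries D i j" by (rule q)
  have "(\<lambda>S. a * (b + c) S) = (\<lambda>S. a * b S) + (\<lambda>S. a * c S)" for b c :: "estate \<Rightarrow> 'r"
    by (simp add: fun_eq_iff distrib_left)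
  moreover have "(\<lambda>c S. a * c S) ` boundaries D i j \<subseteq> boundaries D i j"
    unfolding boundaries_eq[OF fin] using scale_chains differential_scale[symmetric] by blast
  ultimately show "scale D i j a (chain_coset (boundaries D i j) x) = chain_coset (boundaries D i j) (\<lambda>S. a * x S)"
    unfolding scale_def induced_eq by (intro Union_chain_coset[OF B B BZ x])
  show "(\<lambda>S. a * x S) \<in> cycles D i j"
    using x scale_chains differential_scale' unfolding cycles_eq[OF fin] by blast
qed

text \<open>The shape of the cross terms in the square of the differential of \<open>D'\<close>,
  once E has been moved past d at the cost of a sign.\<close>

lemma cancel_neg:
  fixes x y :: "'a::ab_group_add"
  shows "- x - y + (x + y) = 0" "- x - - y + (x - y) = 0"
  by simp_all

section \<open>Exactness on the level of chains\<close>

context hopf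
begin

lemma block_diff: "block m0 m1 z (y - y') = block m0 m1 z y - block m0 m1 z y'"
  by (auto simp: block_def fun_eq_iff)

lemma block_0: "block m0 m1 z 0 = 0"
  by (auto simp: block_def fun_eq_iff)

lemmas linear_simps =
  additive.add[OF additive_differential] additive.diff[OF additive_differential]
  additive.minus[OF additive_differential] additive.zero[OF additive_differential]
  additive.add[OF additive_mult_arc] additive.diff[OF additive_mult_arc]
  additive.minus[OF additive_mult_arc] additive.zero[OF additive_mult_arc]
  additive.add[OF additive_sign_all] additive.diff[OF additive_sign_all]
  additive.minus[OF additive_sign_all] additive.zero[OF additive_sign_all]

lemmas block_differential = block_positive block_mixed[of True False, simplified] block_mixed[of False True, simplified] block_negative

lemma chains_eqI6:
  assumes "y \<in> carrier (chains D' i j)" "y' \<in> carrier (chains D' i' j')"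
    and "block True True True y = block True True True y'" "block True True False y = block True True False y'"
    "block True False False y = block True False False y'" "block False True False y = block False True False y'"
    "block False False True y = block False False True y'" "block False False False y = block False False False y'"
  shows "y = y'"
proof (rule chains_eqI[OF assms(1,2)])
  fix m0 m1 z :: bool assume "z \<longrightarrow> m0 = m1"
  then show "block m0 m1 z y = block m0 m1 z y'"
    using assms(3-8) by (cases m0; cases m1; cases z) (simp_all only: simp_thms)
qed

lemma blocks_lift:
  assumes "c \<in> carrier (chains D i j)"
  shows "block True True True (lift True True True c) = c" "block True True False (lift True True True c) = 0"
    "block True False False (lift True True True c) = 0" "block False True False (lift True True True c) = 0"
    "block False False True (lift True True True c) = 0" "block False False False (lift True True True c) = 0"
    "block True True True (lift True True False c) = 0" "block True True False (lift True True False c) = c"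
    "block True False False (lift True True False c) = 0" "block False True False (lift True True False c) = 0"
    "block False False True (lift True True False c) = 0" "block False False False (lift True True False c) = 0"
    "block True True True (lift False True False c) = 0" "block True True False (lift False True False c) = 0"
    "block True False False (lift False True False c) = 0" "block False True False (lift False True False c) = c"
    "block False False True (lift False True False c) = 0" "block False False False (lift False True False c) = 0"
    "block True True True (lift False False False c) = 0" "block True True False (lift False False False c) = 0"
    "block True False False (lift False False False c) = 0" "block False True False (lift False False False c) = 0"
    "block False False True (lift False False False c) = 0" "block False False False (lift False False False c) = c"
  using block_lift[OF _ _ chains_outside[OF assms]] by simp_all

lemmas group_simps = add_0 add.right_neutral diff_0 diff_0_right minus_zero minus_minus diff_self left_minus right_minus add_uminus_conv_diff

lemma shift_values [simp]:
  "sigma_shift True True = 2" "sigma_shift True False = 0" "sigma_shift False True = 0" "sigma_shift False False = - 2"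
  "degree_shift True True True = 4" "degree_shift True True False = 0" "degree_shift True False False = 0"
  "degree_shift False True False = 0" "degree_shift False False True = 0" "degree_shift False False False = - 4"
  by (simp_all add: sigma_shift_def degree_shift_def)

text \<open>Computed block by block: the cross terms cancel since X commutes and E anticommutes with
  d.\<close>

lemma differential_differential':
  assumes "y \<in> carrier (chains D' i j)"
  shows "differential D' (differential D' y) = 0"
proof (rule chains_eqI6)
  show "differential D' (differential D' y) \<in> carrier (chains D' (i - 2 - 2) j)"
    by (intro differential_chains[OF finite_loops'] assms)
  show "0 \<in> carrier (chains D' i j)" by (rule zero_chains)
qed (simp_all only: block_differential block_0 differential_differential linear_simps group_simps
      differential_sign_all differential_mult_arc[OF e_arc] mult_arc_sign_all add_diff_cancel_right cancel_neg)

lemma complex_D: "chain_quotient (cycles D i j :: (estate \<Rightarrow> 'r::ring) set) (boundaries D i j)"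
  by (rule complex_quotient[OF finite_loops differential_differential])

lemma complex_D': "chain_quotient (cycles D' i j :: (estate \<Rightarrow> 'r::ring) set) (boundaries D' i j)"
  by (rule complex_quotient[OF finite_loops' differential_differential'])

text \<open>Once both new markers are negative, only markers of \<open>D\<close> can still change,
  and these changes keep the sign of the small circle; so the states with a negative small circle
  span a copy of the complex of \<open>D\<close>.\<close>

lemma differential_lift:
  fixes c :: "estate \<Rightarrow> 'r::ring"
  assumes c: "c \<in> carrier (chains D (i + 2) (j + 4))"
  shows "lift False False False c \<in> carrier (chains D' i j)"
    and "differential D' (lift False False False c) = lift False False False (differential D c)"
proof -
  show l: "lift False False False c \<in> carrier (chains D' i j)"
    using lift_chains[of c i False False j False] c by simp
  have dc: "differential D c \<in> carrier (chains D (i + 2 - 2) (j + 4))" by (rule differential_chains[OF finite_loops c])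
  show "differential D' (lift False False False c) = lift False False False (differential D c)"
  proof (rule chains_eqI6)
    show "differential D' (lift False False False c) \<in> carrier (chains D' (i - 2) j)"
      by (rule differential_chains[OF finite_loops' l])
    show "lift False False False (differential D c) \<in> carrier (chains D' (i - 2) j)"
      using lift_chains[of "differential D c" "i - 2" False False j False] dc by simp
  qed (simp_all only: block_differential blocks_lift[OF c] blocks_lift[OF dc] linear_simps group_simps)
qed

lemma alpha_injective:
  fixes c :: "estate \<Rightarrow> 'r::ring"
  assumes c: "c \<in> cycles D (i + 2) (j + 4)" and b: "lift False False False c \<in> boundaries D' i j"
  shows "c \<in> boundaries D (i + 2) (j + 4)"
proof -
  have c': "c \<in> carrier (chains D (i + 2) (j + 4))" using c cycles_eq[OF finite_loops] by blast
  obtain y where y: "y \<in> carrier (chains D' (i + 2) j)" "lift False False False c = differential D' y"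
    using b unfolding boundaries_eq[OF finite_loops'] by blast
  define f where "f = block False False True y"
  define g where "g = block False False False y"
  define E where "E = sign_all D (block False True False y - block True False False y)"
  \<comment> \<open>The two components with negative new markers are compared: the positive small
    circle has coefficient 0 on the left, which expresses \<open>E\<close> by \<open>f\<close>; the
    negative one has coefficient \<open>c\<close>.\<close>
  have "0 = differential D f + E" "c = differential D g + mult_arc D e E"
    using blocks_lift(23,24)[OF c', unfolded y(2) block_differential] unfolding f_def g_def E_def by simp_all
  then have "E = - differential D f" by (metis add_eq_0_iff)
  then have "c = differential D (g - mult_arc D e f)"
    using \<open>c = differential D g + mult_arc D e E\<close>
    by (simp only: linear_simps differential_mult_arc[OF e_arc] add_uminus_conv_diff)
  moreover have "g - mult_arc D e f \<in> carrier (chains D (i + 2 + 2) (j + 4))"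
  proof (rule diff_chains)
    show "g \<in> carrier (chains D (i + 2 + 2) (j + 4))"
      using block_chains[OF y(1), of False False False] by (simp add: g_def)
    have "f \<in> carrier (chains D (i + 2 + 2) j)"
      using block_chains[OF y(1), of True False False] by (simp add: f_def)
    then show "mult_arc D e f \<in> carrier (chains D (i + 2 + 2) (j + 4))"
      by (rule mult_arc_chains[OF finite_loops e_arc])
  qed
  ultimately show ?thesis unfolding boundaries_eq[OF finite_loops] by blast
qed

lemma beta_surjective:
  fixes p :: "estate \<Rightarrow> 'r::ring"
  assumes p: "p \<in> cycles D (i - 2) (j - 4)"
  shows "\<exists>y\<in>cycles D' i j. block True True True y = p"
proof -
  have p': "p \<in> carrier (chains D (i - 2) (j - 4))" and dp: "differential D p = 0"
    using p cycles_eq[OF finite_loops] by blast+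
  have q: "mult_arc D e p \<in> carrier (chains D (i - 2) j)"
    using mult_arc_chains[OF finite_loops e_arc p'] by simp
  \<comment> \<open>With q = - X p the merged term q + X p vanishes, and d q = - X d p = 0.\<close>
  define y where "y = lift True True True p - lift True True False (mult_arc D e p)"
  have y: "y \<in> carrier (chains D' i j)"
    unfolding y_def
    using lift_chains[of p i True True j True] lift_chains[of "mult_arc D e p" i True True j False] p' q
    by (intro diff_chains) simp_all
  have "differential D' y = 0"
  proof (rule chains_eqI6)
    show "differential D' y \<in> carrier (chains D' (i - 2) j)" by (rule differential_chains[OF finite_loops' y])
    show "0 \<in> carrier (chains D' (i - 2) j)" by (rule zero_chains)
  qed (simp_all only: y_def block_differential block_0 block_diff blocks_lift[OF p'] blocks_lift[OF q] linear_simps group_simps dp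
      differential_mult_arc[OF e_arc])
  moreover have "block True True True y = p"
    unfolding y_def by (simp only: block_diff blocks_lift[OF p'] blocks_lift[OF q] group_simps)
  ultimately show ?thesis using y cycles_eq[OF finite_loops'] by blast
qed

text \<open>The components of a cycle are made to vanish one after the other by subtracting boundaries, until
  only the image of the first map is left.\<close>

lemma exact_middle:
  fixes y :: "estate \<Rightarrow> 'r::ring"
  assumes y: "y \<in> cycles D' i j" and b: "block True True True y \<in> boundaries D (i - 2) (j - 4)"
  shows "\<exists>c\<in>cycles D (i + 2) (j + 4). y - lift False False False c \<in> boundaries D' i j"
proof -
  have yc: "y \<in> carrier (chains D' i j)" and dy: "differential D' y = 0" using y cycles_eq[OF finite_loops'] by blast+
  note dl = additive.diff[OF additive_differential, of D']
  have cyc: "x - differential D' z \<in> carrier (chains D' i j)" "differential D' (x - differential D' z) = 0"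
    if "x \<in> carrier (chains D' i j)" "differential D' x = 0" "z \<in> carrier (chains D' (i + 2) j)" for x z :: "estate \<Rightarrow> 'r"
  proof -
    have "differential D' z \<in> carrier (chains D' i j)" using differential_chains[OF finite_loops' that(3)] by simp
    then show "x - differential D' z \<in> carrier (chains D' i j)" by (rule diff_chains[OF that(1)])
    show "differential D' (x - differential D' z) = 0"
      by (simp only: dl that(2) differential_differential'[OF that(3)] diff_self)
  qed
  obtain p where p: "p \<in> carrier (chains D (i - 2 + 2) (j - 4))" "block True True True y = differential D p"
    using b unfolding boundaries_eq[OF finite_loops] by blast
  define z1 where "z1 = lift True True True p"
  define y1 where "y1 = y - differential D' z1"
  have z1: "z1 \<in> carrier (chains D' (i + 2) j)"
    using lift_chains[of p "i + 2" True True j True] p(1) by (simp add: z1_def)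
  note y1 = cyc[OF yc dy z1, folded y1_def]
  have y1_blocks: "block True True True y1 = 0"
    by (simp only: y1_def z1_def block_diff block_differential blocks_lift[OF p(1)] p(2) group_simps)
  \<comment> \<open>Since E E = 1, the boundary of E a, placed with positive new markers and
    negative small circle, has the mixed component a. By the cycle condition it cancels the
    component q at the same time.\<close>
  define a1 where "a1 = sign_all D (block True False False y1)"
  have a1: "a1 \<in> carrier (chains D i j)"
    unfolding a1_def using block_chains[OF y1(1), of False True False] by (intro sign_all_chains) simp
  define z2 where "z2 = lift True True False a1"
  define y2 where "y2 = y1 - differential D' z2"
  have z2: "z2 \<in> carrier (chains D' (i + 2) j)"
    using lift_chains[of a1 "i + 2" True True j False] a1 by (simp add: z2_def)
  note y2 = cyc[OF y1 z2, folded y2_def]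
  have "0 = block True False False (differential D' y1)" by (simp only: y1(2) block_0)
  then have "0 = differential D (block True False False y1) + sign_all D (block True True False y1)"
    by (simp only: block_differential y1_blocks linear_simps group_simps)
  then have "sign_all D (block True True False y1) = - differential D (block True False False y1)"
    by (metis add_eq_0_iff)
  then have q1: "block True True False y1 = differential D a1"
    unfolding a1_def differential_sign_all by (metis sign_all_sign_all additive.minus[OF additive_sign_all])
  have y2_blocks: "block True True True y2 = 0" "block True True False y2 = 0" "block True False False y2 = 0"
    by (simp_all only: y2_def z2_def block_diff block_differential blocks_lift[OF a1] q1 y1_blocks linear_simps group_simps)
       (simp only: a1_def sign_all_sign_all group_simps)
  \<comment> \<open>The same device once more: E f, placed at the other mixed pair of markers,
    cancels f and, by the cycle condition, also the remaining mixed component.\<close>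
  define f2 where "f2 = sign_all D (block False False True y2)"
  have f2: "f2 \<in> carrier (chains D (i + 2) j)"
    unfolding f2_def using block_chains[OF y2(1), of True False False] by (intro sign_all_chains) simp
  define z3 where "z3 = lift False True False f2"
  define y3 where "y3 = y2 - differential D' z3"
  have z3: "z3 \<in> carrier (chains D' (i + 2) j)"
    using lift_chains[of f2 "i + 2" False True j False] f2 by (simp add: z3_def)
  note y3 = cyc[OF y2 z3, folded y3_def]
  have "0 = block False False True (differential D' y2)" by (simp only: y2(2) block_0)
  then have "0 = differential D (block False False True y2) + sign_all D (block False True False y2)"
    by (simp only: block_differential y2_blocks linear_simps group_simps)
  then have "sign_all D (block False True False y2) = - differential D (block False False True y2)"
    by (metis add_eq_0_iff)
  then have b2: "block False True False y2 = differential D f2"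
    unfolding f2_def differential_sign_all by (metis sign_all_sign_all additive.minus[OF additive_sign_all])
  have y3_blocks: "block True True True y3 = 0" "block True True False y3 = 0" "block True False False y3 = 0"
    "block False True False y3 = 0" "block False False True y3 = 0"
    by (simp_all only: y3_def z3_def block_diff block_differential blocks_lift[OF f2] b2 y2_blocks linear_simps group_simps)
       (simp only: f2_def sign_all_sign_all group_simps)
  define c where "c = block False False False y3"
  have c: "c \<in> carrier (chains D (i + 2) (j + 4))"
    unfolding c_def using block_chains[OF y3(1), of False False False] by simp
  have "block False False False (differential D' y3) = differential D c"
    by (simp only: block_differential y3_blocks linear_simps group_simps c_def)
  then have "differential D c = 0" by (simp only: y3(2) block_0)
  then have cc: "c \<in> cycles D (i + 2) (j + 4)" using c cycles_eq[OF finite_loops] by blast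
  have "y3 = lift False False False c"
    by (rule chains_eqI6[OF y3(1) differential_lift(1)[OF c]])
       (simp_all only: blocks_lift[OF c] y3_blocks c_def[symmetric])
  then have "y - lift False False False c = differential D' (z1 + z2 + z3)"
    unfolding y3_def y2_def y1_def additive.add[OF additive_differential] by (simp only: algebra_simps)
  moreover have "z1 + z2 + z3 \<in> carrier (chains D' (i + 2) j)"
    using z1 z2 z3 unfolding in_chains plus_fun_def by (metis add_0)
  ultimately show ?thesis using cc unfolding boundaries_eq[OF finite_loops'] by blast
qed

end

section \<open>The induced maps on homology\<close>

lemma linear_ext_add: "linear_ext B f (x + y) = linear_ext B f x + linear_ext B f y"
  by (simp add: linear_ext_def fun_eq_iff sum.distrib)

lemma linear_ext_scale: "linear_ext B f (\<lambda>S. a * x S) = (\<lambda>T. a * linear_ext B f x T)"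
  by (simp add: linear_ext_def fun_eq_iff sum_distrib_left)

lemma induced_coset:
  fixes D1 D2 :: link_diagram and i j i' j' :: int
  defines "Z1 \<equiv> cycles D1 i j :: (estate \<Rightarrow> 'r::ring) set" and "B1 \<equiv> boundaries D1 i j"
  assumes "chain_quotient Z1 B1" "chain_quotient (cycles D2 i' j' :: (estate \<Rightarrow> 'r) set) (boundaries D2 i' j')"
    and "x \<in> Z1" "linear_ext G f ` B1 \<subseteq> boundaries D2 i' j'"
  shows "induced D2 i' j' (linear_ext G f) (chain_coset B1 x) = chain_coset (boundaries D2 i' j') (linear_ext G f x)"
proof -
  interpret q1: chain_quotient Z1 B1 by fact
  interpret q2: chain_quotient "cycles D2 i' j' :: (estate \<Rightarrow> 'r) set" "boundaries D2 i' j'" by fact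
  show ?thesis
    unfolding induced_eq by (rule Union_chain_coset[OF q2.B q1.B q1.BZ assms(5) linear_ext_add assms(6)])
qed

context hopf
begin

abbreviation "alpha_chain i j \<equiv> linear_ext (generators D (i + 2) (j + 4)) (alpha_state D D')"
abbreviation "beta_chain i j \<equiv> linear_ext (generators D' i j) (beta_state D u r)"

lemma cycles_chains: "finite (loops X) \<Longrightarrow> c \<in> cycles X i j \<Longrightarrow> c \<in> carrier (chains X i j) \<and> differential X c = 0"
  by (simp add: cycles_eq)

lemma alpha_cycles: "alpha_chain i j ` cycles D (i + 2) (j + 4) \<subseteq> (cycles D' i j :: (estate \<Rightarrow> 'r::ring) set)"
proof
  fix y :: "estate \<Rightarrow> 'r" assume "y \<in> alpha_chain i j ` cycles D (i + 2) (j + 4)"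
  then obtain c where c: "c \<in> carrier (chains D (i + 2) (j + 4))" "differential D c = 0" "y = alpha_chain i j c"
    using cycles_chains[OF finite_loops] by blast
  have y: "y = lift False False False c" unfolding c(3) by (rule alpha_eq_lift[OF c(1)])
  have "lift False False False (0 :: estate \<Rightarrow> 'r) = 0" by (simp add: lift_def fun_eq_iff)
  then show "y \<in> cycles D' i j"
    using differential_lift[OF c(1)] c(2) unfolding cycles_eq[OF finite_loops'] y by simp
qed

lemma alpha_boundaries: "alpha_chain i j ` boundaries D (i + 2) (j + 4) \<subseteq> (boundaries D' i j :: (estate \<Rightarrow> 'r::ring) set)"
proof
  fix y :: "estate \<Rightarrow> 'r" assume "y \<in> alpha_chain i j ` boundaries D (i + 2) (j + 4)"
  then obtain g where g: "g \<in> carrier (chains D (i + 2 + 2) (j + 4))" "y = alpha_chain i j (differential D g)"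
    unfolding boundaries_eq[OF finite_loops] by blast
  have dg: "differential D g \<in> carrier (chains D (i + 2) (j + 4))"
    using differential_chains[OF finite_loops g(1)] by (simp only: add_diff_cancel_right')
  have "y = differential D' (lift False False False g)"
    unfolding g(2) alpha_eq_lift[OF dg] differential_lift(2)[OF g(1)] ..
  then show "y \<in> boundaries D' i j"
    using differential_lift(1)[OF g(1)] unfolding boundaries_eq[OF finite_loops'] by blast
qed

lemma block_positive_chains:
  "y \<in> carrier (chains D' i j) \<Longrightarrow> block True True True y \<in> carrier (chains D (i - 2) (j - 4))"
  using block_chains[of y i j True True True] by simp

lemma beta_cycles: "beta_chain i j ` cycles D' i j \<subseteq> (cycles D (i - 2) (j - 4) :: (estate \<Rightarrow> 'r::ring) set)"
proof
  fix p :: "estate \<Rightarrow> 'r" assume "p \<in> beta_chain i j ` cycles D' i j"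
  then obtain y where y: "y \<in> carrier (chains D' i j)" "differential D' y = 0" "p = beta_chain i j y"
    using cycles_chains[OF finite_loops'] by blast
  have p: "p = block True True True y" unfolding y(3) by (rule beta_eq_block[OF y(1)])
  have "differential D p = 0" unfolding p block_positive[symmetric] y(2) by (rule block_0)
  then show "p \<in> cycles D (i - 2) (j - 4)"
    using block_positive_chains[OF y(1)] unfolding cycles_eq[OF finite_loops] p by simp
qed

lemma beta_boundaries: "beta_chain i j ` boundaries D' i j \<subseteq> (boundaries D (i - 2) (j - 4) :: (estate \<Rightarrow> 'r::ring) set)"
proof
  fix p :: "estate \<Rightarrow> 'r" assume "p \<in> beta_chain i j ` boundaries D' i j"
  then obtain y where y: "y \<in> carrier (chains D' (i + 2) j)" "p = beta_chain i j (differential D' y)"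
    unfolding boundaries_eq[OF finite_loops'] by blast
  have dy: "differential D' y \<in> carrier (chains D' i j)"
    using differential_chains[OF finite_loops' y(1)] by (simp only: add_diff_cancel_right')
  have "p = differential D (block True True True y)"
    unfolding y(2) beta_eq_block[OF dy] block_positive ..
  moreover have "block True True True y \<in> carrier (chains D (i - 2 + 2) (j - 4))"
    using block_positive_chains[OF y(1)] by simp
  ultimately show "p \<in> boundaries D (i - 2) (j - 4)"
    unfolding boundaries_eq[OF finite_loops] by blast
qed

lemma homology_sequence:
  "short_exact_sequence
     (homology D (i - 2) (j - 4) :: (estate \<Rightarrow> 'r::ring) set monoid)
     (homology D' i j) (homology D (i + 2) (j + 4)) (beta_h D u r D' i j) (alpha_h D D' i j)"
proof -
  have a: "alpha_h D D' i j = (\<lambda>X :: (estate \<Rightarrow> 'r) set. \<Union>x\<in>X. chain_coset (boundaries D' i j) (alpha_chain i j x))"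
    and b: "beta_h D u r D' i j = (\<lambda>X :: (estate \<Rightarrow> 'r) set. \<Union>x\<in>X. chain_coset (boundaries D (i - 2) (j - 4)) (beta_chain i j x))"
    unfolding alpha_h_def beta_h_def by (intro ext induced_eq)+
  have alpha: "alpha_chain i j c = lift False False False c" if "c \<in> cycles D (i + 2) (j + 4)" for c :: "estate \<Rightarrow> 'r"
    using cycles_chains[OF finite_loops that] by (intro alpha_eq_lift) blast
  have beta: "beta_chain i j y = block True True True y" if "y \<in> cycles D' i j" for y :: "estate \<Rightarrow> 'r"
    using cycles_chains[OF finite_loops' that] by (intro beta_eq_block) blast
  show ?thesis
    unfolding homology_eq a b
  proof (rule short_exact_sequence_quotients[OF complex_D complex_D' complex_D
        alpha_cycles alpha_boundaries beta_cycles beta_boundaries linear_ext_add linear_ext_add])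
    fix c :: "estate \<Rightarrow> 'r" assume c: "c \<in> cycles D (i + 2) (j + 4)"
    show "c \<in> boundaries D (i + 2) (j + 4)" if "alpha_chain i j c \<in> boundaries D' i j"
      using alpha_injective[OF c] that unfolding alpha[OF c] .
    have "alpha_chain i j c \<in> cycles D' i j" using alpha_cycles c by blast
    from beta[OF this] have "beta_chain i j (alpha_chain i j c) = block True True True (lift False False False c)"
      unfolding alpha[OF c] .
    also have "\<dots> = 0" using cycles_chains[OF finite_loops c] blocks_lift(19) by blast
    finally show "beta_chain i j (alpha_chain i j c) \<in> boundaries D (i - 2) (j - 4)"
      using closed_chainsD(1)[OF chain_quotient.B[OF complex_D]] by simp
  next
    fix y :: "estate \<Rightarrow> 'r" assume y: "y \<in> cycles D' i j" "beta_chain i j y \<in> boundaries D (i - 2) (j - 4)"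
    obtain c where "c \<in> cycles D (i + 2) (j + 4)" "y - lift False False False c \<in> boundaries D' i j"
      using exact_middle[OF y(1) y(2)[unfolded beta[OF y(1)]]] by blast
    then show "\<exists>x\<in>cycles D (i + 2) (j + 4). y - alpha_chain i j x \<in> boundaries D' i j"
      using alpha by metis
  next
    fix p :: "estate \<Rightarrow> 'r" assume "p \<in> cycles D (i - 2) (j - 4)"
    then show "\<exists>y\<in>cycles D' i j. beta_chain i j y = p" using beta_surjective beta by metis
  qed
qed

text \<open>Scaling acts on representatives, and linear extensions commute with left multiplication
  of the coefficients.\<close>

lemma alpha_scale:
  fixes a :: "'r::ring"
  assumes "X \<in> carrier (homology D (i + 2) (j + 4))"
  shows "alpha_h D D' i j (scale D (i + 2) (j + 4) a X) = scale D' i j a (alpha_h D D' i j X)"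
proof -
  obtain x where x: "x \<in> cycles D (i + 2) (j + 4)" "X = chain_coset (boundaries D (i + 2) (j + 4)) x"
    using assms unfolding homology_eq chain_quotient.carrier_Q[OF complex_D] by blast
  have ax: "alpha_chain i j x \<in> cycles D' i j" using alpha_cycles x(1) by blast
  note ic = induced_coset[OF complex_D complex_D' _ alpha_boundaries]
  show ?thesis
    unfolding alpha_h_def x(2) scale_coset(1)[OF finite_loops complex_D x(1)] ic[OF x(1)]
      ic[OF scale_coset(2)[OF finite_loops complex_D x(1)]] scale_coset(1)[OF finite_loops' complex_D' ax] linear_ext_scale ..
qed

lemma beta_scale:
  fixes a :: "'r::ring"
  assumes "X \<in> carrier (homology D' i j)"
  shows "beta_h D u r D' i j (scale D' i j a X) = scale D (i - 2) (j - 4) a (beta_h D u r D' i j X)"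
proof -
  obtain x where x: "x \<in> cycles D' i j" "X = chain_coset (boundaries D' i j) x"
    using assms unfolding homology_eq chain_quotient.carrier_Q[OF complex_D'] by blast
  have bx: "beta_chain i j x \<in> cycles D (i - 2) (j - 4)" using beta_cycles x(1) by blast
  note ic = induced_coset[OF complex_D' complex_D _ beta_boundaries]
  show ?thesis
    unfolding beta_h_def x(2) scale_coset(1)[OF finite_loops' complex_D' x(1)] ic[OF x(1)]
      ic[OF scale_coset(2)[OF finite_loops' complex_D' x(1)]] scale_coset(1)[OF finite_loops complex_D bx] linear_ext_scale ..
qed

end

lemma hopf_sum_hopf:
  assumes "is_diagram D" "hopf_sum D u l r D'"
  shows "\<exists>c0 e w h0 h1 cs. hopf D c0 D' u l r e w h0 h1 cs"
proof -
  obtain c0 where or: "oriented D c0" using is_diagram_oriented[OF assms(1)] by blast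
  have fin: "finite (loops D)" and l4: "\<forall>x\<in>set (crossings D). length x = 4"
    using assms(1) by (simp_all add: is_diagram_def)
  have "oriented_diagram D c0" using or fin by (simp add: oriented_diagram_def)
  note od = this
  have fresh_map: "map (id(w := e)) x = x" if "x \<in> set (crossings D)" "w \<notin> arcs D \<or> w = e" for w e x
  proof -
    have "set x \<subseteq> arcs D" using that(1) by (auto simp: arcs_def edges_def)
    then show ?thesis using that(2) by (intro map_idI) (auto simp: fun_upd_def)
  qed
  from assms(2) show ?thesis
  proof cases
    case (on_edge k p e w hs)
    let ?cs = "(crossings D)[k := (crossings D ! k)[p := w]]"
    have k: "k < ncr D" "p < 4" using on_edge(2) by (auto simp: ends_def)
    then have ck: "crossings D ! k \<in> set (crossings D)" "p < length (crossings D ! k)" using l4 by auto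
    have w: "w \<notin> arcs D" using on_edge(5) by blast
    have e: "e \<in> arcs D" using arc_at_in_edges[OF l4 on_edge(2)] on_edge(3) by (simp add: arcs_def)
    have "map (id(w := e)) (?cs ! j) = crossings D ! j" if "j < ncr D" for j
    proof (cases "j = k")
      case True
      \<comment> \<open>Only the end \<open>p\<close> was renamed, and \<open>w\<close> is fresh; so
        renaming back restores the crossing even if \<open>e\<close> occurs there twice.\<close>
      have "crossings D ! k ! p = e" using on_edge(3) by (simp add: arc_at_def)
      then have "(crossings D ! k)[p := e] = crossings D ! k" using list_update_id by metis
      then show ?thesis
        using True k fresh_map[OF ck(1), of w e] w by (simp add: map_update del: fun_upd_apply) simp
    next
      case False
      then show ?thesis using fresh_map[of "crossings D ! j" w e] that w by simp
    qed
    moreover obtain h0 h1 where "hs = [h0, h1]" "h0 = [l, e, r, u] \<and> h1 = [u, r, w, l] \<or> h0 = [u, r, w, l] \<and> h1 = [l, e, r, u]"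
      using on_edge(6) by (auto simp: hopf_crossings_def)
    ultimately have "hopf D c0 D' u l r e w h0 h1 ?cs"
      using od e w on_edge(1,4,5) by (auto simp: hopf_def hopf_axioms_def)
    then show ?thesis by blast
  next
    case (on_loop e hs)
    obtain h0 h1 where "hs = [h0, h1]" "h0 = [l, e, r, u] \<and> h1 = [u, r, e, l] \<or> h0 = [u, r, e, l] \<and> h1 = [l, e, r, u]"
      using on_loop(5) by (auto simp: hopf_crossings_def)
    moreover have e: "e \<in> arcs D" using on_loop(2) by (simp add: arcs_def)
    moreover have "map (id(e := e)) (crossings D ! j) = crossings D ! j" if "j < ncr D" for j
      using fresh_map[of "crossings D ! j" e e] that by simp
    ultimately have "hopf D c0 D' u l r e e h0 h1 (crossings D)"
      using od on_loop(1-4) by (auto simp: hopf_def hopf_axioms_def)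
    then show ?thesis by blast
  qed
qed

theorem theoremX6p1:
  fixes D D' :: link_diagram and u l r :: nat and i j :: int
  assumes "is_diagram D" and "hopf_sum D u l r D'"
  shows "short_exact_sequence
           (homology D (i - 2) (j - 4) :: (estate \<Rightarrow> 'r::ring) set monoid)
           (homology D' i j)
           (homology D (i + 2) (j + 4))
           (beta_h D u r D' i j)
           (alpha_h D D' i j)
         \<and> (\<forall>(a::'r). \<forall>X \<in> carrier (homology D (i + 2) (j + 4)).
              alpha_h D D' i j (scale D (i + 2) (j + 4) a X)
                = scale D' i j a (alpha_h D D' i j X))
         \<and> (\<forall>(a::'r). \<forall>X \<in> carrier (homology D' i j).
              beta_h D u r D' i j (scale D' i j a X)
                = scale D (i - 2) (j - 4) a (beta_h D u r D' i j X))"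
proof -
  obtain c0 e w h0 h1 cs where "hopf D c0 D' u l r e w h0 h1 cs"
    using hopf_sum_hopf[OF assms] by blast
  then interpret hopf D c0 D' u l r e w h0 h1 cs .
  show ?thesis using homology_sequence alpha_scale beta_scale by blast
qed

end
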